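(* There exist a (complete) hyperbolic surface $X$ and rays $\alpha_n$ ($n\in\mathbb{N}$) and $\alpha$ on $X$, with $\alpha_n\to\alpha$ uniformly on compact sets, such that: (i) $d_\infty(\alpha_n,\alpha_m)<\infty$ but $d_\infty(\alpha_n,\alpha)=\infty$ for all $n,m$; (ii) $B_{\alpha_n}=B_{\alpha_m}$ but $B_{\alpha_n}\neq B_\alpha$ for all $n,m$.
   Context: Let $X$ be a complete Riemannian manifold with distance $d$. A ray is a half-geodesic $\alpha:[0,+\infty)\to X$ parametrized by arc-length with $d(\alpha(t),\alpha(s))=|t-s|$ for all $s,t\ge 0$. For rays $\alpha,\beta$ (possibly with different origins), one writes $d_\infty(\alpha,\beta)<\infty$ if $\sup_{t\ge 0} d(\alpha(t),\beta(t))<\infty$, and $d_\infty(\alpha,\beta)=\infty$ otherwise. The Busemann function of a ray $\alpha$ is the function of two variables $B_\alpha(x,y)=\lim_{t\to+\infty}\big(d(x,\alpha(t))-d(\alpha(t),y)\big)$, $x,y\in X$. A hyperbolic surface is a complete Riemannian surface of constant curvature $-1$. *)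

theory Defs
  imports "HOL-Analysis.Analysis"
begin

section \<open>Smooth maps between open subsets of Euclidean spaces\<close>

text \<open>Only meant for open \<open>S\<close>: the partial derivatives are two-sided.\<close>

primrec Ck_on ::
  "nat \<Rightarrow> ('e::euclidean_space \<Rightarrow> 'b::real_normed_vector) \<Rightarrow> 'e set \<Rightarrow> bool" where
  "Ck_on 0 f S \<longleftrightarrow> continuous_on S f"
| "Ck_on (Suc k) f S \<longleftrightarrow>
     f differentiable_on S \<and>
     (\<forall>b\<in>Basis. Ck_on k (\<lambda>x. frechet_derivative f (at x) b) S)"

definition smooth_on ::
  "('e::euclidean_space \<Rightarrow> 'b::real_normed_vector) \<Rightarrow> 'e set \<Rightarrow> bool" where
  "smooth_on f S \<longleftrightarrow> (\<forall>k. Ck_on k f S)"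


section \<open>Riemannian manifolds\<close>

text \<open>A manifold modelled on the Euclidean space \<open>'e\<close> is a topology together with an
  atlas, i.e. a set of charts \<open>(U, \<phi>)\<close>; only the values of \<open>\<phi>\<close> on \<open>U\<close> matter. The atlas
  need not be maximal.\<close>

type_synonym ('p, 'e) chart = "'p set \<times> ('p \<Rightarrow> 'e)"

abbreviation chart_image :: "('p, 'e) chart \<Rightarrow> 'e set" where
  "chart_image c \<equiv> snd c ` fst c"

definition transition :: "('p, 'e) chart \<Rightarrow> ('p, 'e) chart \<Rightarrow> 'e \<Rightarrow> 'e" where
  "transition c c' = snd c' \<circ> inv_into (fst c) (snd c)"

definition smooth_manifold ::
  "'p topology \<Rightarrow> ('p, 'e::euclidean_space) chart set \<Rightarrow> bool" where
  "smooth_manifold M A \<longleftrightarrow>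
     Hausdorff_space M \<and>
     (\<exists>\<B>. countable \<B> \<and> (\<forall>V\<in>\<B>. openin M V) \<and>
        (\<forall>W x. openin M W \<and> x \<in> W \<longrightarrow> (\<exists>V\<in>\<B>. x \<in> V \<and> V \<subseteq> W))) \<and>
     (\<Union>c\<in>A. fst c) = topspace M \<and>
     (\<forall>c\<in>A. openin M (fst c) \<and> open (chart_image c) \<and>
        homeomorphic_map (subtopology M (fst c)) (top_of_set (chart_image c)) (snd c)) \<and>
     (\<forall>c\<in>A. \<forall>c'\<in>A. smooth_on (transition c c') (snd c ` (fst c \<inter> fst c')))"

text \<open>A Riemannian metric is given by its local expressions: \<open>g c x u v\<close> is the inner product,
  at the point with coordinates \<open>x\<close> in the chart \<open>c\<close>, of the tangent vectors with coordinates
  \<open>u\<close> and \<open>v\<close>. The last condition is the transformation law of a covariant 2-tensor.\<close>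

type_synonym ('p, 'e) local_metric = "('p, 'e) chart \<Rightarrow> 'e \<Rightarrow> 'e \<Rightarrow> 'e \<Rightarrow> real"

definition riemannian_metric ::
  "('p, 'e::euclidean_space) chart set \<Rightarrow> ('p, 'e) local_metric \<Rightarrow> bool" where
  "riemannian_metric A g \<longleftrightarrow>
     (\<forall>c\<in>A. \<forall>x\<in>chart_image c.
        bilinear (g c x) \<and>
        (\<forall>u v. g c x u v = g c x v u) \<and>
        (\<forall>u. u \<noteq> 0 \<longrightarrow> g c x u u > 0)) \<and>
     (\<forall>c\<in>A. \<forall>u v. smooth_on (\<lambda>x. g c x u v) (chart_image c)) \<and>
     (\<forall>c\<in>A. \<forall>c'\<in>A. \<forall>p\<in>fst c \<inter> fst c'. \<forall>u v.
        g c (snd c p) u v =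
        g c' (snd c' p)
          (frechet_derivative (transition c c') (at (snd c p)) u)
          (frechet_derivative (transition c c') (at (snd c p)) v))"

definition riemannian_manifold ::
  "'p topology \<Rightarrow> ('p, 'e::euclidean_space) chart set \<Rightarrow> ('p, 'e) local_metric \<Rightarrow> bool" where
  "riemannian_manifold M A g \<longleftrightarrow>
     smooth_manifold M A \<and> connected_space M \<and> riemannian_metric A g"


section \<open>The Riemannian distance\<close>

text \<open>For \<open>a < b\<close>: \<open>\<gamma>\<close> is of class C1 on the closed interval (one-sided derivatives at the
  endpoints).\<close>

definition C1_curve_on ::
  "('p, 'e::euclidean_space) chart set \<Rightarrow> (real \<Rightarrow> 'p) \<Rightarrow> real \<Rightarrow> real \<Rightarrow> bool" where
  "C1_curve_on A \<gamma> a b \<longleftrightarrow>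
     (\<forall>c\<in>A. let J = {t\<in>{a..b}. \<gamma> t \<in> fst c} in
        \<exists>D. continuous_on J D \<and>
            (\<forall>t\<in>J. ((snd c \<circ> \<gamma>) has_vector_derivative D t) (at t within J)))"

definition piecewise_C1_path ::
  "'p topology \<Rightarrow> ('p, 'e::euclidean_space) chart set \<Rightarrow> (real \<Rightarrow> 'p) \<Rightarrow> bool" where
  "piecewise_C1_path M A \<gamma> \<longleftrightarrow>
     continuous_map (top_of_set {0..1}) M \<gamma> \<and>
     (\<exists>T. finite T \<and> {0, 1} \<subseteq> T \<and> T \<subseteq> {0..1} \<and>
        (\<forall>a\<in>T. \<forall>b\<in>T. a < b \<and> {a<..<b} \<inter> T = {} \<longrightarrow> C1_curve_on A \<gamma> a b))"

text \<open>By the transformation law, the speed does not depend on the chosen chart wherever the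
  curve is differentiable.\<close>

definition speed ::
  "('p, 'e::euclidean_space) chart set \<Rightarrow> ('p, 'e) local_metric \<Rightarrow> (real \<Rightarrow> 'p) \<Rightarrow> real \<Rightarrow> real"
  where
  "speed A g \<gamma> t =
     (let c = (SOME c. c \<in> A \<and> \<gamma> t \<in> fst c);
          v = vector_derivative (snd c \<circ> \<gamma>) (at t)
      in sqrt (g c (snd c (\<gamma> t)) v v))"

definition curve_length ::
  "('p, 'e::euclidean_space) chart set \<Rightarrow> ('p, 'e) local_metric \<Rightarrow> (real \<Rightarrow> 'p) \<Rightarrow> ennreal" where
  "curve_length A g \<gamma> = (\<integral>\<^sup>+t\<in>{0..1}. ennreal (speed A g \<gamma> t) \<partial>lborel)"

text \<open>Only meaningful on \<open>topspace M\<close>; there the infimum is finite when \<open>M\<close> is connected.\<close>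

definition riem_dist ::
  "'p topology \<Rightarrow> ('p, 'e::euclidean_space) chart set \<Rightarrow> ('p, 'e) local_metric
    \<Rightarrow> 'p \<Rightarrow> 'p \<Rightarrow> real" where
  "riem_dist M A g x y =
     enn2real (INF \<gamma>\<in>{\<gamma>. piecewise_C1_path M A \<gamma> \<and> \<gamma> 0 = x \<and> \<gamma> 1 = y}. curve_length A g \<gamma>)"

definition complete_riemannian_manifold ::
  "'p topology \<Rightarrow> ('p, 'e::euclidean_space) chart set \<Rightarrow> ('p, 'e) local_metric \<Rightarrow> bool" where
  "complete_riemannian_manifold M A g \<longleftrightarrow>
     riemannian_manifold M A g \<and> Metric_space.mcomplete (topspace M) (riem_dist M A g)"


section \<open>Curvature\<close>

text \<open>Here \<open>h\<close> is the local expression of a metric on an open subset of \<open>'e\<close>. The vector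
  \<open>christoffel h x u v\<close> is the Levi-Civita derivative at \<open>x\<close> of the constant vector field \<open>v\<close>
  in the direction \<open>u\<close>, as determined by the Koszul formula; its components for basis vectors
  \<open>u\<close> and \<open>v\<close> are the Christoffel symbols.\<close>

definition christoffel ::
  "('e::euclidean_space \<Rightarrow> 'e \<Rightarrow> 'e \<Rightarrow> real) \<Rightarrow> 'e \<Rightarrow> 'e \<Rightarrow> 'e \<Rightarrow> 'e" where
  "christoffel h x u v =
     (THE w. \<forall>z. 2 * h x w z =
        frechet_derivative (\<lambda>y. h y v z) (at x) u
        + frechet_derivative (\<lambda>y. h y u z) (at x) v
        - frechet_derivative (\<lambda>y. h y u v) (at x) z)"

text \<open>The curvature tensor \<open>R(u,v)w = \<nabla>\<^sub>u \<nabla>\<^sub>v w - \<nabla>\<^sub>v \<nabla>\<^sub>u w\<close> for constant (hence commuting)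
  fields \<open>u\<close>, \<open>v\<close>, \<open>w\<close>.\<close>

definition riem_curvature ::
  "('e::euclidean_space \<Rightarrow> 'e \<Rightarrow> 'e \<Rightarrow> real) \<Rightarrow> 'e \<Rightarrow> 'e \<Rightarrow> 'e \<Rightarrow> 'e \<Rightarrow> 'e" where
  "riem_curvature h x u v w =
     frechet_derivative (\<lambda>y. christoffel h y v w) (at x) u
     - frechet_derivative (\<lambda>y. christoffel h y u w) (at x) v
     + christoffel h x u (christoffel h x v w)
     - christoffel h x v (christoffel h x u w)"

definition sectional_curvature ::
  "('e::euclidean_space \<Rightarrow> 'e \<Rightarrow> 'e \<Rightarrow> real) \<Rightarrow> 'e \<Rightarrow> 'e \<Rightarrow> 'e \<Rightarrow> real" where
  "sectional_curvature h x u v =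
     h x (riem_curvature h x u v v) u / (h x u u * h x v v - (h x u v)\<^sup>2)"

definition constant_curvature ::
  "('p, 'e::euclidean_space) chart set \<Rightarrow> ('p, 'e) local_metric \<Rightarrow> real \<Rightarrow> bool" where
  "constant_curvature A g \<kappa> \<longleftrightarrow>
     (\<forall>c\<in>A. \<forall>x\<in>chart_image c. \<forall>u v. u \<noteq> v \<and> independent {u, v} \<longrightarrow>
        sectional_curvature (g c) x u v = \<kappa>)"

text \<open>The coordinate plane is \<open>complex\<close>, used only as a two-dimensional real Euclidean space.\<close>

definition hyperbolic_surface ::
  "'p topology \<Rightarrow> ('p, complex) chart set \<Rightarrow> ('p, complex) local_metric \<Rightarrow> bool" where
  "hyperbolic_surface M A g \<longleftrightarrow>
     complete_riemannian_manifold M A g \<and> constant_curvature A g (-1)"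


section \<open>Rays and Busemann functions\<close>

text \<open>In this section \<open>X\<close> is the set of points and \<open>d\<close> the distance. A ray is a curve on
  \<open>[0,\<infinity>)\<close>; its values at negative parameters are irrelevant. The condition on distances
  says in particular that a ray is locally distance-realizing with unit speed, i.e. a
  half-geodesic parametrized by arc-length.\<close>

definition is_ray :: "'p set \<Rightarrow> ('p \<Rightarrow> 'p \<Rightarrow> real) \<Rightarrow> (real \<Rightarrow> 'p) \<Rightarrow> bool" where
  "is_ray X d \<alpha> \<longleftrightarrow>
     (\<forall>t\<ge>0. \<alpha> t \<in> X) \<and> (\<forall>s\<ge>0. \<forall>t\<ge>0. d (\<alpha> t) (\<alpha> s) = \<bar>t - s\<bar>)"

definition rays_converge ::
  "('p \<Rightarrow> 'p \<Rightarrow> real) \<Rightarrow> (nat \<Rightarrow> real \<Rightarrow> 'p) \<Rightarrow> (real \<Rightarrow> 'p) \<Rightarrow> bool" where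
  "rays_converge d \<alpha>s \<alpha> \<longleftrightarrow>
     (\<forall>K. compact K \<and> K \<subseteq> {0..} \<longrightarrow>
        (\<forall>\<epsilon>>0. \<exists>N. \<forall>n\<ge>N. \<forall>t\<in>K. d (\<alpha>s n t) (\<alpha> t) < \<epsilon>))"

definition d_infinity ::
  "('p \<Rightarrow> 'p \<Rightarrow> real) \<Rightarrow> (real \<Rightarrow> 'p) \<Rightarrow> (real \<Rightarrow> 'p) \<Rightarrow> ereal" where
  "d_infinity d \<alpha> \<beta> = (SUP t\<in>{0..}. ereal (d (\<alpha> t) (\<beta> t)))"

text \<open>The limit exists for every ray, by the triangle inequality.\<close>

definition busemann :: "('p \<Rightarrow> 'p \<Rightarrow> real) \<Rightarrow> (real \<Rightarrow> 'p) \<Rightarrow> 'p \<Rightarrow> 'p \<Rightarrow> real" where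
  "busemann d \<alpha> x y = Lim at_top (\<lambda>t. d x (\<alpha> t) - d (\<alpha> t) y)"

definition same_busemann ::
  "'p set \<Rightarrow> ('p \<Rightarrow> 'p \<Rightarrow> real) \<Rightarrow> (real \<Rightarrow> 'p) \<Rightarrow> (real \<Rightarrow> 'p) \<Rightarrow> bool" where
  "same_busemann X d \<alpha> \<beta> \<longleftrightarrow> (\<forall>x\<in>X. \<forall>y\<in>X. busemann d \<alpha> x y = busemann d \<beta> x y)"

end

theory Submission
  imports Defs
begin

text \<open>
  Let \<open>P\<close> be the closed region of the upper half plane outside the half-discs with centre
  \<open>c\<^sub>k\<close> and radius \<open>R\<^sub>k\<close>, where \<open>R\<^sub>k\<^sup>2 = (c\<^sub>k\<^sup>2 + 1) / 2\<close> and \<open>c\<^sub>k\<^sub>+\<^sub>1 / c\<^sub>k\<close> tends to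
  infinity, and let the surface be the double of \<open>P\<close> along its boundary geodesics. The ray
  \<open>\<alpha>\<^sub>n\<close> leaves \<open>\<i>\<close> in the first copy towards \<open>c\<^sub>n\<close>, crosses the \<open>n\<close>-th edge, and then runs
  vertically upwards in the second copy. The choice of \<open>R\<^sub>k\<close> makes the images of a fixed horoball
  at infinity under the reflections in all edges equidistant from \<open>\<i>\<close>; this is why all \<open>\<alpha>\<^sub>n\<close>
  are minimizing. They are asymptotic to each other in the second copy, but converge to the vertical
  ray \<open>\<alpha>\<close> of the first copy. In the wide gaps between consecutive edges \<open>\<alpha>\<close> is far from the
  second copy. The Busemann functions differ on the pair of the two copies of \<open>\<i>\<close>.

  Distances are bounded from above by explicit curves and from below by functions that are
  infinitesimally 1-Lipschitz for the hyperbolic metric.\<close>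

section \<open>Hyperbolic metric and isometries of the half plane\<close>

text \<open>Minimality is certified by calibration, so no geodesic of the surface has to be
  classified: a function that is 1-Lipschitz on each copy and whose two halves agree on the edges
  bounds the length of every path, however often it changes copies. The function calibrating
  \<open>\<alpha>\<^sub>n\<close> is the logarithmic height on the second copy, continued to the
  first copy as the supremum over all edges of the logarithmic height of the mirror image. A
  supremum of 1-Lipschitz functions is 1-Lipschitz, and the halves agree on the edges because a
  reflection fixes its own edge and no reflection raises a point of \<open>P\<close>. At
  \<open>\<i>\<close> the term of edge \<open>k\<close> is
  \<open>ln (R\<^sub>k\<^sup>2 / (c\<^sub>k\<^sup>2 + 1))\<close>. One function calibrates all
  \<open>\<alpha>\<^sub>n\<close> as soon as these terms coincide, which is the origin of the radii;
  the common value is \<open>- ln 2\<close>, and the same \<open>ln 2\<close> later separates the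
  Busemann functions. These functions have corners, so the passage from pointwise slopes to path
  lengths must do without derivatives of the calibrating function.\<close>

lemma frechet_derivative_cong:
  assumes "open S" "x \<in> S" "\<And>y. y \<in> S \<Longrightarrow> f y = g y"
  shows "frechet_derivative f (at x) = frechet_derivative g (at x)"
proof -
  \<comment> \<open>\<open>frechet_derivative\<close> is a choice among the derivatives, so it
    agrees for functions with the same derivatives, even at points where there is none.\<close>
  have "(f has_derivative D) (at x) \<longleftrightarrow> (g has_derivative D) (at x)" for D
    using has_derivative_transform_within_open[OF _ assms(1,2)] assms(3) by metis
  then show ?thesis unfolding frechet_derivative_def by simp
qed

lemma differentiable_on_open_cong:
  assumes "open S" "\<And>y. y \<in> S \<Longrightarrow> f y = g y"
  shows "f differentiable_on S \<longleftrightarrow> g differentiable_on S"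
  using assms(2) by (auto simp: differentiable_on_def intro: differentiable_transform_within[where d=1])

lemma Ck_on_cong:
  assumes "open S" "\<And>y. y \<in> S \<Longrightarrow> f y = g y"
  shows "Ck_on k f S \<longleftrightarrow> Ck_on k g S"
  using assms(2)
proof (induction k arbitrary: f g)
  case 0
  then show ?case by (simp cong: continuous_on_cong)
next
  case (Suc k)
  have "Ck_on k (\<lambda>x. frechet_derivative f (at x) b) S = Ck_on k (\<lambda>x. frechet_derivative g (at x) b) S" for b
    by (rule Suc.IH) (metis frechet_derivative_cong[OF assms(1)] Suc.prems)
  then show ?case
    using differentiable_on_open_cong[OF assms(1), of f g] Suc.prems by simp
qed

lemma smooth_on_cong:
  assumes "open S" "\<And>y. y \<in> S \<Longrightarrow> f y = g y"
  shows "smooth_on f S \<longleftrightarrow> smooth_on g S"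
  using Ck_on_cong[OF assms] by (simp add: smooth_on_def)

lemma Ck_on_subset: "Ck_on k f S \<Longrightarrow> T \<subseteq> S \<Longrightarrow> Ck_on k f T"
  by (induction k arbitrary: f) (auto intro: continuous_on_subset differentiable_on_subset)

lemma smooth_on_subset: "smooth_on f S \<Longrightarrow> T \<subseteq> S \<Longrightarrow> smooth_on f T"
  by (auto simp: smooth_on_def intro: Ck_on_subset)

text \<open>Replaces the choice operator in the recursion of \<open>Ck_on\<close> by an explicit
  derivative formula; all smoothness proofs go through this rule.\<close>

lemma Ck_on_SucI:
  assumes "open S" "\<And>x. x \<in> S \<Longrightarrow> (f has_derivative f' x) (at x)"
    "\<And>b. b \<in> Basis \<Longrightarrow> Ck_on k (\<lambda>x. f' x b) S"
  shows "Ck_on (Suc k) f S"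
proof -
  have "f differentiable_on S"
    using assms(2) by (meson differentiableI differentiable_at_imp_differentiable_on)
  moreover have "Ck_on k (\<lambda>x. frechet_derivative f (at x) b) S \<longleftrightarrow> Ck_on k (\<lambda>x. f' x b) S" for b
    by (rule Ck_on_cong[OF assms(1)]) (metis assms(2) frechet_derivative_at)
  ultimately show ?thesis using assms(3) by simp
qed

lemma Ck_on_const: "open S \<Longrightarrow> Ck_on k (\<lambda>x. c) S"
proof (induction k arbitrary: c)
  case (Suc k)
  show ?case
    by (rule Ck_on_SucI[OF Suc.prems, where f' = "\<lambda>_ _. 0"]) (auto simp: Suc)
qed auto

lemma smooth_on_id: "open S \<Longrightarrow> smooth_on id S"
proof -
  assume S: "open S"
  have "Ck_on k id S" for k
  proof (cases k)
    case (Suc m)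
    show ?thesis unfolding Suc
      by (rule Ck_on_SucI[OF S, where f' = "\<lambda>_ h. h"]) (auto simp: id_def Ck_on_const[OF S])
  qed auto
  then show ?thesis by (simp add: smooth_on_def)
qed

section \<open>The half plane metric and its curvature\<close>

abbreviation upper_half_plane :: "complex set" where
  "upper_half_plane \<equiv> {z. 0 < Im z}"

lemma open_upper_half_plane: "open upper_half_plane"
  by (simp add: open_halfspace_Im_gt)

lemma convex_upper_half_plane: "convex upper_half_plane"
  by (simp add: convex_halfspace_Im_gt)

text \<open>The chart argument is ignored: every chart takes values in the half plane and chart
  changes are isometries of it, so one expression serves all charts.\<close>

definition hyp_metric :: "'c \<Rightarrow> complex \<Rightarrow> complex \<Rightarrow> complex \<Rightarrow> real" where
  "hyp_metric c x u v = (u \<bullet> v) / (Im x)\<^sup>2"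

lemma hyp_metric_has_derivative:
  assumes "0 < Im x"
  shows "((\<lambda>x. a / (Im x) ^ n) has_derivative (\<lambda>h. - real n * a * Im h / (Im x) ^ Suc n)) (at x)"
proof -
  have "((\<lambda>x. a / (Im x) ^ n) has_derivative
      (\<lambda>h. - (a * (real n * Im h * Im x ^ (n - 1))) / (Im x ^ n * Im x ^ n))) (at x)"
    using assms by (auto intro!: derivative_eq_intros simp: field_simps)
  moreover have "- (a * (real n * h * Im x ^ (n - 1))) / (Im x ^ n * Im x ^ n)
      = - real n * a * h / (Im x) ^ Suc n" for h
    using assms by (cases n) (auto simp: field_simps)
  ultimately show ?thesis by simp
qed

text \<open>The functions \<open>a / (Im x) ^ n\<close>, for all \<open>a\<close> and
  \<open>n\<close> together, are closed under partial derivatives, so the induction runs with both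
  arbitrary.\<close>

lemma Ck_on_hyp_metric: "Ck_on k (\<lambda>x. a / (Im x) ^ n) upper_half_plane"
proof (induction k arbitrary: a n)
  case 0
  show ?case by (auto intro!: continuous_intros)
next
  case (Suc k)
  show ?case
  proof (rule Ck_on_SucI[OF open_upper_half_plane hyp_metric_has_derivative])
    show "Ck_on k (\<lambda>x. - real n * a * Im b / Im x ^ Suc n) upper_half_plane" for b
      by (rule Suc.IH)
  qed auto
qed

lemma smooth_on_hyp_metric: "smooth_on (\<lambda>x. hyp_metric c x u v) upper_half_plane"
  using Ck_on_hyp_metric[of _ "u \<bullet> v" 2] by (simp add: smooth_on_def hyp_metric_def)

lemma hyp_metric_derivative:
  assumes "0 < Im x"
  shows "frechet_derivative (\<lambda>y. hyp_metric c y u v) (at x) h = - 2 * (u \<bullet> v) * Im h / (Im x) ^ 3"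
proof -
  have "((\<lambda>y. hyp_metric c y u v) has_derivative (\<lambda>h. - 2 * (u \<bullet> v) * Im h / (Im x) ^ 3)) (at x)"
    using hyp_metric_has_derivative[OF assms, of "u \<bullet> v" 2]
    by (simp add: hyp_metric_def numeral_3_eq_3)
  then show ?thesis by (simp add: frechet_derivative_at[symmetric])
qed

text \<open>The classical Christoffel symbols of the half plane combine into a single complex
  product, which turns the curvature into a computation with complex numbers.\<close>

lemma christoffel_hyp_metric:
  assumes "0 < Im x"
  shows "christoffel (hyp_metric c) x u v = \<i> * u * v / of_real (Im x)"
  unfolding christoffel_def
proof (rule the_equality)
  define y where "y = Im x"
  have y: "y > 0" using assms y_def by simp
  \<comment> \<open>The Koszul formula with the common factor \<open>2 / y ^ 3\<close>
    cancelled.\<close>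
  have *: "2 * hyp_metric c x w z = frechet_derivative (\<lambda>y. hyp_metric c y v z) (at x) u +
          frechet_derivative (\<lambda>y. hyp_metric c y u z) (at x) v -
          frechet_derivative (\<lambda>y. hyp_metric c y u v) (at x) z
     \<longleftrightarrow> w \<bullet> z * y = - (v \<bullet> z) * Im u - (u \<bullet> z) * Im v + (u \<bullet> v) * Im z" for w z
  proof -
    have "2 * hyp_metric c x w z = 2 * (w \<bullet> z * y) / y ^ 3"
      using y by (simp add: hyp_metric_def y_def[symmetric] power3_eq_cube power2_eq_square)
    then show ?thesis
      unfolding hyp_metric_derivative[OF assms] y_def[symmetric]
      using y by (simp add: field_simps) (auto simp: algebra_simps)
  qed
  show "\<forall>z. 2 * hyp_metric c x (\<i> * u * v / of_real (Im x)) z = frechet_derivative (\<lambda>y. hyp_metric c y v z) (at x) u +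
          frechet_derivative (\<lambda>y. hyp_metric c y u z) (at x) v -
          frechet_derivative (\<lambda>y. hyp_metric c y u v) (at x) z"
    unfolding * y_def[symmetric]
    using y by (auto simp: inner_complex_def field_simps)
  fix w
  assume "\<forall>z. 2 * hyp_metric c x w z = frechet_derivative (\<lambda>y. hyp_metric c y v z) (at x) u +
          frechet_derivative (\<lambda>y. hyp_metric c y u z) (at x) v -
          frechet_derivative (\<lambda>y. hyp_metric c y u v) (at x) z"
  then have "w \<bullet> z * y = - (v \<bullet> z) * Im u - (u \<bullet> z) * Im v + (u \<bullet> v) * Im z" for z
    unfolding * by blast
  \<comment> \<open>Testing against the basis vectors \<open>1\<close> and \<open>\<i>\<close>
    yields both coordinates of \<open>w\<close>, hence the uniqueness that \<open>THE\<close> asks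
    for.\<close>
  from this[of 1] this[of \<i>]
  show "w = \<i> * u * v / of_real (Im x)"
    unfolding y_def[symmetric] using y
    by (auto simp: inner_complex_def complex_eq_iff field_simps)
qed

lemma christoffel_derivative:
  assumes "0 < Im x"
  shows "frechet_derivative (\<lambda>y. christoffel (hyp_metric c) y u v) (at x) h
    = - \<i> * u * v * of_real (Im h) / of_real (Im x)^2"
proof -
  have "((\<lambda>y. \<i> * u * v / of_real (Im y)) has_derivative
      (\<lambda>h. - \<i> * u * v * of_real (Im h) / of_real (Im x)^2)) (at x)"
    using assms by (auto intro!: derivative_eq_intros ext simp: field_simps power2_eq_square)
  from frechet_derivative_at[OF this]
  have "frechet_derivative (\<lambda>y. \<i> * u * v / of_real (Im y)) (at x) h
      = - \<i> * u * v * of_real (Im h) / of_real (Im x)^2" by metis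
  moreover have "frechet_derivative (\<lambda>y. christoffel (hyp_metric c) y u v) (at x)
      = frechet_derivative (\<lambda>y. \<i> * u * v / of_real (Im y)) (at x)"
    by (rule frechet_derivative_cong[OF open_upper_half_plane])
      (use assms christoffel_hyp_metric in auto)
  ultimately show ?thesis by simp
qed

lemma sectional_curvature_hyp_metric:
  assumes "0 < Im x" "u \<noteq> v" "independent {u, v}"
  shows "sectional_curvature (hyp_metric c) x u v = -1"
proof -
  define y where "y = Im x"
  have y: "y > 0" using assms y_def by simp
  \<comment> \<open>The determinant of \<open>u\<close> and \<open>v\<close>. Numerator and
    denominator of the sectional curvature turn out to be \<open>- \<Delta>^2 / y^4\<close> and
    \<open>\<Delta>^2 / y^4\<close>.\<close>
  define \<Delta> where "\<Delta> = Re u * Im v - Im u * Re v"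
  have nz: "\<Delta> \<noteq> 0"
  proof
    assume "\<Delta> = 0"
    then have *: "Re u * Im v = Im u * Re v" by (simp add: \<Delta>_def)
    have "v \<noteq> 0" "u \<noteq> 0" using assms(3) dependent_zero by blast+
    have "\<exists>k. u = k *\<^sub>R v"
    proof (cases "Re v = 0")
      case True
      then have "Im v \<noteq> 0" using \<open>v \<noteq> 0\<close> by (simp add: complex_eq_iff)
      with True * show ?thesis
        by (intro exI[of _ "Im u / Im v"]) (auto simp: complex_eq_iff)
    next
      case False
      with * show ?thesis
        by (intro exI[of _ "Re u / Re v"]) (auto simp: complex_eq_iff field_simps)
    qed
    then have "u \<in> span {v}" by (auto simp: span_singleton)
    then show False using assms(2,3) unfolding dependent_def by auto
  qed
  have R: "riem_curvature (hyp_metric c) x u v v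
      = \<i> * v * (u * of_real (Im v) - v * of_real (Im u)) / of_real y ^ 2"
    unfolding riem_curvature_def christoffel_derivative[OF assms(1)]
      christoffel_hyp_metric[OF assms(1)] y_def[symmetric]
    using y by (simp add: field_simps power2_eq_square)
  have n: "(\<i> * v * (u * of_real (Im v) - v * of_real (Im u))) \<bullet> u = - \<Delta>\<^sup>2"
    unfolding \<Delta>_def by (simp add: inner_complex_def power2_eq_square algebra_simps)
  have "(w / of_real y ^ 2) \<bullet> u = (w \<bullet> u) / y ^ 2" for w :: complex
    by (simp add: inner_complex_def add_divide_distrib flip: of_real_power)
  with n have "riem_curvature (hyp_metric c) x u v v \<bullet> u = - \<Delta>\<^sup>2 / y^2"
    unfolding R by metis
  then have N: "hyp_metric c x (riem_curvature (hyp_metric c) x u v v) u = - \<Delta>\<^sup>2 / y^4"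
    unfolding hyp_metric_def y_def[symmetric] by (simp add: field_simps flip: power_add)
  have "(u \<bullet> u) * (v \<bullet> v) - (u \<bullet> v)\<^sup>2 = \<Delta>\<^sup>2"
    unfolding \<Delta>_def by (simp add: inner_complex_def power2_eq_square algebra_simps)
  then have D: "hyp_metric c x u u * hyp_metric c x v v - (hyp_metric c x u v)\<^sup>2 = \<Delta>\<^sup>2 / y^4"
    unfolding hyp_metric_def y_def[symmetric]
    by (simp add: power_divide flip: power_mult power_add diff_divide_distrib)
  show ?thesis unfolding sectional_curvature_def N D using nz y by simp
qed

section \<open>Inversions as isometries of the half plane\<close>

definition inversion :: "real \<Rightarrow> real \<Rightarrow> complex \<Rightarrow> complex" where
  "inversion a r z = of_real a + of_real (r\<^sup>2) / cnj (z - of_real a)"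

text \<open>With \<open>d\<close> the hyperbolic distance, \<open>chord z w = 2 * sinh (d z w / 2)\<close>, which agrees with
  \<open>d z w\<close> to first order.\<close>

definition chord :: "complex \<Rightarrow> complex \<Rightarrow> real" where
  "chord z w = norm (z - w) / sqrt (Im z * Im w)"

text \<open>Not closed under composition: the chart changes of the double are the identity and
  single reflections, so composites never arise.\<close>

definition hyp_isoms :: "(complex \<Rightarrow> complex) set" where
  "hyp_isoms = insert id {inversion a r | a r. 0 < r}"

lemma cnj_neq_of_real: "z \<noteq> of_real a \<Longrightarrow> cnj z \<noteq> of_real a"
  by (metis complex_cnj_cnj complex_cnj_complex_of_real)

lemma norm_inversion: "norm (inversion a r z - of_real a) = r\<^sup>2 / norm (z - of_real a)"
  unfolding inversion_def
  by (simp only: add_diff_cancel_left' norm_divide complex_mod_cnj norm_of_real abs_power2 power2_abs)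

lemma Im_inversion: "Im (inversion a r z) = r\<^sup>2 * Im z / (norm (z - of_real a))\<^sup>2"
  unfolding inversion_def by (simp add: Im_divide cmod_power2 field_simps)

lemma inversion_involution:
  assumes "z \<noteq> of_real a" "r > 0"
  shows "inversion a r (inversion a r z) = z"
  using assms unfolding inversion_def by (simp add: field_simps)

lemma inversion_fixed:
  assumes "norm (z - of_real a) = r" "r > 0"
  shows "inversion a r z = z"
proof -
  have "z \<noteq> of_real a" using assms by auto
  moreover have "(z - of_real a) * cnj (z - of_real a) = of_real (r\<^sup>2)"
    using complex_norm_square[of "z - of_real a"] assms(1) by simp
  ultimately show ?thesis unfolding inversion_def
    by (simp add: field_simps del: of_real_power complex_cnj_diff)
qed

lemma inversion_diff:
  assumes "z \<noteq> of_real a" "w \<noteq> of_real a"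
  shows "norm (inversion a r z - inversion a r w)
    = r\<^sup>2 * norm (z - w) / (norm (z - of_real a) * norm (w - of_real a))"
proof -
  have "inversion a r z - inversion a r w
      = of_real (r\<^sup>2) * cnj (w - z) / (cnj (z - of_real a) * cnj (w - of_real a))"
  proof -
    have "k / p - k / q = k * (q - p) / (p * q)" if "p \<noteq> 0" "q \<noteq> 0" for k p q :: complex
      using that by (simp add: field_simps)
    from this[of "cnj (z - of_real a)" "cnj (w - of_real a)" "of_real (r\<^sup>2)"]
    show ?thesis using assms unfolding inversion_def
      by (simp add: cnj_neq_of_real del: of_real_power)
  qed
  then show ?thesis
    by (simp only: norm_mult norm_divide complex_mod_cnj norm_of_real abs_power2 power2_abs norm_minus_commute)
qed

lemma inversion_has_derivative:
  assumes "z \<noteq> of_real a"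
  shows "(inversion a r has_derivative (\<lambda>h. - of_real (r\<^sup>2) * cnj h / (cnj (z - of_real a))\<^sup>2)) (at z)"
  using cnj_neq_of_real[OF assms] unfolding inversion_def
  by (auto intro!: derivative_eq_intros ext simp: field_simps power2_eq_square)

text \<open>Again a family closed under partial derivatives. The constant \<open>b\<close> admits
  the inversion itself; its derivatives all fall under \<open>b = 0\<close>.\<close>

lemma Ck_on_cnj_pole:
  assumes "open S" "\<And>z. z \<in> S \<Longrightarrow> z \<noteq> of_real c"
  shows "Ck_on k (\<lambda>z. b + a / (cnj z - of_real c) ^ n) S"
proof (induction k arbitrary: a b n)
  case 0
  have "cnj z \<noteq> of_real c" if "z \<in> S" for z
    using assms(2)[OF that] by (metis complex_cnj_cnj complex_cnj_complex_of_real)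
  then show ?case by (auto intro!: continuous_intros)
next
  case (Suc k)
  show ?case
  proof (rule Ck_on_SucI[OF assms(1), where
        f' = "\<lambda>z h. - of_nat n * a * cnj h / (cnj z - of_real c) ^ Suc n"])
    fix z assume "z \<in> S"
    then have nz: "cnj z \<noteq> of_real c"
      using assms(2) by (metis complex_cnj_cnj complex_cnj_complex_of_real)
    have "((\<lambda>z. b + a / (cnj z - of_real c) ^ n) has_derivative
      (\<lambda>h. - (a * (of_nat n * cnj h * (cnj z - of_real c) ^ (n - 1)))
         / ((cnj z - of_real c) ^ n * (cnj z - of_real c) ^ n))) (at z)"
      using nz by (auto intro!: derivative_eq_intros ext simp: field_simps)
    moreover have "- (a * (of_nat n * h * p ^ (n - 1))) / (p ^ n * p ^ n) = - of_nat n * a * h / p ^ Suc n"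
      if "p \<noteq> 0" for h p :: complex
      using that by (cases n) (auto simp: field_simps)
    from this[of "cnj z - of_real c"] nz
    have "- (a * (of_nat n * h * (cnj z - of_real c) ^ (n - 1)))
         / ((cnj z - of_real c) ^ n * (cnj z - of_real c) ^ n)
       = - of_nat n * a * h / (cnj z - of_real c) ^ Suc n" for h
      by simp
    ultimately show "((\<lambda>z. b + a / (cnj z - of_real c) ^ n) has_derivative
      (\<lambda>h. - of_nat n * a * cnj h / (cnj z - of_real c) ^ Suc n)) (at z)" by simp
  next
    fix h :: complex
    show "Ck_on k (\<lambda>z. - of_nat n * a * cnj h / (cnj z - of_real c) ^ Suc n) S"
      using Suc.IH[of 0 "- of_nat n * a * cnj h" "Suc n"] by simp
  qed
qed

lemma hyp_isoms_smooth:
  assumes "f \<in> hyp_isoms"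
  shows "smooth_on f upper_half_plane"
  using assms unfolding hyp_isoms_def
proof safe
  show "smooth_on id upper_half_plane" by (simp add: smooth_on_id open_upper_half_plane)
  fix a r :: real
  have "Ck_on k (\<lambda>z. of_real a + of_real (r\<^sup>2) / (cnj z - of_real a) ^ 1) upper_half_plane" for k
    by (rule Ck_on_cnj_pole[OF open_upper_half_plane]) auto
  then show "smooth_on (inversion a r) upper_half_plane"
    unfolding smooth_on_def inversion_def by simp
qed

lemma hyp_isoms_Im:
  assumes "f \<in> hyp_isoms" "0 < Im z"
  shows "0 < Im (f z)"
proof -
  have "z \<noteq> of_real a" for a using assms(2) by auto
  then show ?thesis using assms unfolding hyp_isoms_def by (auto simp: Im_inversion)
qed

text \<open>An inversion multiplies the Euclidean distance of two points and the geometric mean of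
  their heights by the same factor \<open>r^2 / (p * q)\<close>.\<close>

lemma chord_isom:
  assumes "f \<in> hyp_isoms" "0 < Im z" "0 < Im w"
  shows "chord (f z) (f w) = chord z w"
  using assms(1) unfolding hyp_isoms_def
proof safe
  show "chord (id z) (id w) = chord z w" by simp
  fix a r :: real assume r: "0 < r"
  have nz: "z \<noteq> of_real a" "w \<noteq> of_real a" using assms(2,3) by auto
  define p q where "p = norm (z - of_real a)" and "q = norm (w - of_real a)"
  have pq: "p > 0" "q > 0" using nz by (auto simp: p_def q_def)
  have "sqrt (Im (inversion a r z) * Im (inversion a r w)) = sqrt ((r\<^sup>2 / (p * q))\<^sup>2 * (Im z * Im w))"
    by (simp add: Im_inversion p_def q_def field_simps power2_eq_square)
  also have "\<dots> = r\<^sup>2 / (p * q) * sqrt (Im z * Im w)"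
    using pq by (simp add: real_sqrt_mult)
  finally show "chord (inversion a r z) (inversion a r w) = chord z w"
    unfolding chord_def inversion_diff[OF nz] p_def[symmetric] q_def[symmetric]
    using pq r by (simp add: field_simps)
qed

lemma hyp_isoms_derivative:
  assumes "f \<in> hyp_isoms" "0 < Im z"
  obtains f' where "(f has_derivative f') (at z)"
    "\<And>u v. f' u \<bullet> f' v / (Im (f z))\<^sup>2 = u \<bullet> v / (Im z)\<^sup>2"
  using assms(1) unfolding hyp_isoms_def
proof safe
  assume "f = id"
  then show thesis using that[of "\<lambda>h. h"] by (auto simp: id_def)
next
  fix a r :: real assume r: "0 < r" "f = inversion a r"
  have nz: "z \<noteq> of_real a" using assms(2) by auto
  \<comment> \<open>The derivative is conjugation followed by multiplication with \<open>k\<close>,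
    hence conformal with factor \<open>norm k\<close>; the height changes by the same
    factor.\<close>
  define k where "k = - of_real (r\<^sup>2) / (cnj (z - of_real a))\<^sup>2"
  have D: "(f has_derivative (\<lambda>h. k * cnj h)) (at z)"
    using inversion_has_derivative[OF nz, of r] r by (simp add: k_def)
  have "(k * cnj u) \<bullet> (k * cnj v) = (norm k)\<^sup>2 * (u \<bullet> v)" for u v
    unfolding cmod_power2 by (simp add: inner_complex_def power2_eq_square algebra_simps)
  moreover have "norm k = r\<^sup>2 / (norm (z - of_real a))\<^sup>2"
    unfolding k_def by (simp only: norm_divide norm_minus_cancel norm_power complex_mod_cnj norm_of_real abs_power2 power2_abs)
  moreover have "norm (z - of_real a) > 0" using nz by simp
  ultimately have "(k * cnj u) \<bullet> (k * cnj v) / (Im (f z))\<^sup>2 = u \<bullet> v / (Im z)\<^sup>2" for u v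
    using r(1) assms(2) unfolding r(2) Im_inversion
    by (simp add: divide_simps power2_eq_square)
  with D show thesis by (rule that)
qed

lemma hyp_isoms_continuous:
  assumes "f \<in> hyp_isoms"
  shows "continuous_on upper_half_plane f"
  using hyp_isoms_smooth[OF assms] unfolding smooth_on_def by (metis Ck_on.simps(1))

section \<open>Surfaces glued from charts in the half plane\<close>

text \<open>Reading the topology off the atlas avoids a quotient construction for the double; of the
  manifold axioms only the Hausdorff property then needs an argument beyond the atlas.\<close>

definition atlas_topology :: "('p, 'e::euclidean_space) chart set \<Rightarrow> 'p topology" where
  "atlas_topology A = topology (\<lambda>U. U \<subseteq> (\<Union>c\<in>A. fst c) \<and> (\<forall>c\<in>A. open (snd c ` (U \<inter> fst c))))"

text \<open>A single isometry must serve the whole overlap of two charts, connected or not. The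
  double satisfies this because the overlap of two distinct charts lies in one copy.\<close>

locale half_plane_atlas =
  fixes A :: "('p, complex) chart set"
  assumes chart_inj: "c \<in> A \<Longrightarrow> inj_on (snd c) (fst c)"
    and open_overlap: "c \<in> A \<Longrightarrow> c' \<in> A \<Longrightarrow> open (snd c ` (fst c \<inter> fst c'))"
    and chart_upper: "c \<in> A \<Longrightarrow> p \<in> fst c \<Longrightarrow> 0 < Im (snd c p)"
    and overlap_isom: "c \<in> A \<Longrightarrow> c' \<in> A \<Longrightarrow>
      \<exists>f\<in>hyp_isoms. \<forall>p\<in>fst c \<inter> fst c'. snd c' p = f (snd c p)"
    and countable_atlas: "countable A"
begin

abbreviation M where "M \<equiv> atlas_topology A"

lemma openin_atlas:
  "openin M U \<longleftrightarrow> U \<subseteq> (\<Union>c\<in>A. fst c) \<and> (\<forall>c\<in>A. open (snd c ` (U \<inter> fst c)))"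
proof -
  have "istopology (\<lambda>U. U \<subseteq> (\<Union>c\<in>A. fst c) \<and> (\<forall>c\<in>A. open (snd c ` (U \<inter> fst c))))"
    unfolding istopology_def
  proof (intro conjI allI impI ballI; (elim conjE)?)
    fix S T c
    assume S: "\<forall>c\<in>A. open (snd c ` (S \<inter> fst c))" and T: "\<forall>c\<in>A. open (snd c ` (T \<inter> fst c))"
      and c: "c \<in> A"
    have "snd c ` (S \<inter> T \<inter> fst c) = snd c ` (S \<inter> fst c) \<inter> snd c ` (T \<inter> fst c)"
      using inj_on_image_Int[OF chart_inj[OF c], of "S \<inter> fst c" "T \<inter> fst c"]
      by (simp add: Int_ac)
    then show "open (snd c ` (S \<inter> T \<inter> fst c))" using S T c by auto
  next
    fix \<K> c assume K: "\<forall>K\<in>\<K>. K \<subseteq> (\<Union>c\<in>A. fst c) \<and> (\<forall>c\<in>A. open (snd c ` (K \<inter> fst c)))" "c \<in> A"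
    have "snd c ` (\<Union>\<K> \<inter> fst c) = (\<Union>K\<in>\<K>. snd c ` (K \<inter> fst c))" by auto
    then show "open (snd c ` (\<Union>\<K> \<inter> fst c))" using K by auto
  qed auto
  from topology_inverse'[OF this] show ?thesis unfolding atlas_topology_def by simp
qed

lemma openin_chart: "c \<in> A \<Longrightarrow> openin M (fst c)"
  using open_overlap by (auto simp: openin_atlas Int_commute)

lemma topspace_atlas: "topspace M = (\<Union>c\<in>A. fst c)"
proof
  show "topspace M \<subseteq> (\<Union>c\<in>A. fst c)" using openin_atlas[of "topspace M"] by simp
  show "(\<Union>c\<in>A. fst c) \<subseteq> topspace M" using openin_chart openin_subset by blast
qed

lemma openin_chart_preimage:
  assumes c: "c \<in> A" and B: "open B"
  shows "openin M {p \<in> fst c. snd c p \<in> B}"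
  unfolding openin_atlas
proof (intro conjI ballI)
  show "{p \<in> fst c. snd c p \<in> B} \<subseteq> (\<Union>c\<in>A. fst c)" using c by auto
  fix c' assume c': "c' \<in> A"
  obtain f where f: "f \<in> hyp_isoms" "\<forall>p\<in>fst c' \<inter> fst c. snd c p = f (snd c' p)"
    using overlap_isom[OF c' c] by blast
  let ?S = "snd c' ` (fst c' \<inter> fst c)"
  have "snd c' ` ({p \<in> fst c. snd c p \<in> B} \<inter> fst c') = ?S \<inter> f -` B"
    using f(2) by auto
  moreover have "continuous_on ?S f"
    using hyp_isoms_continuous[OF f(1)] by (rule continuous_on_subset) (use chart_upper[OF c'] in auto)
  ultimately show "open (snd c' ` ({p \<in> fst c. snd c p \<in> B} \<inter> fst c'))"
    using continuous_open_preimage[OF _ open_overlap[OF c' c] B] by metis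
qed

lemma open_chart_image: "c \<in> A \<Longrightarrow> open (chart_image c)"
  using open_overlap[of c c] by simp

lemma homeomorphic_chart:
  assumes c: "c \<in> A"
  shows "homeomorphic_map (subtopology M (fst c)) (top_of_set (chart_image c)) (snd c)"
proof (rule bijective_open_imp_homeomorphic_map)
  have sub: "fst c \<subseteq> topspace M" using c topspace_atlas by auto
  then have ts: "topspace (subtopology M (fst c)) = fst c" by (simp add: inf.absorb2)
  show "continuous_map (subtopology M (fst c)) (top_of_set (chart_image c)) (snd c)"
    unfolding continuous_map_in_subtopology
  proof
    show "continuous_map (subtopology M (fst c)) euclidean (snd c)"
      unfolding continuous_map
    proof (intro conjI allI impI)
      fix U :: "complex set" assume U: "openin euclidean U"
      have "openin M {p \<in> fst c. snd c p \<in> U}" using openin_chart_preimage[OF c] U by auto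
      then show "openin (subtopology M (fst c)) {p \<in> topspace (subtopology M (fst c)). snd c p \<in> U}"
        unfolding ts openin_subtopology by (intro exI[of _ "{p \<in> fst c. snd c p \<in> U}"]) auto
    qed auto
    show "snd c \<in> topspace (subtopology M (fst c)) \<rightarrow> chart_image c" unfolding ts by auto
  qed
  show "open_map (subtopology M (fst c)) (top_of_set (chart_image c)) (snd c)"
    unfolding open_map_def
  proof (intro allI impI)
    fix U assume "openin (subtopology M (fst c)) U"
    then obtain V where V: "openin M V" "U = V \<inter> fst c" unfolding openin_subtopology by auto
    then have "open (snd c ` U)" using openin_atlas c by auto
    then show "openin (top_of_set (chart_image c)) (snd c ` U)"
      using V by (metis Int_lower2 image_mono open_subset)
  qed
  show "snd c ` topspace (subtopology M (fst c)) = topspace (top_of_set (chart_image c))"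
    unfolding ts by simp
  show "inj_on (snd c) (topspace (subtopology M (fst c)))" unfolding ts using chart_inj c by simp
qed

lemma second_countable_atlas:
  "\<exists>\<B>. countable \<B> \<and> (\<forall>V\<in>\<B>. openin M V) \<and>
        (\<forall>W x. openin M W \<and> x \<in> W \<longrightarrow> (\<exists>V\<in>\<B>. x \<in> V \<and> V \<subseteq> W))"
proof -
  obtain B :: "complex set set" where B: "countable B" "topological_basis B"
    using ex_countable_basis by auto
  define \<B> where "\<B> = (\<lambda>(c, b). {p \<in> fst c. snd c p \<in> b}) ` (A \<times> B)"
  have "countable \<B>" unfolding \<B>_def using B countable_atlas by auto
  moreover have "\<forall>V\<in>\<B>. openin M V"
    unfolding \<B>_def using openin_chart_preimage topological_basis_open[OF B(2)] by auto
  moreover have "\<exists>V\<in>\<B>. x \<in> V \<and> V \<subseteq> W" if W: "openin M W" "x \<in> W" for W x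
  proof -
    obtain c where c: "c \<in> A" "x \<in> fst c" using W unfolding openin_atlas by auto
    have "open (snd c ` (W \<inter> fst c))" using W c openin_atlas by auto
    then obtain b where b: "b \<in> B" "snd c x \<in> b" "b \<subseteq> snd c ` (W \<inter> fst c)"
      using topological_basisE[OF B(2), of "snd c ` (W \<inter> fst c)" "snd c x"] W c by auto
    have "{p \<in> fst c. snd c p \<in> b} \<subseteq> W"
    proof clarify
      fix p assume p: "p \<in> fst c" "snd c p \<in> b"
      then obtain w where "w \<in> W" "w \<in> fst c" "snd c p = snd c w" using b(3) by auto
      then show "p \<in> W" using inj_onD[OF chart_inj[OF c(1)], of p w] p by auto
    qed
    then show ?thesis using b c unfolding \<B>_def by (intro bexI[of _ "{p \<in> fst c. snd c p \<in> b}"]) auto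
  qed
  ultimately show ?thesis by blast
qed

lemma transition_isom:
  assumes "c \<in> A" "c' \<in> A"
  obtains f where "f \<in> hyp_isoms" "\<And>p. p \<in> fst c \<inter> fst c' \<Longrightarrow> snd c' p = f (snd c p)"
    "\<And>x. x \<in> snd c ` (fst c \<inter> fst c') \<Longrightarrow> transition c c' x = f x"
proof -
  obtain f where f: "f \<in> hyp_isoms" "\<And>p. p \<in> fst c \<inter> fst c' \<Longrightarrow> snd c' p = f (snd c p)"
    using overlap_isom[OF assms] by blast
  have "transition c c' x = f x" if "x \<in> snd c ` (fst c \<inter> fst c')" for x
    using that f(2) chart_inj[OF assms(1)] unfolding transition_def by auto
  with f show thesis using that by blast
qed

lemma smooth_manifold_atlas:
  assumes "Hausdorff_space M"
  shows "smooth_manifold M A"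
  unfolding smooth_manifold_def
proof (intro conjI ballI)
  fix c c' assume c: "c \<in> A" "c' \<in> A"
  obtain f where f: "f \<in> hyp_isoms" "\<And>x. x \<in> snd c ` (fst c \<inter> fst c') \<Longrightarrow> transition c c' x = f x"
    using transition_isom[OF c] by metis
  have "smooth_on f (snd c ` (fst c \<inter> fst c'))"
    by (rule smooth_on_subset[OF hyp_isoms_smooth[OF f(1)]]) (use chart_upper[OF c(1)] in auto)
  then show "smooth_on (transition c c') (snd c ` (fst c \<inter> fst c'))"
    using smooth_on_cong[OF open_overlap[OF c], of "transition c c'" f] f(2) by blast
qed (simp_all only: assms second_countable_atlas topspace_atlas openin_chart open_chart_image
    homeomorphic_chart)

section \<open>The metric and its curvature on an atlas\<close>

lemma riemannian_metric_atlas: "riemannian_metric A hyp_metric"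
  unfolding riemannian_metric_def
proof (intro conjI ballI allI impI)
  fix c x assume "c \<in> A" "x \<in> chart_image c"
  then have x: "0 < Im x" using chart_upper by blast
  show "bilinear (hyp_metric c x)"
    unfolding bilinear_def hyp_metric_def
    by (auto intro!: linearI simp: inner_add_left inner_add_right add_divide_distrib)
  show "hyp_metric c x u v = hyp_metric c x v u" for u v
    by (simp add: hyp_metric_def inner_commute)
  show "hyp_metric c x u u > 0" if "u \<noteq> 0" for u
    using that x by (simp add: hyp_metric_def)
next
  fix c u v assume "c \<in> A"
  then have "chart_image c \<subseteq> upper_half_plane" using chart_upper[of c] by auto
  then show "smooth_on (\<lambda>x. hyp_metric c x u v) (chart_image c)"
    by (rule smooth_on_subset[OF smooth_on_hyp_metric])
next
  fix c c' p u v assume c: "c \<in> A" "c' \<in> A" and p: "p \<in> fst c \<inter> fst c'"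
  obtain f where f: "f \<in> hyp_isoms" "\<And>p. p \<in> fst c \<inter> fst c' \<Longrightarrow> snd c' p = f (snd c p)"
      "\<And>x. x \<in> snd c ` (fst c \<inter> fst c') \<Longrightarrow> transition c c' x = f x"
    using transition_isom[OF c] by metis
  have "0 < Im (snd c p)" using chart_upper[OF c(1)] p by simp
  then obtain f' where f': "(f has_derivative f') (at (snd c p))"
    "\<And>u v. f' u \<bullet> f' v / (Im (f (snd c p)))\<^sup>2 = u \<bullet> v / (Im (snd c p))\<^sup>2"
    using hyp_isoms_derivative[OF f(1)] by metis
  have "frechet_derivative (transition c c') (at (snd c p)) = frechet_derivative f (at (snd c p))"
    by (rule frechet_derivative_cong[OF open_overlap[OF c]]) (use p f(3) in auto)
  also have "\<dots> = f'" using frechet_derivative_at[OF f'(1)] by simp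
  finally show "hyp_metric c (snd c p) u v = hyp_metric c' (snd c' p)
          (frechet_derivative (transition c c') (at (snd c p)) u)
          (frechet_derivative (transition c c') (at (snd c p)) v)"
    using f'(2)[of u v] f(2)[OF p] by (simp add: hyp_metric_def)
qed

lemma constant_curvature_atlas: "constant_curvature A hyp_metric (-1)"
  unfolding constant_curvature_def
proof (intro ballI allI impI, elim conjE)
  fix c x and u v :: complex assume "c \<in> A" "x \<in> chart_image c" and *: "u \<noteq> v" "independent {u, v}"
  then have "0 < Im x" using chart_upper[of c] by auto
  then show "sectional_curvature (hyp_metric c) x u v = -1"
    using * by (rule sectional_curvature_hyp_metric)
qed

section \<open>Curves seen in charts\<close>

lemma eventually_in_chart:
  assumes "continuous_map (top_of_set S) M \<gamma>" "t \<in> S" "c \<in> A" "\<gamma> t \<in> fst c" "0 < e"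
  shows "eventually (\<lambda>s. \<gamma> s \<in> fst c \<and> dist (snd c (\<gamma> s)) (snd c (\<gamma> t)) < e) (at t within S)"
proof -
  let ?U = "{p \<in> fst c. snd c p \<in> ball (snd c (\<gamma> t)) e}"
  have "openin (top_of_set S) {s \<in> S. \<gamma> s \<in> ?U}"
    using openin_continuous_map_preimage[OF assms(1) openin_chart_preimage[OF assms(3), of "ball (snd c (\<gamma> t)) e"]]
    by simp
  then obtain T where T: "open T" "{s \<in> S. \<gamma> s \<in> ?U} = S \<inter> T" unfolding openin_open by auto
  have "t \<in> {s \<in> S. \<gamma> s \<in> ?U}" using assms(2,4,5) by simp
  then have "t \<in> T" unfolding T(2) by simp
  then have "eventually (\<lambda>s. s \<in> T \<and> s \<in> S) (at t within S)"
    using T(1) unfolding eventually_at_topological by auto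
  then show ?thesis
  proof (rule eventually_mono)
    fix s assume "s \<in> T \<and> s \<in> S"
    then have "\<gamma> s \<in> ?U" using T(2) by blast
    then show "\<gamma> s \<in> fst c \<and> dist (snd c (\<gamma> s)) (snd c (\<gamma> t)) < e" by (auto simp: dist_commute)
  qed
qed

lemma continuous_chart_curve:
  assumes "continuous_map (top_of_set S) M \<gamma>" "t \<in> S" "c \<in> A" "\<gamma> t \<in> fst c"
  shows "((snd c \<circ> \<gamma>) \<longlongrightarrow> snd c (\<gamma> t)) (at t within S)"
proof (rule tendstoI)
  fix e :: real assume "0 < e"
  from eventually_in_chart[OF assms this]
  show "\<forall>\<^sub>F x in at t within S. dist ((snd c \<circ> \<gamma>) x) (snd c (\<gamma> t)) < e"
    by (rule eventually_mono) auto
qed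

text \<open>\<open>speed\<close> selects its chart by \<open>SOME\<close>; since chart changes
  preserve the metric, the speed can be computed in any chart around the point.\<close>

lemma speed_eq:
  assumes I: "open I" "t \<in> I" and \<gamma>: "continuous_map (top_of_set I) M \<gamma>"
    and c: "c \<in> A" "\<gamma> t \<in> fst c" and d: "((snd c \<circ> \<gamma>) has_vector_derivative d) (at t)"
  shows "speed A hyp_metric \<gamma> t = norm d / Im (snd c (\<gamma> t))"
proof -
  define c' where "c' = (SOME c. c \<in> A \<and> \<gamma> t \<in> fst c)"
  have c': "c' \<in> A" "\<gamma> t \<in> fst c'"
    using someI[of "\<lambda>c. c \<in> A \<and> \<gamma> t \<in> fst c"] c unfolding c'_def by auto
  obtain f where f: "f \<in> hyp_isoms" "\<And>p. p \<in> fst c \<inter> fst c' \<Longrightarrow> snd c' p = f (snd c p)"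
    using transition_isom[OF c(1) c'(1)] by metis
  have Im: "0 < Im (snd c (\<gamma> t))" using chart_upper[OF c] .
  then obtain f' where f': "(f has_derivative f') (at (snd c (\<gamma> t)))"
    "\<And>u v. f' u \<bullet> f' v / (Im (f (snd c (\<gamma> t))))\<^sup>2 = u \<bullet> v / (Im (snd c (\<gamma> t)))\<^sup>2"
    using hyp_isoms_derivative[OF f(1)] by metis
  have "(f \<circ> (snd c \<circ> \<gamma>) has_vector_derivative f' d) (at t)"
    unfolding has_vector_derivative_def
    using diff_chain_at[OF d[unfolded has_vector_derivative_def], of f f'] f'(1)
      linear_cmul[OF has_derivative_linear[OF f'(1)]]
    by (simp add: o_def)
  moreover have "openin (top_of_set I) {s \<in> I. \<gamma> s \<in> fst c \<inter> fst c'}"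
    using openin_continuous_map_preimage[OF \<gamma> openin_Int[OF openin_chart[OF c(1)] openin_chart[OF c'(1)]]]
    by simp
  then have "open {s \<in> I. \<gamma> s \<in> fst c \<inter> fst c'}" using I(1) openin_open_trans by blast
  ultimately have "(snd c' \<circ> \<gamma> has_vector_derivative f' d) (at t)"
    by (rule has_vector_derivative_transform_within_open) (use f(2) c c' I in auto)
  then have "vector_derivative (snd c' \<circ> \<gamma>) (at t) = f' d" by (rule vector_derivative_at)
  moreover have "sqrt ((norm d)\<^sup>2 / (Im (snd c (\<gamma> t)))\<^sup>2) = norm d / Im (snd c (\<gamma> t))"
    using Im by (simp add: real_sqrt_divide)
  ultimately show ?thesis
    unfolding speed_def Let_def c'_def[symmetric]
    using f'(2)[of d d] f(2)[of "\<gamma> t"] c c' by (simp add: hyp_metric_def power2_norm_eq_inner)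
qed

text \<open>\<open>C1_curve_on\<close> speaks of derivatives within the set of parameters mapped
  into the chart, \<open>speed\<close> of two-sided ones. At an interior parameter that set is a
  neighbourhood, so the two notions meet there.\<close>

lemma C1_curve_interior:
  assumes C1: "C1_curve_on A \<gamma> a b" and \<gamma>: "continuous_map (top_of_set {a..b}) M \<gamma>"
    and t: "a < t" "t < b" and c: "c \<in> A" "\<gamma> t \<in> fst c"
  obtains I D where "open I" "t \<in> I" "I \<subseteq> {a<..<b}" "\<And>s. s \<in> I \<Longrightarrow> \<gamma> s \<in> fst c"
    "continuous_on I D" "\<And>s. s \<in> I \<Longrightarrow> ((snd c \<circ> \<gamma>) has_vector_derivative D s) (at s)"
    "\<And>s. s \<in> I \<Longrightarrow> speed A hyp_metric \<gamma> s = norm (D s) / Im (snd c (\<gamma> s))"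
proof -
  define J where "J = {t\<in>{a..b}. \<gamma> t \<in> fst c}"
  obtain D where D: "continuous_on J D" "\<And>t. t \<in> J \<Longrightarrow> ((snd c \<circ> \<gamma>) has_vector_derivative D t) (at t within J)"
    using C1 c unfolding C1_curve_on_def J_def Let_def by meson
  have "openin (top_of_set {a..b}) J"
    unfolding J_def using openin_continuous_map_preimage[OF \<gamma> openin_chart[OF c(1)]] by simp
  then obtain T where T: "open T" "J = {a..b} \<inter> T" unfolding openin_open by auto
  define I where "I = {a<..<b} \<inter> T"
  have "t \<in> J" using t c unfolding J_def by simp
  then have I: "open I" "t \<in> I" "I \<subseteq> {a<..<b}" "I \<subseteq> J"
    using T(1) t unfolding I_def T(2) by auto
  have d: "((snd c \<circ> \<gamma>) has_vector_derivative D s) (at s)" if "s \<in> I" for s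
    using has_vector_derivative_within_subset[OF D(2) I(4)] that I(1,4) at_within_open by (metis subsetD)
  show thesis
  proof
    show "open I" "t \<in> I" "I \<subseteq> {a<..<b}" by fact+
    show \<gamma>I: "\<gamma> s \<in> fst c" if "s \<in> I" for s using that I(4) unfolding J_def by auto
    show "continuous_on I D" using D(1) I(4) continuous_on_subset by blast
    show "((snd c \<circ> \<gamma>) has_vector_derivative D s) (at s)" if "s \<in> I" for s using d that .
    have "continuous_map (top_of_set I) M \<gamma>"
      using continuous_map_from_subtopology_mono[OF \<gamma>, of I] greaterThanLessThan_subseteq_atLeastAtMost_iff[of a b a b] I(3)
      by (metis order.refl order.trans)
    then show "speed A hyp_metric \<gamma> s = norm (D s) / Im (snd c (\<gamma> s))" if "s \<in> I" for s
      using speed_eq[OF I(1) that _ c(1) \<gamma>I[OF that] d[OF that]] by blast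
  qed
qed

lemma curve_in_space:
  assumes "continuous_map (top_of_set S) M \<gamma>" "t \<in> S"
  obtains c where "c \<in> A" "\<gamma> t \<in> fst c"
  using assms(2) continuous_map_image_subset_topspace[OF assms(1)] that
  unfolding topspace_atlas by (metis (no_types, lifting) UN_E image_subset_iff topspace_euclidean_subtopology)

text \<open>Restricted to the open interval: at a break point of a piecewise curve the two-sided
  derivative in \<open>speed\<close> may fail to exist.\<close>

lemma speed_continuous:
  assumes C1: "C1_curve_on A \<gamma> a b" and \<gamma>: "continuous_map (top_of_set {a..b}) M \<gamma>"
  shows "continuous_on {a<..<b} (speed A hyp_metric \<gamma>)"
proof (rule continuous_at_imp_continuous_on, rule ballI)
  fix t assume t: "t \<in> {a<..<b}"
  obtain c where c: "c \<in> A" "\<gamma> t \<in> fst c" using curve_in_space[OF \<gamma>, of t] t by auto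
  obtain I D where I: "open I" "t \<in> I" "I \<subseteq> {a<..<b}" "\<And>s. s \<in> I \<Longrightarrow> \<gamma> s \<in> fst c"
    "continuous_on I D" "\<And>s. s \<in> I \<Longrightarrow> ((snd c \<circ> \<gamma>) has_vector_derivative D s) (at s)"
    "\<And>s. s \<in> I \<Longrightarrow> speed A hyp_metric \<gamma> s = norm (D s) / Im (snd c (\<gamma> s))"
    using C1_curve_interior[OF C1 \<gamma> _ _ c] t by auto
  have "continuous_on I (snd c \<circ> \<gamma>)"
    using I(1,6) continuous_at_imp_continuous_on has_vector_derivative_continuous by blast
  then have "continuous_on I (\<lambda>s. norm (D s) / Im ((snd c \<circ> \<gamma>) s))"
    using I(4,5) chart_upper[OF c(1)] by (intro continuous_intros) (auto simp: less_imp_neq[symmetric])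
  then have "continuous_on I (speed A hyp_metric \<gamma>)"
    using I(7) by (simp cong: continuous_on_cong)
  then show "isCont (speed A hyp_metric \<gamma>) t" using I(1,2) continuous_on_eq_continuous_at by blast
qed

end

section \<open>Curves and the Riemannian distance\<close>

text \<open>\<open>piecewise_C1_path\<close> on arbitrary intervals, so that curves can be joined
  first and rescaled to \<open>{0..1}\<close> afterwards.\<close>

definition pcurve :: "'p topology \<Rightarrow> ('p, 'e::euclidean_space) chart set \<Rightarrow> (real \<Rightarrow> 'p) \<Rightarrow> real \<Rightarrow> real \<Rightarrow> bool"
  where "pcurve M A \<gamma> a b \<longleftrightarrow> a < b \<and>
     continuous_map (top_of_set {a..b}) M \<gamma> \<and>
     (\<exists>T. finite T \<and> {a, b} \<subseteq> T \<and> T \<subseteq> {a..b} \<and>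
        (\<forall>p\<in>T. \<forall>q\<in>T. p < q \<and> {p<..<q} \<inter> T = {} \<longrightarrow> C1_curve_on A \<gamma> p q))"

lemma pcurveE:
  assumes "pcurve M A \<gamma> a b"
  obtains T where "finite T" "{a, b} \<subseteq> T" "T \<subseteq> {a..b}"
    "\<And>p q. p \<in> T \<Longrightarrow> q \<in> T \<Longrightarrow> p < q \<Longrightarrow> {p<..<q} \<inter> T = {} \<Longrightarrow> C1_curve_on A \<gamma> p q"
  using assms unfolding pcurve_def by metis

lemma pcurveI:
  assumes "a < b" "continuous_map (top_of_set {a..b}) M \<gamma>" "finite T" "{a, b} \<subseteq> T" "T \<subseteq> {a..b}"
    "\<And>p q. p \<in> T \<Longrightarrow> q \<in> T \<Longrightarrow> p < q \<Longrightarrow> {p<..<q} \<inter> T = {} \<Longrightarrow> C1_curve_on A \<gamma> p q"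
  shows "pcurve M A \<gamma> a b"
  unfolding pcurve_def using assms by (intro conjI exI[of _ T]) simp_all

lemma pcurve_less: "pcurve M A \<gamma> a b \<Longrightarrow> a < b"
  by (simp add: pcurve_def)

lemma pcurve_continuous: "pcurve M A \<gamma> a b \<Longrightarrow> continuous_map (top_of_set {a..b}) M \<gamma>"
  by (simp add: pcurve_def)

lemma pcurve_unit: "pcurve M A \<gamma> 0 1 \<longleftrightarrow> piecewise_C1_path M A \<gamma>"
  by (simp add: pcurve_def piecewise_C1_path_def)

definition plength ::
  "('p, 'e::euclidean_space) chart set \<Rightarrow> ('p, 'e) local_metric \<Rightarrow> (real \<Rightarrow> 'p) \<Rightarrow> real \<Rightarrow> real \<Rightarrow> ennreal" where
  "plength A g \<gamma> a b = (\<integral>\<^sup>+t\<in>{a..b}. ennreal (speed A g \<gamma> t) \<partial>lborel)"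

lemma plength_unit: "plength A g \<gamma> 0 1 = curve_length A g \<gamma>"
  by (simp add: plength_def curve_length_def)

lemma C1_curve_on_cong:
  assumes "\<And>t. t \<in> {a..b} \<Longrightarrow> \<gamma> t = \<delta> t" "C1_curve_on A \<gamma> a b"
  shows "C1_curve_on A \<delta> a b"
  unfolding C1_curve_on_def Let_def
proof
  fix c assume c: "c \<in> A"
  let ?J = "{t\<in>{a..b}. \<gamma> t \<in> fst c}"
  have J: "{t\<in>{a..b}. \<delta> t \<in> fst c} = ?J" using assms(1) by auto
  obtain D where D: "continuous_on ?J D" "\<forall>t\<in>?J. ((snd c \<circ> \<gamma>) has_vector_derivative D t) (at t within ?J)"
    using assms(2) c unfolding C1_curve_on_def Let_def by meson
  have "((snd c \<circ> \<delta>) has_vector_derivative D t) (at t within ?J)" if t: "t \<in> ?J" for t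
    by (rule has_vector_derivative_transform[OF t _ bspec[OF D(2) t]]) (use assms(1) in auto)
  then show "\<exists>D. continuous_on {t \<in> {a..b}. \<delta> t \<in> fst c} D \<and>
         (\<forall>t\<in>{t \<in> {a..b}. \<delta> t \<in> fst c}.
             (snd c \<circ> \<delta> has_vector_derivative D t) (at t within {t \<in> {a..b}. \<delta> t \<in> fst c}))"
    unfolding J using D(1) by blast
qed

lemma C1_curve_on_affine:
  assumes "C1_curve_on A \<gamma> a b" "\<And>t. t \<in> {p..q} \<Longrightarrow> m * t + k \<in> {a..b}"
  shows "C1_curve_on A (\<lambda>t. \<gamma> (m * t + k)) p q"
  unfolding C1_curve_on_def Let_def
proof
  fix c assume c: "c \<in> A"
  let ?J = "{t\<in>{a..b}. \<gamma> t \<in> fst c}" and ?K = "{t\<in>{p..q}. \<gamma> (m * t + k) \<in> fst c}"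
  obtain D where D: "continuous_on ?J D" "\<forall>t\<in>?J. ((snd c \<circ> \<gamma>) has_vector_derivative D t) (at t within ?J)"
    using assms(1) c unfolding C1_curve_on_def Let_def by meson
  have KJ: "(\<lambda>t. m * t + k) ` ?K \<subseteq> ?J" using assms(2) by auto
  have "continuous_on ?K (\<lambda>t. m *\<^sub>R D (m * t + k))"
    using KJ by (intro continuous_intros continuous_on_compose2[OF D(1)]) auto
  moreover have "((snd c \<circ> (\<lambda>t. \<gamma> (m * t + k))) has_vector_derivative m *\<^sub>R D (m * t + k)) (at t within ?K)"
    if t: "t \<in> ?K" for t
  proof -
    have "((\<lambda>t. m * t + k) has_vector_derivative m) (at t within ?K)"
      by (auto intro!: derivative_eq_intros)
    moreover have "((snd c \<circ> \<gamma>) has_vector_derivative D (m * t + k)) (at (m * t + k) within (\<lambda>t. m * t + k) ` ?K)"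
      using has_vector_derivative_within_subset[OF _ KJ] D(2) KJ t by blast
    ultimately show ?thesis
      using vector_diff_chain_within[of "\<lambda>t. m * t + k" m t ?K "snd c \<circ> \<gamma>"] by (simp add: o_def)
  qed
  ultimately show "\<exists>D. continuous_on ?K D \<and> (\<forall>t\<in>?K. (snd c \<circ> (\<lambda>t. \<gamma> (m * t + k)) has_vector_derivative D t) (at t within ?K))"
    by blast
qed

lemma pcurve_cong:
  assumes eq: "\<And>t. t \<in> {a..b} \<Longrightarrow> \<gamma> t = \<delta> t" and P: "pcurve M A \<gamma> a b"
  shows "pcurve M A \<delta> a b"
proof -
  obtain T where T: "finite T" "{a, b} \<subseteq> T" "T \<subseteq> {a..b}"
    and C: "\<And>p q. p \<in> T \<Longrightarrow> q \<in> T \<Longrightarrow> p < q \<Longrightarrow> {p<..<q} \<inter> T = {} \<Longrightarrow> C1_curve_on A \<gamma> p q"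
    using pcurveE[OF P] by metis
  have "C1_curve_on A \<delta> p q" if "p \<in> T" "q \<in> T" "p < q" "{p<..<q} \<inter> T = {}" for p q
  proof (rule C1_curve_on_cong)
    show "C1_curve_on A \<gamma> p q" by (rule C[OF that])
    have "p \<in> {a..b}" "q \<in> {a..b}" using that T(3) by auto
    then show "\<gamma> t = \<delta> t" if "t \<in> {p..q}" for t using that eq by auto
  qed
  moreover have "continuous_map (top_of_set {a..b}) M \<delta>"
    using P continuous_map_eq[of "top_of_set {a..b}" M \<gamma> \<delta>] eq unfolding pcurve_def by simp
  ultimately show ?thesis using pcurveI[OF pcurve_less[OF P] _ T] by blast
qed

text \<open>Negative \<open>m\<close> is included because reversal of curves gives the symmetry of
  the distance; hence the \<open>min\<close> and \<open>max\<close> below.\<close>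

lemma pcurve_affine:
  assumes P: "pcurve M A \<gamma> a b" and m: "m \<noteq> 0" and ab: "a' < b'" "(\<lambda>t. m * t + k) ` {a'..b'} = {a..b}"
  shows "pcurve M A (\<lambda>t. \<gamma> (m * t + k)) a' b'"
proof -
  obtain T where T: "finite T" "{a, b} \<subseteq> T" "T \<subseteq> {a..b}"
    and C: "\<And>p q. p \<in> T \<Longrightarrow> q \<in> T \<Longrightarrow> p < q \<Longrightarrow> {p<..<q} \<inter> T = {} \<Longrightarrow> C1_curve_on A \<gamma> p q"
    using pcurveE[OF P] by metis
  define h where "h t = m * t + k" for t
  have hinj: "h s = h t \<longleftrightarrow> s = t" for s t using m by (simp add: h_def)
  have him: "h ` {a'..b'} = {a..b}" using ab(2) by (simp add: h_def[abs_def])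
  define T' where "T' = {t \<in> {a'..b'}. h t \<in> T}"
  have "finite T'"
    using finite_vimageI[OF T(1), of h] hinj unfolding T'_def
    by (auto intro: finite_subset[of _ "h -` T"] simp: inj_def)
  moreover have "{a', b'} \<subseteq> T'"
  proof -
    have "a < b" using P by (simp add: pcurve_def)
    have "h a' \<in> h ` {a'..b'}" "h b' \<in> h ` {a'..b'}" using ab(1) by auto
    then have "{h a', h b'} \<subseteq> {a..b}" unfolding him by auto
    moreover have "a \<in> h ` {a'..b'}" "b \<in> h ` {a'..b'}" unfolding him using \<open>a < b\<close> by auto
    then obtain u v where "u \<in> {a'..b'}" "h u = a" "v \<in> {a'..b'}" "h v = b" by blast
    ultimately have "(h a' = a \<and> h b' = b) \<or> (h a' = b \<and> h b' = a)"
    proof (cases "m > 0")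
      case True
      then have "h a' \<le> h u" "h v \<le> h b'" using \<open>u \<in> _\<close> \<open>v \<in> _\<close> by (auto simp: h_def)
      then show ?thesis using \<open>{h a', h b'} \<subseteq> _\<close> \<open>h u = a\<close> \<open>h v = b\<close> by auto
    next
      case False
      then have "h a' \<ge> h v" "h u \<ge> h b'" using \<open>u \<in> _\<close> \<open>v \<in> _\<close> m by (auto simp: h_def)
      then show ?thesis using \<open>{h a', h b'} \<subseteq> _\<close> \<open>h u = a\<close> \<open>h v = b\<close> by auto
    qed
    then show ?thesis using T(2) ab(1) by (auto simp: T'_def)
  qed
  moreover have "T' \<subseteq> {a'..b'}" by (auto simp: T'_def)
  moreover have "C1_curve_on A (\<lambda>t. \<gamma> (m * t + k)) p q"
    if pq: "p \<in> T'" "q \<in> T'" "p < q" "{p<..<q} \<inter> T' = {}" for p q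
  proof -
    have sub: "p \<in> {a'..b'}" "q \<in> {a'..b'}" using pq by (auto simp: T'_def)
    have empty: "{min (h p) (h q)<..<max (h p) (h q)} \<inter> T = {}"
    proof (rule ccontr)
      assume "{min (h p) (h q)<..<max (h p) (h q)} \<inter> T \<noteq> {}"
      then obtain x where x: "min (h p) (h q) < x" "x < max (h p) (h q)" "x \<in> T" by auto
      define t where "t = (x - k) / m"
      have ht: "h t = x" using m by (simp add: t_def h_def)
      have "p < t \<and> t < q"
        using x(1,2) m \<open>p < q\<close> unfolding ht[symmetric] h_def
        by (cases "m > 0") (auto simp: min_def max_def mult_less_cancel_left split: if_splits)
      then have "t \<in> {p<..<q} \<inter> T'" using ht x(3) sub by (auto simp: T'_def)
      then show False using pq(4) by auto
    qed
    have "min (h p) (h q) < max (h p) (h q)" using hinj[of p q] \<open>p < q\<close> by auto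
    then have "C1_curve_on A \<gamma> (min (h p) (h q)) (max (h p) (h q))"
      using empty pq(1,2) by (intro C) (auto simp: T'_def min_def max_def)
    then show ?thesis
      by (rule C1_curve_on_affine)
        (use m in \<open>cases "m > 0"; auto simp: h_def min_def max_def mult_le_cancel_left\<close>)
  qed
  moreover have "continuous_map (top_of_set {a'..b'}) M (\<lambda>t. \<gamma> (m * t + k))"
  proof -
    have "continuous_map (top_of_set {a'..b'}) (top_of_set {a..b}) h"
      using him by (auto simp: h_def[abs_def] intro!: continuous_intros)
    then have "continuous_map (top_of_set {a'..b'}) M (\<gamma> \<circ> h)"
      using pcurve_continuous[OF P] by (rule continuous_map_compose)
    then show ?thesis by (simp add: o_def h_def)
  qed
  ultimately show ?thesis using pcurveI[OF ab(1)] by metis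
qed

lemma pcurve_join:
  assumes 1: "pcurve M A \<gamma> a b" and 2: "pcurve M A \<gamma> b c"
  shows "pcurve M A \<gamma> a c"
proof -
  obtain T where T: "finite T" "{a, b} \<subseteq> T" "T \<subseteq> {a..b}"
    and C: "\<And>p q. p \<in> T \<Longrightarrow> q \<in> T \<Longrightarrow> p < q \<Longrightarrow> {p<..<q} \<inter> T = {} \<Longrightarrow> C1_curve_on A \<gamma> p q"
    using pcurveE[OF 1] by metis
  obtain U where U: "finite U" "{b, c} \<subseteq> U" "U \<subseteq> {b..c}"
    and E: "\<And>p q. p \<in> U \<Longrightarrow> q \<in> U \<Longrightarrow> p < q \<Longrightarrow> {p<..<q} \<inter> U = {} \<Longrightarrow> C1_curve_on A \<gamma> p q"
    using pcurveE[OF 2] by metis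
  have abc: "a < b" "b < c" using 1 2 by (auto simp: pcurve_def)
  have "C1_curve_on A \<gamma> p q" if pq: "p \<in> T \<union> U" "q \<in> T \<union> U" "p < q" "{p<..<q} \<inter> (T \<union> U) = {}" for p q
  proof (cases "q \<le> b")
    case True
    then have "p \<in> T" "q \<in> T" using pq T U by auto
    then show ?thesis using C pq by blast
  next
    case False
    then have "b \<le> p" using pq(4) T(2) pq(3) by (metis IntI UnI1 disjoint_iff greaterThanLessThan_iff insert_subset not_le)
    then have "p \<in> U" "q \<in> U" using pq T U False by auto
    then show ?thesis using E pq by blast
  qed
  moreover have "continuous_map (top_of_set {a..c}) M \<gamma>"
  proof -
    have "continuous_map (subtopology (top_of_set {a..c}) {a..b}) M \<gamma>"
      "continuous_map (subtopology (top_of_set {a..c}) {b..c}) M \<gamma>"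
      using 1 2 abc unfolding pcurve_def by (auto simp: subtopology_subtopology Int_absorb1)

    moreover have "{x \<in> topspace (top_of_set {a..c}). x \<le> b} = {a..b}"
      "{x \<in> topspace (top_of_set {a..c}). b \<le> x} = {b..c}"
      using abc by auto
    \<comment> \<open>The pasting lemma with the same function in both branches.\<close>
    ultimately have "continuous_map (top_of_set {a..c}) M (\<lambda>x. if x \<le> b then \<gamma> x else \<gamma> x)"
      by (intro continuous_map_cases_le) auto
    then show ?thesis by simp
  qed
  ultimately show ?thesis
    using T U abc by (intro pcurveI[where T = "T \<union> U"]) auto
qed

lemma finite_neighbours:
  fixes T :: "real set"
  assumes "finite T" "{a, b} \<subseteq> T" "a < t" "t < b" "t \<notin> T"
  obtains p q where "p \<in> T" "q \<in> T" "p < t" "t < q" "{p<..<q} \<inter> T = {}"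
proof
  let ?p = "Max {s\<in>T. s < t}" and ?q = "Min {s\<in>T. t < s}"
  have f: "finite {s\<in>T. s < t}" "finite {s\<in>T. t < s}" using assms(1) by auto
  have ne: "{s\<in>T. s < t} \<noteq> {}" "{s\<in>T. t < s} \<noteq> {}" using assms by auto
  show "?p \<in> T" "?p < t" using Max_in[OF f(1) ne(1)] by auto
  show "?q \<in> T" "t < ?q" using Min_in[OF f(2) ne(2)] by auto
  show "{?p<..<?q} \<inter> T = {}"
  proof (rule ccontr)
    assume "{?p<..<?q} \<inter> T \<noteq> {}"
    then obtain x where x: "x \<in> T" "?p < x" "x < ?q" by auto
    then have "x \<noteq> t" using assms(5) by auto
    then show False using x Max_ge[OF f(1), of x] Min_le[OF f(2), of x] by (cases "x < t") auto
  qed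
qed

section \<open>Lengths of curves and the extended distance\<close>

context half_plane_atlas
begin

abbreviation len where "len \<equiv> plength A hyp_metric"

lemma pcurve_regular:
  assumes P: "pcurve M A \<gamma> a b"
  obtains T where "finite T" "{a, b} \<subseteq> T"
    "continuous_on ({a<..<b} - T) (speed A hyp_metric \<gamma>)"
    "\<And>t. t \<in> {a<..<b} - T \<Longrightarrow> \<exists>c\<in>A. \<exists>d. \<gamma> t \<in> fst c \<and> ((snd c \<circ> \<gamma>) has_vector_derivative d) (at t)"
proof -
  obtain T where T: "finite T" "{a, b} \<subseteq> T" "T \<subseteq> {a..b}"
    and C: "\<And>p q. p \<in> T \<Longrightarrow> q \<in> T \<Longrightarrow> p < q \<Longrightarrow> {p<..<q} \<inter> T = {} \<Longrightarrow> C1_curve_on A \<gamma> p q"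
    using pcurveE[OF P] by metis
  note \<gamma> = pcurve_continuous[OF P]
  have *: "isCont (speed A hyp_metric \<gamma>) t \<and>
      (\<exists>c\<in>A. \<exists>d. \<gamma> t \<in> fst c \<and> ((snd c \<circ> \<gamma>) has_vector_derivative d) (at t))"
    if t: "t \<in> {a<..<b} - T" for t
  proof -
    obtain p q where pq: "p \<in> T" "q \<in> T" "p < t" "t < q" "{p<..<q} \<inter> T = {}"
      using finite_neighbours[OF T(1,2), of t] t by auto
    then have C1: "C1_curve_on A \<gamma> p q" using C by simp
    have "{p..q} \<subseteq> {a..b}" using pq(1,2) T(3) by auto
    then have \<gamma>': "continuous_map (top_of_set {p..q}) M \<gamma>"
      using continuous_map_from_subtopology_mono[OF \<gamma>] by blast
    obtain c where c: "c \<in> A" "\<gamma> t \<in> fst c" using curve_in_space[OF \<gamma>', of t] pq by auto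
    have "isCont (speed A hyp_metric \<gamma>) t"
      using speed_continuous[OF C1 \<gamma>'] pq(3,4) by (simp add: continuous_on_eq_continuous_at)
    moreover obtain I D where "t \<in> I" "\<And>s. s \<in> I \<Longrightarrow> ((snd c \<circ> \<gamma>) has_vector_derivative D s) (at s)"
      using C1_curve_interior[OF C1 \<gamma>' pq(3,4) c] by metis
    ultimately show ?thesis using c by auto
  qed
  show thesis
  proof (rule that[OF T(1,2)])
    show "continuous_on ({a<..<b} - T) (speed A hyp_metric \<gamma>)"
      using * by (intro continuous_at_imp_continuous_on) blast
    show "\<And>t. t \<in> {a<..<b} - T \<Longrightarrow> \<exists>c\<in>A. \<exists>d. \<gamma> t \<in> fst c \<and> ((snd c \<circ> \<gamma>) has_vector_derivative d) (at t)"
      using * by blast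
  qed
qed

text \<open>At break points \<open>speed\<close> is some unspecified real number; altering a
  function on a finite set does not affect measurability.\<close>

lemma speed_measurable:
  assumes "pcurve M A \<gamma> a b"
  shows "(\<lambda>t. ennreal (speed A hyp_metric \<gamma> t) * indicator {a..b} t) \<in> borel_measurable lborel"
proof -
  obtain T where T: "finite T" "{a, b} \<subseteq> T" "continuous_on ({a<..<b} - T) (speed A hyp_metric \<gamma>)"
    using pcurve_regular[OF assms] by metis
  have "open ({a<..<b} - T)" using T(1) by (simp add: finite_imp_closed open_Diff)
  then have "(\<lambda>t. indicator ({a<..<b} - T) t *\<^sub>R speed A hyp_metric \<gamma> t) \<in> borel_measurable borel"
    using borel_measurable_continuous_on_indicator[OF _ T(3)] by simp
  then have "(\<lambda>t. ennreal (indicator ({a<..<b} - T) t *\<^sub>R speed A hyp_metric \<gamma> t)) \<in> borel_measurable borel"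
    by measurable
  note m = this
  have "ennreal (indicator ({a<..<b} - T) t *\<^sub>R speed A hyp_metric \<gamma> t)
      = ennreal (speed A hyp_metric \<gamma> t) * indicator {a..b} t" if "t \<notin> T" for t
    using that T(2) by (auto simp: indicator_def)
  then have "(\<lambda>t. ennreal (speed A hyp_metric \<gamma> t) * indicator {a..b} t) \<in> borel_measurable borel"
    using T(1) by (intro measurable_discrete_difference[OF m, of T]) (auto simp: countable_finite)
  then show ?thesis by simp
qed

lemma AE_not_finite: "finite (T :: real set) \<Longrightarrow> AE t in lborel. t \<notin> T"
  by (intro AE_not_in finite_imp_null_set_lborel)

lemma speed_cong:
  assumes "open I" "t \<in> I" "\<And>s. s \<in> I \<Longrightarrow> \<gamma> s = \<delta> s"
  shows "speed A g \<gamma> t = speed A g \<delta> t"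
proof -
  have "((snd c \<circ> \<gamma>) has_vector_derivative d) (at t) \<longleftrightarrow> ((snd c \<circ> \<delta>) has_vector_derivative d) (at t)"
    for c :: "('p, complex) chart" and d
    using has_vector_derivative_transform_within_open[OF _ assms(1,2), of "snd c \<circ> \<gamma>" d "snd c \<circ> \<delta>"]
      has_vector_derivative_transform_within_open[OF _ assms(1,2), of "snd c \<circ> \<delta>" d "snd c \<circ> \<gamma>"]
      assms(3) by auto
  then show ?thesis using assms(2,3) unfolding speed_def vector_derivative_def by simp
qed

lemma plength_cong:
  assumes "\<And>t. t \<in> {a..b} \<Longrightarrow> \<gamma> t = \<delta> t"
  shows "len \<gamma> a b = len \<delta> a b"
  unfolding plength_def
proof (rule nn_integral_cong_AE)
  have "speed A hyp_metric \<gamma> t = speed A hyp_metric \<delta> t" if "t \<in> {a<..<b}" for t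
    by (rule speed_cong[OF _ that]) (use assms in auto)
  then have "ennreal (speed A hyp_metric \<gamma> t) * indicator {a..b} t
      = ennreal (speed A hyp_metric \<delta> t) * indicator {a..b} t" if "t \<notin> {a, b}" for t
    using that by (auto simp: indicator_def)
  note * = this
  show "AE t in lborel. ennreal (speed A hyp_metric \<gamma> t) * indicator {a..b} t
      = ennreal (speed A hyp_metric \<delta> t) * indicator {a..b} t"
    by (rule eventually_mono[OF AE_not_finite[of "{a, b}"] *]) simp_all
qed

lemma plength_affine:
  assumes P: "pcurve M A \<gamma> a b" and m: "m \<noteq> 0" and ab: "a' < b'" "(\<lambda>t. m * t + k) ` {a'..b'} = {a..b}"
  shows "len (\<lambda>t. \<gamma> (m * t + k)) a' b' = len \<gamma> a b"
proof -
  obtain T where T: "finite T" "{a, b} \<subseteq> T"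
    "\<And>t. t \<in> {a<..<b} - T \<Longrightarrow> \<exists>c\<in>A. \<exists>d. \<gamma> t \<in> fst c \<and> ((snd c \<circ> \<gamma>) has_vector_derivative d) (at t)"
    using pcurve_regular[OF P] by metis
  have P': "pcurve M A (\<lambda>t. \<gamma> (m * t + k)) a' b'" by (rule pcurve_affine[OF assms])
  have cont: "continuous_map (top_of_set {a<..<b}) M \<gamma>"
    "continuous_map (top_of_set {a'<..<b'}) M (\<lambda>t. \<gamma> (m * t + k))"
    using P P' unfolding pcurve_def
    by (auto intro: continuous_map_from_subtopology_mono greaterThanLessThan_subseteq_atLeastAtMost_iff[THEN iffD2])
  define T' where "T' = {a', b'} \<union> (\<lambda>t. m * t + k) -` T"
  have "finite T'"
    unfolding T'_def using finite_vimageI[OF T(1), of "\<lambda>t. m * t + k"] m by (auto simp: inj_def)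
  have pre: "m * t + k \<in> {a..b} \<longleftrightarrow> t \<in> {a'..b'}" for t
  proof
    assume "m * t + k \<in> {a..b}"
    then obtain s where "s \<in> {a'..b'}" "m * s + k = m * t + k" using ab(2) by (metis (no_types, lifting) imageE)
    then show "t \<in> {a'..b'}" using m by simp
  qed (use ab(2) in blast)
  have sp: "speed A hyp_metric (\<lambda>t. \<gamma> (m * t + k)) t = \<bar>m\<bar> * speed A hyp_metric \<gamma> (m * t + k)"
    if t: "t \<in> {a'..b'}" "t \<notin> T'" for t
  proof -
    have t': "t \<in> {a'<..<b'}" using t by (auto simp: T'_def)
    have mt: "m * t + k \<in> {a<..<b} - T" using t pre[of t] T(2)
      by (auto simp: T'_def less_le)
    then obtain c d where c: "c \<in> A" "\<gamma> (m * t + k) \<in> fst c"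
      and d: "((snd c \<circ> \<gamma>) has_vector_derivative d) (at (m * t + k))" using T(3) by meson
    have "((\<lambda>t. m * t + k) has_vector_derivative m) (at t)"
      by (auto intro!: derivative_eq_intros)
    then have d': "((snd c \<circ> (\<lambda>t. \<gamma> (m * t + k))) has_vector_derivative (m *\<^sub>R d)) (at t)"
      using vector_diff_chain_at[of "\<lambda>t. m * t + k" m t "snd c \<circ> \<gamma>" d] d by (simp add: o_def)
    show ?thesis
      using speed_eq[OF _ _ cont(1) c d] speed_eq[OF _ t' cont(2) c(1) _ d'] c(2) mt by simp
  qed
  have "len (\<lambda>t. \<gamma> (m * t + k)) a' b' = (\<integral>\<^sup>+t. ennreal \<bar>m\<bar> * (ennreal (speed A hyp_metric \<gamma> (k + m * t)) * indicator {a..b} (k + m * t)) \<partial>lborel)"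
    unfolding plength_def
  proof (rule nn_integral_cong_AE)
    have "ennreal (speed A hyp_metric (\<lambda>t. \<gamma> (m * t + k)) t) * indicator {a'..b'} t =
         ennreal \<bar>m\<bar> * (ennreal (speed A hyp_metric \<gamma> (k + m * t)) * indicator {a..b} (k + m * t))"
      if "t \<notin> T'" for t
      using sp[OF _ that] pre[of t] by (auto simp: indicator_def ennreal_mult' add.commute)
    then show "AE t in lborel. ennreal (speed A hyp_metric (\<lambda>t. \<gamma> (m * t + k)) t) * indicator {a'..b'} t =
         ennreal \<bar>m\<bar> * (ennreal (speed A hyp_metric \<gamma> (k + m * t)) * indicator {a..b} (k + m * t))"
      using AE_not_finite[OF \<open>finite T'\<close>] by (auto elim!: eventually_mono)
  qed
  also have "\<dots> = ennreal \<bar>m\<bar> * (\<integral>\<^sup>+t. (ennreal (speed A hyp_metric \<gamma> (k + m * t)) * indicator {a..b} (k + m * t)) \<partial>lborel)"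
  proof (rule nn_integral_cmult)
    have "(\<lambda>t. k + m * t) \<in> lborel \<rightarrow>\<^sub>M lborel" by simp
    from measurable_compose[OF this speed_measurable[OF P]]
    show "(\<lambda>t. ennreal (speed A hyp_metric \<gamma> (k + m * t)) * indicator {a..b} (k + m * t)) \<in> borel_measurable lborel" .
  qed
  also have "\<dots> = len \<gamma> a b"
    unfolding plength_def
    using nn_integral_real_affine[OF _ m, of "\<lambda>t. ennreal (speed A hyp_metric \<gamma> t) * indicator {a..b} t" k]
      speed_measurable[OF P] by simp
  finally show ?thesis .
qed

lemma plength_join:
  assumes P: "pcurve M A \<gamma> a b" "pcurve M A \<gamma> b c"
  shows "len \<gamma> a c = len \<gamma> a b + len \<gamma> b c"
proof -
  have abc: "a < b" "b < c" using P by (auto simp: pcurve_def)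
  have "len \<gamma> a c = (\<integral>\<^sup>+t. ennreal (speed A hyp_metric \<gamma> t) * indicator {a..b} t
      + ennreal (speed A hyp_metric \<gamma> t) * indicator {b..c} t \<partial>lborel)"
    unfolding plength_def
  proof (rule nn_integral_cong_AE)
    have "ennreal (speed A hyp_metric \<gamma> t) * indicator {a..c} t = ennreal (speed A hyp_metric \<gamma> t) * indicator {a..b} t
      + ennreal (speed A hyp_metric \<gamma> t) * indicator {b..c} t" if "t \<notin> {b}" for t
      using that abc by (auto simp: indicator_def)
    then show "AE t in lborel. ennreal (speed A hyp_metric \<gamma> t) * indicator {a..c} t = ennreal (speed A hyp_metric \<gamma> t) * indicator {a..b} t
      + ennreal (speed A hyp_metric \<gamma> t) * indicator {b..c} t"
      using AE_not_finite[of "{b}"] by (auto elim!: eventually_mono)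
  qed
  also have "\<dots> = len \<gamma> a b + len \<gamma> b c"
    unfolding plength_def using speed_measurable P by (intro nn_integral_add) auto
  finally show ?thesis .
qed

text \<open>The infimum before \<open>enn2real\<close>, which would turn an infinite value into 0.
  Finiteness is a property of the particular surface and is proved only for the double.\<close>

definition edist :: "'p \<Rightarrow> 'p \<Rightarrow> ennreal" where
  "edist x y = (INF \<gamma>\<in>{\<gamma>. piecewise_C1_path M A \<gamma> \<and> \<gamma> 0 = x \<and> \<gamma> 1 = y}. curve_length A hyp_metric \<gamma>)"

abbreviation rdist where "rdist \<equiv> riem_dist M A hyp_metric"

lemma rdist_edist: "rdist x y = enn2real (edist x y)"
  by (simp add: riem_dist_def edist_def)

lemma edist_le:
  assumes P: "pcurve M A \<gamma> a b"
  shows "edist (\<gamma> a) (\<gamma> b) \<le> len \<gamma> a b"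
proof -
  have ab: "a < b" using P by (simp add: pcurve_def)
  have im: "(\<lambda>t. (b - a) * t + a) ` {0..1} = {a..b}"
    using ab by (simp add: image_affinity_atLeastAtMost)
  let ?\<delta> = "\<lambda>t. \<gamma> ((b - a) * t + a)"
  have "pcurve M A ?\<delta> 0 1" "len ?\<delta> 0 1 = len \<gamma> a b"
    using pcurve_affine[OF P _ _ im] plength_affine[OF P _ _ im] ab by auto
  then show ?thesis
    unfolding edist_def pcurve_unit plength_unit by (intro INF_lower2[of ?\<delta>]) auto
qed

lemma edist_less:
  assumes "edist x y < r"
  obtains \<gamma> where "pcurve M A \<gamma> 0 1" "\<gamma> 0 = x" "\<gamma> 1 = y" "len \<gamma> 0 1 < r"
  using assms unfolding edist_def INF_less_iff pcurve_unit plength_unit by auto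

lemma edist_commute_le: "edist y x \<le> edist x y"
  unfolding edist_def[of x y]
proof (rule INF_greatest, clarsimp)
  fix \<gamma> assume "piecewise_C1_path M A \<gamma>"
  then have P: "pcurve M A \<gamma> 0 1" by (simp add: pcurve_unit)
  have im: "(\<lambda>t. (-1) * t + 1) ` {0..1::real} = {0..1}"
    by (subst image_affinity_atLeastAtMost) auto
  have "pcurve M A (\<lambda>t. \<gamma> ((-1) * t + 1)) 0 1" "len (\<lambda>t. \<gamma> ((-1) * t + 1)) 0 1 = len \<gamma> 0 1"
    using pcurve_affine[OF P _ _ im] plength_affine[OF P _ _ im] by auto
  with edist_le[of "\<lambda>t. \<gamma> ((-1) * t + 1)" 0 1]
  show "edist (\<gamma> 1) (\<gamma> 0) \<le> curve_length A hyp_metric \<gamma>" by (simp add: plength_unit)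
qed

lemma edist_commute: "edist x y = edist y x"
  by (intro antisym edist_commute_le)

lemma edist_triangle: "edist x z \<le> edist x y + edist y z"
proof (rule ennreal_le_epsilon)
  fix e :: real assume fin: "edist x y + edist y z < top" and e: "0 < e"
  have e2: "ennreal (e/2) > 0" using e by simp
  have "edist x y < edist x y + ennreal (e/2)" "edist y z < edist y z + ennreal (e/2)"
    using fin e2 by (auto simp: ennreal_add_eq_top less_top)
  then obtain \<gamma> \<delta> where 1: "pcurve M A \<gamma> 0 1" "\<gamma> 0 = x" "\<gamma> 1 = y" "len \<gamma> 0 1 < edist x y + ennreal (e/2)"
    and 2: "pcurve M A \<delta> 0 1" "\<delta> 0 = y" "\<delta> 1 = z" "len \<delta> 0 1 < edist y z + ennreal (e/2)"
    by (meson edist_less)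
  have im: "(\<lambda>t. 1 * t + (-1)) ` {1..2::real} = {0..1}"
    by (subst image_affinity_atLeastAtMost) auto
  let ?\<delta> = "\<lambda>t. \<delta> (1 * t + (-1))" and ?\<eta> = "\<lambda>t. if t \<le> 1 then \<gamma> t else \<delta> (1 * t + (-1))"
  have \<delta>: "pcurve M A ?\<delta> 1 2" "len ?\<delta> 1 2 = len \<delta> 0 1"
    using pcurve_affine[OF 2(1) _ _ im] plength_affine[OF 2(1) _ _ im] by auto
  have c1: "\<gamma> t = ?\<eta> t" if "t \<in> {0..1}" for t using that by auto
  have c2: "?\<delta> t = ?\<eta> t" if "t \<in> {1..2}" for t using that 1(3) 2(2) by (cases "t = 1") auto
  note p1 = pcurve_cong[OF c1 1(1)] and p2 = pcurve_cong[OF c2 \<delta>(1)]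
  have "edist x z \<le> len ?\<eta> 0 2"
    using edist_le[OF pcurve_join[OF p1 p2]] 1(2) 2(3) by simp
  also have "\<dots> = len \<gamma> 0 1 + len \<delta> 0 1"
    using plength_join[OF p1 p2] plength_cong[of 0 1 \<gamma> ?\<eta>, OF c1] plength_cong[of 1 2 ?\<delta> ?\<eta>, OF c2] \<delta>(2) by simp
  also have "\<dots> \<le> (edist x y + ennreal (e/2)) + (edist y z + ennreal (e/2))"
    using 1(4) 2(4) by (intro add_mono) auto
  also have "\<dots> = edist x y + edist y z + (ennreal (e/2) + ennreal (e/2))" by (simp add: ac_simps)
  also have "ennreal (e/2) + ennreal (e/2) = ennreal e" using e by (simp flip: ennreal_plus)
  finally show "edist x z \<le> edist x y + edist y z + ennreal e" .
qed

lemma rdist_commute: "rdist x y = rdist y x"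
  by (simp add: rdist_edist edist_commute)

lemma rdist_nonneg: "0 \<le> rdist x y"
  by (simp add: rdist_edist)

end

section \<open>Lower bounds for the distance\<close>

text \<open>A mean value inequality for functions with corners, as suprema and truncations have
  them. A bound on difference quotients near each \<open>t\<close>, with a radius depending on
  \<open>t\<close>, is precisely a gauge, and on a tagged division fine for it the increment of
  \<open>h\<close> is at most a Riemann sum of \<open>v\<close> plus a small error.\<close>

lemma dini_bound:
  fixes h v :: "real \<Rightarrow> real"
  assumes ab: "a \<le> b" and v: "v integrable_on {a..b}"
    and dini: "\<And>t \<epsilon>. t \<in> {a..b} \<Longrightarrow> 0 < \<epsilon> \<Longrightarrow>
      \<exists>\<delta>>0. \<forall>s\<in>{a..b}. \<bar>s - t\<bar> < \<delta> \<longrightarrow> \<bar>h s - h t\<bar> \<le> (v t + \<epsilon>) * \<bar>s - t\<bar>"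
  shows "\<bar>h b - h a\<bar> \<le> integral {a..b} v"
proof (rule field_le_epsilon)
  fix e :: real assume e: "0 < e"
  \<comment> \<open>One \<open>\<epsilon>\<close> pays for the error of the Riemann sum and
    \<open>\<epsilon>\<close> per unit length for the slack in the slopes; together they make
    \<open>e\<close>.\<close>
  define \<epsilon> where "\<epsilon> = e / (1 + (b - a))"
  have "1 + (b - a) > 0" using ab by simp
  then have \<epsilon>: "\<epsilon> > 0" "\<epsilon> + \<epsilon> * (b - a) = e"
    using e by (simp_all add: \<epsilon>_def flip: add_divide_distrib) (simp add: field_simps)
  obtain g where g: "gauge g"
    "\<And>\<D>. \<D> tagged_division_of {a..b} \<Longrightarrow> g fine \<D> \<Longrightarrow>
        norm (sum (\<lambda>(x,k). measure lborel k *\<^sub>R v x) \<D> - integral {a..b} v) < \<epsilon>"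
    using integrable_integral[OF v] \<epsilon>(1) unfolding has_integral_real by metis
  obtain \<delta> where \<delta>: "\<And>t. t \<in> {a..b} \<Longrightarrow> \<delta> t > 0"
    "\<And>t s. t \<in> {a..b} \<Longrightarrow> s \<in> {a..b} \<Longrightarrow> \<bar>s - t\<bar> < \<delta> t \<Longrightarrow> \<bar>h s - h t\<bar> \<le> (v t + \<epsilon>) * \<bar>s - t\<bar>"
    using dini[OF _ \<epsilon>(1)] by metis
  define \<delta>' where "\<delta>' t = (if t \<in> {a..b} then \<delta> t else 1)" for t
  have "gauge (\<lambda>t. g t \<inter> ball t (\<delta>' t))"
    by (intro gauge_Int g(1) gauge_ball_dependent) (auto simp: \<delta>'_def \<delta>(1))
  then obtain p where p: "p tagged_division_of {a..b}" "(\<lambda>t. g t \<inter> ball t (\<delta>' t)) fine p"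
    by (rule fine_division_exists_real)
  then have gp: "g fine p" and bp: "(\<lambda>t. ball t (\<delta>' t)) fine p" by (auto simp: fine_Int)
  have fin: "finite p" using p(1) by blast
  have step: "\<bar>h (Sup k) - h (Inf k)\<bar> \<le> measure lborel k *\<^sub>R v x + \<epsilon> * measure lborel k" if xk: "(x, k) \<in> p" for x k
  proof -
    obtain u w where k: "k = {u..w}" using tagged_division_ofD(4)[OF p(1) xk] by auto
    have x: "x \<in> k" "k \<subseteq> {a..b}" using tagged_division_ofD(2,3)[OF p(1) xk] by auto
    have "k \<subseteq> ball x (\<delta>' x)" using bp xk by (auto simp: fine_def)
    moreover have "x \<in> {a..b}" using x by blast
    ultimately have "k \<subseteq> ball x (\<delta> x)" by (simp add: \<delta>'_def)
    have uw: "u \<in> k" "w \<in> k" "u \<le> x" "x \<le> w" using x k by auto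
    have "\<bar>s - x\<bar> < \<delta> x" "s \<in> {a..b}" if "s \<in> k" for s
      using that \<open>k \<subseteq> ball x (\<delta> x)\<close> x by (auto simp: dist_real_def abs_minus_commute subset_iff)
    \<comment> \<open>Both ends of the interval are compared with its tag, since the hypothesis
      controls differences from the tag only.\<close>
    then have "\<bar>h u - h x\<bar> \<le> (v x + \<epsilon>) * \<bar>u - x\<bar>" "\<bar>h w - h x\<bar> \<le> (v x + \<epsilon>) * \<bar>w - x\<bar>"
      using \<delta>(2)[OF \<open>x \<in> {a..b}\<close>] uw(1,2) by blast+
    then have "\<bar>h w - h u\<bar> \<le> (v x + \<epsilon>) * (x - u) + (v x + \<epsilon>) * (w - x)" using uw by auto
    also have "\<dots> = (v x + \<epsilon>) * (w - u)" by (simp add: algebra_simps)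
    finally show ?thesis using k uw by (simp add: algebra_simps)
  qed
  have "h b - h a = (\<Sum>(x,k)\<in>p. h (Sup k) - h (Inf k))"
    using additive_tagged_division_1[OF ab p(1), of h] by simp
  also have "\<bar>\<dots>\<bar> \<le> (\<Sum>(x,k)\<in>p. \<bar>h (Sup k) - h (Inf k)\<bar>)"
    by (rule order_trans[OF sum_abs]) (simp add: case_prod_unfold)
  also have "\<dots> \<le> (\<Sum>(x,k)\<in>p. measure lborel k *\<^sub>R v x + \<epsilon> * measure lborel k)"
    by (rule sum_mono) (use step in auto)
  also have "\<dots> = (\<Sum>(x,k)\<in>p. measure lborel k *\<^sub>R v x) + \<epsilon> * (\<Sum>(x,k)\<in>p. measure lborel k)"
    by (simp add: case_prod_unfold sum.distrib sum_distrib_left)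
  also have "(\<Sum>(x,k)\<in>p. measure lborel k) = b - a"
    using additive_content_tagged_division[of p a b] p(1) ab by simp
  also have "(\<Sum>(x,k)\<in>p. measure lborel k *\<^sub>R v x) \<le> integral {a..b} v + \<epsilon>"
    using g(2)[OF p(1) gp] by (simp only: real_norm_def)
  finally show "\<bar>h b - h a\<bar> \<le> integral {a..b} v + e" using \<epsilon>(2) by linarith
qed

lemma vector_derivative_quotient:
  fixes x :: "real \<Rightarrow> 'a::real_normed_vector"
  assumes "(x has_vector_derivative d) (at t)"
  shows "((\<lambda>s. norm (x s - x t) / \<bar>s - t\<bar>) \<longlongrightarrow> norm d) (at t)"
proof -
  have lim: "((\<lambda>s. norm ((x s - x t) - (s - t) *\<^sub>R d) / norm (s - t)) \<longlongrightarrow> 0) (at t)"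
    using assms unfolding has_vector_derivative_def has_derivative_iff_norm by simp
  have "((\<lambda>s. norm (x s - x t) / \<bar>s - t\<bar> - norm d) \<longlongrightarrow> 0) (at t)"
  proof (rule Lim_null_comparison[OF _ lim])
    have "norm (norm (x s - x t) / \<bar>s - t\<bar> - norm d) \<le> norm ((x s - x t) - (s - t) *\<^sub>R d) / norm (s - t)"
      if "s \<noteq> t" for s
    proof -
      have "norm (x s - x t) / \<bar>s - t\<bar> - norm d = (norm (x s - x t) - norm ((s - t) *\<^sub>R d)) / \<bar>s - t\<bar>"
        using that by (simp add: diff_divide_distrib del: norm_scaleR) simp
      then have "norm (norm (x s - x t) / \<bar>s - t\<bar> - norm d)
          = \<bar>norm (x s - x t) - norm ((s - t) *\<^sub>R d)\<bar> / \<bar>s - t\<bar>" by (simp add: abs_divide)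
      also have "\<dots> \<le> norm ((x s - x t) - (s - t) *\<^sub>R d) / norm (s - t)"
        using norm_triangle_ineq3[of "x s - x t" "(s - t) *\<^sub>R d"] by (simp add: divide_right_mono)
      finally show ?thesis .
    qed
    then show "\<forall>\<^sub>F s in at t. norm (norm (x s - x t) / \<bar>s - t\<bar> - norm d)
        \<le> norm ((x s - x t) - (s - t) *\<^sub>R d) / norm (s - t)"
      by (auto simp: eventually_at_filter)
  qed
  then show ?thesis by (simp add: LIM_zero_iff)
qed

lemma chord_tendsto_0:
  assumes "(x \<longlongrightarrow> z) F" "0 < Im z"
  shows "((\<lambda>s. chord (x s) z) \<longlongrightarrow> 0) F"
proof -
  have "((\<lambda>s. norm (x s - z) / sqrt (Im (x s) * Im z)) \<longlongrightarrow> norm (z - z) / sqrt (Im z * Im z)) F"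
    using assms by (intro tendsto_intros) auto
  then show ?thesis by (simp add: chord_def)
qed

lemma pcurve_single:
  assumes "a < b" "continuous_map (top_of_set {a..b}) M \<gamma>" "C1_curve_on A \<gamma> a b"
  shows "pcurve M A \<gamma> a b"
  by (rule pcurveI[OF assms(1,2), where T = "{a, b}"]) (use assms in auto)

context half_plane_atlas
begin

text \<open>The radius depends on \<open>p\<close> and only differences from \<open>p\<close> occur,
  as \<open>dini_bound\<close> requires; two points on opposite sides of an edge near
  \<open>p\<close> never have to be compared with each other. Measuring with \<open>chord\<close> is
  harmless because it agrees with the distance to first order.\<close>

definition lipschitz_fun :: "('p \<Rightarrow> real) \<Rightarrow> bool" where
  "lipschitz_fun f \<longleftrightarrow> (\<forall>c\<in>A. \<forall>p\<in>fst c. \<exists>e>0. \<forall>p'\<in>fst c.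
     dist (snd c p') (snd c p) < e \<longrightarrow> \<bar>f p' - f p\<bar> \<le> chord (snd c p') (snd c p))"

lemma eventually_lipschitz:
  assumes f: "lipschitz_fun f" and \<gamma>: "continuous_map (top_of_set S) M \<gamma>"
    and t: "t \<in> S" "c \<in> A" "\<gamma> t \<in> fst c"
  shows "\<forall>\<^sub>F s in at t within S. \<bar>f (\<gamma> s) - f (\<gamma> t)\<bar> \<le> chord (snd c (\<gamma> s)) (snd c (\<gamma> t))"
proof -
  obtain e where e: "e > 0" "\<And>p'. p' \<in> fst c \<Longrightarrow> dist (snd c p') (snd c (\<gamma> t)) < e \<Longrightarrow>
      \<bar>f p' - f (\<gamma> t)\<bar> \<le> chord (snd c p') (snd c (\<gamma> t))"
    using f t unfolding lipschitz_fun_def by metis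
  show ?thesis
    using eventually_in_chart[OF \<gamma> t e(1)] by (rule eventually_mono) (use e(2) in auto)
qed

lemma lipschitz_continuous_curve:
  assumes f: "lipschitz_fun f" and \<gamma>: "continuous_map (top_of_set S) M \<gamma>"
  shows "continuous_on S (f \<circ> \<gamma>)"
  unfolding continuous_on_def
proof
  fix t assume t: "t \<in> S"
  obtain c where c: "c \<in> A" "\<gamma> t \<in> fst c" using curve_in_space[OF \<gamma> t] .
  have "((\<lambda>s. chord ((snd c \<circ> \<gamma>) s) (snd c (\<gamma> t))) \<longlongrightarrow> 0) (at t within S)"
    by (rule chord_tendsto_0[OF continuous_chart_curve[OF \<gamma> t c] chart_upper[OF c]])
  then have "((\<lambda>s. f (\<gamma> s) - f (\<gamma> t)) \<longlongrightarrow> 0) (at t within S)"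
    by (rule Lim_null_comparison[rotated]) (use eventually_lipschitz[OF f \<gamma> t c] in \<open>simp add: o_def\<close>)
  then show "((f \<circ> \<gamma>) \<longlongrightarrow> (f \<circ> \<gamma>) t) (at t within S)"
    by (simp add: LIM_zero_iff o_def)
qed

lemma speed_nonneg: "0 \<le> speed A hyp_metric \<gamma> t"
  by (simp add: speed_def hyp_metric_def Let_def)

lemma lipschitz_C1_interior:
  assumes f: "lipschitz_fun f" and C1: "C1_curve_on A \<gamma> a b"
    and \<gamma>: "continuous_map (top_of_set {a..b}) M \<gamma>"
    and uw: "a < u" "u \<le> w" "w < b"
  shows "ennreal \<bar>f (\<gamma> w) - f (\<gamma> u)\<bar> \<le> len \<gamma> a b"
proof -
  let ?v = "speed A hyp_metric \<gamma>"
  have cont: "continuous_on {u..w} ?v"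
    using speed_continuous[OF C1 \<gamma>] by (rule continuous_on_subset) (use uw in auto)
  then have int: "?v integrable_on {u..w}" by (rule integrable_continuous_real)
  have "\<bar>(f \<circ> \<gamma>) w - (f \<circ> \<gamma>) u\<bar> \<le> integral {u..w} ?v"
  proof (rule dini_bound[OF uw(2) int])
    fix t \<epsilon> :: real assume t: "t \<in> {u..w}" and \<epsilon>: "0 < \<epsilon>"
    obtain c where c: "c \<in> A" "\<gamma> t \<in> fst c" using curve_in_space[OF \<gamma>, of t] t uw by auto
    obtain I D where I: "open I" "t \<in> I" "I \<subseteq> {a<..<b}" "\<And>s. s \<in> I \<Longrightarrow> \<gamma> s \<in> fst c"
      "\<And>s. s \<in> I \<Longrightarrow> ((snd c \<circ> \<gamma>) has_vector_derivative D s) (at s)"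
      "\<And>s. s \<in> I \<Longrightarrow> ?v s = norm (D s) / Im (snd c (\<gamma> s))"
    proof -
      have "a < t" "t < b" using t uw by auto
      from C1_curve_interior[OF C1 \<gamma> this c] that show thesis by metis
    qed
    let ?x = "snd c \<circ> \<gamma>"
    have Im: "0 < Im (?x t)" using chart_upper[OF c] by simp
    have xt: "(?x \<longlongrightarrow> ?x t) (at t)"
      using has_vector_derivative_continuous[OF I(5)[OF I(2)]] by (simp add: isCont_def)
    have "((\<lambda>s. norm (?x s - ?x t) / \<bar>s - t\<bar> / sqrt (Im (?x s) * Im (?x t))) \<longlongrightarrow>
        norm (D t) / sqrt (Im (?x t) * Im (?x t))) (at t)"
      using Im by (intro tendsto_intros vector_derivative_quotient I(5) I(2) xt) auto
    also have "norm (D t) / sqrt (Im (?x t) * Im (?x t)) = ?v t" using I(6)[OF I(2)] Im by simp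
    finally have "\<forall>\<^sub>F s in at t. norm (?x s - ?x t) / \<bar>s - t\<bar> / sqrt (Im (?x s) * Im (?x t)) < ?v t + \<epsilon>"
      using \<epsilon> by (intro order_tendstoD(2)) auto
    moreover have "continuous_map (top_of_set I) M \<gamma>"
      using continuous_map_from_subtopology_mono[OF \<gamma>, of I] I(3)
        greaterThanLessThan_subseteq_atLeastAtMost_iff[of a b a b] by (metis order.refl order.trans)
    from eventually_lipschitz[OF f this I(2) c]
    have "\<forall>\<^sub>F s in at t. \<bar>f (\<gamma> s) - f (\<gamma> t)\<bar> \<le> chord (?x s) (?x t)"
      using at_within_open[OF I(2,1)] by simp
    ultimately have "\<forall>\<^sub>F s in at t. s \<noteq> t \<longrightarrow> \<bar>f (\<gamma> s) - f (\<gamma> t)\<bar> \<le> (?v t + \<epsilon>) * \<bar>s - t\<bar>"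
    proof eventually_elim
      case (elim s)
      show ?case
      proof
        assume "s \<noteq> t"
        then have "chord (?x s) (?x t) = norm (?x s - ?x t) / \<bar>s - t\<bar> / sqrt (Im (?x s) * Im (?x t)) * \<bar>s - t\<bar>"
          by (simp add: chord_def)
        also have "\<dots> \<le> (?v t + \<epsilon>) * \<bar>s - t\<bar>" using elim(1) by (intro mult_right_mono) auto
        finally show "\<bar>f (\<gamma> s) - f (\<gamma> t)\<bar> \<le> (?v t + \<epsilon>) * \<bar>s - t\<bar>" using elim(2) by simp
      qed
    qed
    then obtain \<delta> where "\<delta> > 0" "\<And>s. s \<noteq> t \<Longrightarrow> dist s t < \<delta> \<Longrightarrow> \<bar>f (\<gamma> s) - f (\<gamma> t)\<bar> \<le> (?v t + \<epsilon>) * \<bar>s - t\<bar>"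
      unfolding eventually_at by blast
    then show "\<exists>\<delta>>0. \<forall>s\<in>{u..w}. \<bar>s - t\<bar> < \<delta> \<longrightarrow> \<bar>(f \<circ> \<gamma>) s - (f \<circ> \<gamma>) t\<bar> \<le> (?v t + \<epsilon>) * \<bar>s - t\<bar>"
    proof (intro exI[of _ \<delta>] conjI ballI impI)
      fix s assume "\<bar>s - t\<bar> < \<delta>"
      with \<open>\<And>s. s \<noteq> t \<Longrightarrow> dist s t < \<delta> \<Longrightarrow> _\<close>[of s]
      show "\<bar>(f \<circ> \<gamma>) s - (f \<circ> \<gamma>) t\<bar> \<le> (?v t + \<epsilon>) * \<bar>s - t\<bar>"
        by (cases "s = t") (simp_all add: dist_real_def)
    qed
  qed
  then have "ennreal \<bar>f (\<gamma> w) - f (\<gamma> u)\<bar> \<le> ennreal (integral {u..w} ?v)" by (simp add: ennreal_leI)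
  \<comment> \<open>From the gauge integral of \<open>dini_bound\<close> to the Lebesgue integral in
    \<open>plength\<close>; the integrand is continuous on \<open>{u..w}\<close> and
    nonnegative.\<close>
  also have "\<dots> = (\<integral>\<^sup>+t. ennreal (indicator {u..w} t *\<^sub>R ?v t) \<partial>lborel)"
  proof (rule nn_integral_has_integral_lborel[symmetric])
    show "(\<lambda>t. indicator {u..w} t *\<^sub>R ?v t) \<in> borel_measurable borel"
      using borel_measurable_continuous_on_indicator[OF _ cont] by simp
    have "((\<lambda>t. if t \<in> {u..w} then ?v t else 0) has_integral integral {u..w} ?v) UNIV"
      using integrable_integral[OF int] by (simp only: has_integral_restrict_UNIV)
    moreover have "(\<lambda>t. if t \<in> {u..w} then ?v t else 0) = (\<lambda>t. indicator {u..w} t *\<^sub>R ?v t)"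
      by (auto simp: indicator_def)
    ultimately show "((\<lambda>t. indicator {u..w} t *\<^sub>R ?v t) has_integral integral {u..w} ?v) UNIV" by simp
  qed (simp add: speed_nonneg)
  also have "\<dots> \<le> len \<gamma> a b"
    unfolding plength_def by (intro nn_integral_mono) (use uw in \<open>auto simp: indicator_def\<close>)
  finally show ?thesis .
qed

text \<open>The speed is controlled only inside the interval, so the ends are reached as limits of
  inner subintervals, using the continuity of \<open>f\<close> along the curve.\<close>

lemma lipschitz_C1:
  assumes f: "lipschitz_fun f" and C1: "C1_curve_on A \<gamma> a b"
    and \<gamma>: "continuous_map (top_of_set {a..b}) M \<gamma>" and ab: "a < b"
  shows "ennreal \<bar>f (\<gamma> b) - f (\<gamma> a)\<bar> \<le> len \<gamma> a b"
proof (cases "len \<gamma> a b")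
  case (real L)
  \<comment> \<open>The offset 2 keeps both shifts at most half of the interval, so that
    \<open>u n \<le> w n\<close> from the start.\<close>
  define u where "u n = a + (b - a) / (real n + 2)" for n
  define w where "w n = b - (b - a) / (real n + 2)" for n
  have "(\<lambda>n. (b - a) / (real n + 2)) \<longlonglongrightarrow> 0"
    using LIMSEQ_ignore_initial_segment[OF lim_const_over_n[of "b - a"], of 2] by (simp add: add.commute)
  then have uL: "u \<longlonglongrightarrow> a" and wL: "w \<longlonglongrightarrow> b"
    unfolding u_def w_def using tendsto_add[of "\<lambda>_. a" a] tendsto_diff[of "\<lambda>_. b" b] by force+
  have small: "0 < (b - a) / (real n + 2)" "(b - a) / (real n + 2) \<le> (b - a) / 2" for n
    using ab by (simp, intro divide_left_mono) auto
  have uw: "a < u n" "u n \<le> w n" "w n < b" for n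
  proof -
    define s where "s = (b - a) / (real n + 2)"
    have "0 < s" "s \<le> (b - a) / 2" using small[of n] by (simp_all only: s_def)
    moreover have "u n = a + s" "w n = b - s" by (simp_all add: u_def w_def s_def)
    ultimately show "a < u n" "u n \<le> w n" "w n < b" by simp_all
  qed
  have bound: "\<bar>f (\<gamma> (w n)) - f (\<gamma> (u n))\<bar> \<le> L" for n
    using lipschitz_C1_interior[OF f C1 \<gamma> uw] real by simp
  note cont = lipschitz_continuous_curve[OF f \<gamma>]
  have "u n \<in> {a..b}" "w n \<in> {a..b}" for n using uw[of n] by auto
  then have "(\<lambda>n. (f \<circ> \<gamma>) (u n)) \<longlonglongrightarrow> (f \<circ> \<gamma>) a" "(\<lambda>n. (f \<circ> \<gamma>) (w n)) \<longlonglongrightarrow> (f \<circ> \<gamma>) b"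
    using ab by (intro continuous_on_tendsto_compose[OF cont] uL wL; simp)+
  then have "(\<lambda>n. \<bar>f (\<gamma> (w n)) - f (\<gamma> (u n))\<bar>) \<longlonglongrightarrow> \<bar>f (\<gamma> b) - f (\<gamma> a)\<bar>"
    by (intro tendsto_rabs tendsto_diff) (simp_all add: o_def)
  then have "\<bar>f (\<gamma> b) - f (\<gamma> a)\<bar> \<le> L" by (rule LIMSEQ_le_const2) (use bound in auto)
  then show ?thesis using real by (simp add: ennreal_leI)
qed simp

lemma lipschitz_pcurve:
  assumes f: "lipschitz_fun f" and P: "pcurve M A \<gamma> a b"
  shows "ennreal \<bar>f (\<gamma> b) - f (\<gamma> a)\<bar> \<le> len \<gamma> a b"
proof -
  obtain T where T: "finite T" "{a, b} \<subseteq> T" "T \<subseteq> {a..b}"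
    and C: "\<And>p q. p \<in> T \<Longrightarrow> q \<in> T \<Longrightarrow> p < q \<Longrightarrow> {p<..<q} \<inter> T = {} \<Longrightarrow> C1_curve_on A \<gamma> p q"
    using pcurveE[OF P] by metis
  have sub: "continuous_map (top_of_set {p..q}) M \<gamma>" if "p \<in> T" "q \<in> T" for p q
  proof (rule continuous_map_from_subtopology_mono[OF pcurve_continuous[OF P]])
    have "p \<in> {a..b}" "q \<in> {a..b}" using that T(3) by auto
    then show "{p..q} \<subseteq> {a..b}" by auto
  qed
  have "pcurve M A \<gamma> a t \<and> ennreal \<bar>f (\<gamma> t) - f (\<gamma> a)\<bar> \<le> len \<gamma> a t" if "t \<in> T" "a < t" for t
    using that
  proof (induction "card {s\<in>T. s < t}" arbitrary: t rule: less_induct)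
    case less
    \<comment> \<open>The break point just before \<open>t\<close>: the induction peels off the last
      smooth piece.\<close>
    let ?p = "Max {s\<in>T. s < t}"
    have fin: "finite {s\<in>T. s < t}" using T(1) by simp
    have ne: "{s\<in>T. s < t} \<noteq> {}" using T(2) less.prems by auto
    have p: "?p \<in> T" "?p < t" using Max_in[OF fin ne] by auto
    have "{?p<..<t} \<inter> T = {}" using Max_ge[OF fin] by fastforce
    then have C1: "C1_curve_on A \<gamma> ?p t" using C p less.prems by blast
    have cm: "continuous_map (top_of_set {?p..t}) M \<gamma>" using sub p less.prems by blast
    note pc = pcurve_single[OF p(2) cm C1] and L = lipschitz_C1[OF f C1 cm p(2)]
    show ?case
    proof (cases "?p = a")
      case True
      then show ?thesis using pc L by simp
    next
      case False
      then have ap: "a < ?p" using p(1) T(3) by force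
      have "{s\<in>T. s < ?p} \<subset> {s\<in>T. s < t}" using p by auto
      then have "card {s\<in>T. s < ?p} < card {s\<in>T. s < t}" using fin by (simp add: psubset_card_mono)
      then have IH: "pcurve M A \<gamma> a ?p" "ennreal \<bar>f (\<gamma> ?p) - f (\<gamma> a)\<bar> \<le> len \<gamma> a ?p"
        using less.hyps p(1) ap by auto
      have "ennreal \<bar>f (\<gamma> t) - f (\<gamma> a)\<bar> \<le> ennreal (\<bar>f (\<gamma> ?p) - f (\<gamma> a)\<bar> + \<bar>f (\<gamma> t) - f (\<gamma> ?p)\<bar>)"
        by (intro ennreal_leI) linarith
      also have "\<dots> = ennreal \<bar>f (\<gamma> ?p) - f (\<gamma> a)\<bar> + ennreal \<bar>f (\<gamma> t) - f (\<gamma> ?p)\<bar>"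
        by (simp add: ennreal_plus)
      also have "\<dots> \<le> len \<gamma> a ?p + len \<gamma> ?p t" by (rule add_mono[OF IH(2) L])
      also have "\<dots> = len \<gamma> a t" by (rule plength_join[OF IH(1) pc, symmetric])
      finally show ?thesis using pcurve_join[OF IH(1) pc] by simp
    qed
  qed
  then show ?thesis using T(2) pcurve_less[OF P] by auto
qed

text \<open>The source of all lower bounds for distances below; each application consists in
  exhibiting a suitable \<open>f\<close>.\<close>

lemma lipschitz_edist:
  assumes "lipschitz_fun f"
  shows "ennreal \<bar>f x - f y\<bar> \<le> edist x y"
  unfolding edist_def
proof (rule INF_greatest, clarsimp)
  fix \<gamma> assume "piecewise_C1_path M A \<gamma>"
  then show "ennreal \<bar>f (\<gamma> 0) - f (\<gamma> 1)\<bar> \<le> curve_length A hyp_metric \<gamma>"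
    using lipschitz_pcurve[OF assms, of \<gamma> 0 1] by (simp add: pcurve_unit plength_unit abs_minus_commute)
qed

lemma edist_self:
  assumes "x \<in> topspace M"
  shows "edist x x = 0"
proof -
  obtain c where c: "c \<in> A" "x \<in> fst c" using assms by (auto simp: topspace_atlas)
  have C1: "C1_curve_on A (\<lambda>_. x) 0 1"
    unfolding C1_curve_on_def Let_def by (auto intro!: exI[of _ "\<lambda>_. 0"] simp: o_def)
  have cm: "continuous_map (top_of_set S) M (\<lambda>_. x)" for S :: "real set" using assms by simp
  have "speed A hyp_metric (\<lambda>_. x) t = 0" for t
    using speed_eq[OF open_UNIV UNIV_I cm c, of 0 t] by (simp add: o_def)
  then have "len (\<lambda>_. x) 0 1 = 0" unfolding plength_def by simp
  then show ?thesis using edist_le[OF pcurve_single[OF _ cm C1]] by simp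
qed

text \<open>An infimum below \<open>top\<close> is taken over a nonempty set, so a joining path
  exists.\<close>

lemma connected_space_atlas:
  assumes "\<And>x y. x \<in> topspace M \<Longrightarrow> y \<in> topspace M \<Longrightarrow> edist x y < top"
  shows "connected_space M"
proof (rule path_connected_imp_connected_space)
  show "path_connected_space M"
    unfolding path_connected_space_def pathin_def
  proof (intro ballI)
    fix x y assume xy: "x \<in> topspace M" "y \<in> topspace M"
    obtain \<gamma> where \<gamma>: "pcurve M A \<gamma> 0 1" "\<gamma> 0 = x" "\<gamma> 1 = y" by (rule edist_less[OF assms[OF xy]])
    show "\<exists>g. continuous_map (top_of_set {0..1::real}) M g \<and> g 0 = x \<and> g 1 = y"
    proof (rule exI[of _ \<gamma>])
      show "continuous_map (top_of_set {0..1::real}) M \<gamma> \<and> \<gamma> 0 = x \<and> \<gamma> 1 = y"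
        using pcurve_continuous[OF \<gamma>(1)] \<gamma>(2,3) by simp
    qed
  qed
qed

end

section \<open>The double of an ideal region\<close>

context half_plane_atlas
begin

lemma lipschitz_continuous_map:
  assumes "lipschitz_fun f"
  shows "continuous_map M euclideanreal f"
  unfolding continuous_map_eq_topcontinuous_at topcontinuous_at_def
proof (intro ballI allI impI conjI)
  fix p V assume p: "p \<in> topspace M" and V: "openin euclideanreal V \<and> f p \<in> V"
  then obtain \<epsilon> where \<epsilon>: "0 < \<epsilon>" "ball (f p) \<epsilon> \<subseteq> V" by (metis open_contains_ball open_openin)
  from p obtain c where c: "c \<in> A" "p \<in> fst c" by (auto simp: topspace_atlas)
  obtain e where e: "e > 0" "\<And>p'. p' \<in> fst c \<Longrightarrow> dist (snd c p') (snd c p) < e \<Longrightarrow>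
      \<bar>f p' - f p\<bar> \<le> chord (snd c p') (snd c p)"
    using assms c unfolding lipschitz_fun_def by metis
  have "((\<lambda>x. chord x (snd c p)) \<longlongrightarrow> 0) (at (snd c p))"
    by (rule chord_tendsto_0[OF tendsto_ident_at chart_upper[OF c]])
  then have "\<forall>\<^sub>F x in at (snd c p). chord x (snd c p) < \<epsilon>" using \<epsilon>(1) by (rule order_tendstoD)
  then obtain d where d: "d > 0" "\<And>x. x \<noteq> snd c p \<Longrightarrow> dist x (snd c p) < d \<Longrightarrow> chord x (snd c p) < \<epsilon>"
    unfolding eventually_at by blast
  have small: "chord x (snd c p) < \<epsilon>" if "dist x (snd c p) < d" for x
    using d(2)[OF _ that] \<epsilon>(1) by (cases "x = snd c p") (auto simp: chord_def)
  let ?U = "{q \<in> fst c. snd c q \<in> ball (snd c p) (min e d)}"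
  have "openin M ?U" by (rule openin_chart_preimage[OF c(1) open_ball])
  moreover have "p \<in> ?U" using c e(1) d(1) by simp
  moreover have "f q \<in> V" if "q \<in> ?U" for q
  proof -
    have "dist (snd c q) (snd c p) < e" "dist (snd c q) (snd c p) < d" using that by (auto simp: dist_commute)
    then have "\<bar>f q - f p\<bar> < \<epsilon>" using e(2)[of q] small[of "snd c q"] that by fastforce
    then have "f q \<in> ball (f p) \<epsilon>" by (simp add: dist_real_def abs_minus_commute)
    then show ?thesis using \<epsilon>(2) by blast
  qed
  ultimately show "\<exists>U. openin M U \<and> p \<in> U \<and> (\<forall>y\<in>U. f y \<in> V)" by (intro exI[of _ ?U]) blast
qed auto

text \<open>The same Lipschitz functions that bound distances are continuous, so they also separate
  points topologically.\<close>

lemma Hausdorff_atlas: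
  assumes "\<And>p q. p \<in> topspace M \<Longrightarrow> q \<in> topspace M \<Longrightarrow> p \<noteq> q \<Longrightarrow> \<exists>f. lipschitz_fun f \<and> f p \<noteq> f q"
  shows "Hausdorff_space M"
  unfolding Hausdorff_space_def
proof (intro allI impI)
  fix p q assume pq: "p \<in> topspace M \<and> q \<in> topspace M \<and> p \<noteq> q"
  then obtain f where f: "lipschitz_fun f" "f p \<noteq> f q" using assms by meson
  obtain U V where UV: "open U" "open V" "f p \<in> U" "f q \<in> V" "U \<inter> V = {}"
    using hausdorff[OF f(2)] by blast
  have "openin M {x \<in> topspace M. f x \<in> U}" "openin M {x \<in> topspace M. f x \<in> V}"
    using openin_continuous_map_preimage[OF lipschitz_continuous_map[OF f(1)]] UV by auto
  moreover have "disjnt {x \<in> topspace M. f x \<in> U} {x \<in> topspace M. f x \<in> V}"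
    using UV(5) by (auto simp: disjnt_def)
  ultimately show "\<exists>U V. openin M U \<and> openin M V \<and> p \<in> U \<and> q \<in> V \<and> disjnt U V"
    using pq UV(3,4) by (intro exI[of _ "{x \<in> topspace M. f x \<in> U}"] exI[of _ "{x \<in> topspace M. f x \<in> V}"]) auto
qed

end

section \<open>The region, its edges and their collars\<close>

definition centre :: "nat \<Rightarrow> real" where
  "centre k = fact (k + 9)"

definition rad :: "nat \<Rightarrow> real" where
  "rad k = sqrt (((centre k)\<^sup>2 + 1) / 2)"

abbreviation cdist :: "nat \<Rightarrow> complex \<Rightarrow> real" where
  "cdist k z \<equiv> norm (z - of_real (centre k))"

abbreviation reflect :: "nat \<Rightarrow> complex \<Rightarrow> complex" where
  "reflect k \<equiv> inversion (centre k) (rad k)"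

definition region :: "complex set" where
  "region = {z. 0 < Im z \<and> (\<forall>k. rad k \<le> cdist k z)}"

definition edges :: "complex set" where
  "edges = {z \<in> region. \<exists>k. cdist k z = rad k}"

text \<open>The factors \<open>4/5\<close> and \<open>5/4\<close> are reciprocal, so the reflection
  in the edge maps its collar to itself; they are close enough to 1 for different collars to be
  disjoint.\<close>

definition collar :: "nat \<Rightarrow> complex set" where
  "collar k = {z. 0 < Im z \<and> 4/5 * (rad k)\<^sup>2 < (cdist k z)\<^sup>2 \<and> (cdist k z)\<^sup>2 < 5/4 * (rad k)\<^sup>2}"

text \<open>The reason for a shifted factorial: the ratios \<open>k + 10\<close> are at least 10,
  which keeps the edges apart, and unbounded, which makes the gaps between them arbitrarily
  wide.\<close>

lemma centre_Suc: "centre (Suc k) = (real k + 10) * centre k"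
  unfolding centre_def add_Suc fact_Suc by simp

lemma centre_ge_10: "10 \<le> centre k"
proof -
  have "(10::real) \<le> fact 9" by (simp add: fact_numeral)
  also have "\<dots> \<le> fact (k + 9)" by (intro fact_mono) auto
  finally show ?thesis by (simp add: centre_def)
qed

lemma centre_mono: "j < k \<Longrightarrow> 10 * centre j \<le> centre k"
proof (induction k)
  case (Suc k)
  have "centre j \<le> centre k \<or> j = k" using Suc centre_ge_10[of j] by (cases "j < k") auto
  then have "centre j \<le> centre k" by auto
  moreover have "10 * centre k \<le> centre (Suc k)"
    unfolding centre_Suc using centre_ge_10[of k] by (intro mult_right_mono) auto
  ultimately show ?case by linarith
qed simp

lemma centre_ge_index: "real k \<le> centre k"
proof (induction k)
  case (Suc k)
  have "centre k + 1 \<le> centre (Suc k)"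
  proof -
    have "10 * centre k \<le> centre (Suc k)"
      unfolding centre_Suc using centre_ge_10[of k] by (intro mult_right_mono) auto
    then show ?thesis using centre_ge_10[of k] by linarith
  qed
  then show ?case using Suc by simp
qed (use centre_ge_10[of 0] in simp)

lemma rad_sq: "(rad k)\<^sup>2 = ((centre k)\<^sup>2 + 1) / 2"
  by (simp add: rad_def)

lemma rad_pos: "0 < rad k"
  by (simp add: rad_def add_nonneg_pos)

lemma cdist_sq: "(cdist k z)\<^sup>2 = (norm z)\<^sup>2 - 2 * centre k * Re z + (centre k)\<^sup>2"
  by (simp add: cmod_power2) (simp add: power2_eq_square algebra_simps)

lemma reflect_isom: "reflect k \<in> hyp_isoms"
  using rad_pos by (auto simp: hyp_isoms_def)

lemma cdist_pos: "0 < Im z \<Longrightarrow> 0 < cdist k z"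
  by auto

lemma cdist_reflect: "cdist k (reflect k z) = (rad k)\<^sup>2 / cdist k z"
  by (rule norm_inversion)

lemma reflect_reflect: "0 < Im z \<Longrightarrow> reflect k (reflect k z) = z"
  by (rule inversion_involution) (use rad_pos in auto)

lemma reflect_fixed: "cdist k z = rad k \<Longrightarrow> reflect k z = z"
  by (rule inversion_fixed[OF _ rad_pos])

text \<open>\<open>5/4 * (rad k)^2\<close> is \<open>5/8 * ((centre k)^2 + 1)\<close>, and
  \<open>5/8 < 16/25\<close> leaves room for the additive constant, so \<open>cdist k z\<close> is
  at most \<open>4/5\<close> of the centre. The two resulting bounds on the modulus have ratio 9,
  below the ratio 10 of successive centres; hence shells of different edges do not meet.\<close>

lemma shell:
  assumes "(cdist k z)\<^sup>2 \<le> 5/4 * (rad k)\<^sup>2"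
  shows "centre k / 5 \<le> norm z" "norm z \<le> 9/5 * centre k"
proof -
  have c: "10 \<le> centre k" by (rule centre_ge_10)
  then have "100 \<le> (centre k)\<^sup>2" using power_mono[of 10 "centre k" 2] by simp
  moreover have "(cdist k z)\<^sup>2 \<le> 5/8 * (centre k)\<^sup>2 + 5/8" using assms by (simp add: rad_sq)
  moreover have "(4/5 * centre k)\<^sup>2 = 16/25 * (centre k)\<^sup>2" by (simp add: power_mult_distrib power2_eq_square)
  ultimately have "(cdist k z)\<^sup>2 \<le> (4/5 * centre k)\<^sup>2" by linarith
  then have d: "cdist k z \<le> 4/5 * centre k" by (rule power2_le_imp_le) (use c in auto)
  have "norm (of_real (centre k) :: complex) = centre k" using c by simp
  then show "centre k / 5 \<le> norm z" "norm z \<le> 9/5 * centre k"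
    using d norm_triangle_ineq2[of "of_real (centre k)" z] norm_triangle_ineq2[of z "of_real (centre k)"]
    by (auto simp: norm_minus_commute)
qed

lemma shell_unique:
  assumes "(cdist j z)\<^sup>2 \<le> 5/4 * (rad j)\<^sup>2" "(cdist k z)\<^sup>2 \<le> 5/4 * (rad k)\<^sup>2"
  shows "j = k"
proof -
  have "\<not> 10 * centre j \<le> centre k" "\<not> 10 * centre k \<le> centre j"
    using shell[OF assms(1)] shell[OF assms(2)] centre_ge_10[of j] centre_ge_10[of k] by linarith+
  then show ?thesis using centre_mono by (metis linorder_neqE_nat)
qed

lemma le_rad_shell:
  assumes "cdist k z \<le> rad k"
  shows "(cdist k z)\<^sup>2 \<le> 5/4 * (rad k)\<^sup>2"
proof -
  have "(cdist k z)\<^sup>2 \<le> (rad k)\<^sup>2" using assms by (intro power_mono) auto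
  moreover have "0 \<le> (rad k)\<^sup>2" by simp
  ultimately show ?thesis by linarith
qed

lemma collarD:
  assumes "z \<in> collar k"
  shows "0 < Im z" "(cdist k z)\<^sup>2 \<le> 5/4 * (rad k)\<^sup>2"
  using assms by (auto simp: collar_def)

lemma collar_other:
  assumes "z \<in> collar k" "j \<noteq> k"
  shows "rad j < cdist j z"
  using shell_unique[OF collarD(2)[OF assms(1)], of j] le_rad_shell[of z j] assms(2) by force

lemma collar_region:
  assumes "z \<in> collar k"
  shows "z \<in> region \<longleftrightarrow> rad k \<le> cdist k z"
proof
  assume k: "rad k \<le> cdist k z"
  have "rad j \<le> cdist j z" for j
    using collar_other[OF assms, of j] k by (cases "j = k") auto
  then show "z \<in> region" using collarD(1)[OF assms] by (simp add: region_def)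
qed (simp add: region_def)

lemma collar_edges:
  assumes "z \<in> collar k"
  shows "z \<in> edges \<longleftrightarrow> cdist k z = rad k"
proof
  assume "z \<in> edges"
  then obtain j where "cdist j z = rad j" by (auto simp: edges_def)
  then show "cdist k z = rad k" using collar_other[OF assms, of j] by (cases "j = k") auto
next
  assume "cdist k z = rad k"
  then show "z \<in> edges" using collar_region[OF assms] by (auto simp: edges_def)
qed

lemma collar_disjoint: "z \<in> collar j \<Longrightarrow> z \<in> collar k \<Longrightarrow> j = k"
  using shell_unique collarD(2) by metis

lemma reflect_collar:
  assumes "z \<in> collar k"
  shows "reflect k z \<in> collar k"
proof -
  have z: "0 < Im z" "4/5 * (rad k)\<^sup>2 < (cdist k z)\<^sup>2" "(cdist k z)\<^sup>2 < 5/4 * (rad k)\<^sup>2"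
    using assms by (auto simp: collar_def)
  have r: "(rad k)\<^sup>2 > 0" using rad_pos[of k] by simp
  have "(cdist k (reflect k z))\<^sup>2 = (rad k)\<^sup>2 * (rad k)\<^sup>2 / (cdist k z)\<^sup>2"
    by (simp add: cdist_reflect power2_eq_square)
  moreover have "4/5 * R < R * R / d \<and> R * R / d < 5/4 * R" if "R > 0" "4/5 * R < d" "d < 5/4 * R" for R d :: real
  proof -
    have "d > 0" using that by linarith
    then show ?thesis using that by (simp add: field_simps)
  qed
  ultimately have "4/5 * (rad k)\<^sup>2 < (cdist k (reflect k z))\<^sup>2 \<and> (cdist k (reflect k z))\<^sup>2 < 5/4 * (rad k)\<^sup>2"
    using r z(2,3) by metis
  then show ?thesis
    using hyp_isoms_Im[OF reflect_isom z(1)] unfolding collar_def by blast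
qed

lemma open_collar: "open (collar k)"
proof -
  have "collar k = {z. 0 < Im z} \<inter> ({z. 4/5 * (rad k)\<^sup>2 < (cdist k z)\<^sup>2} \<inter> {z. (cdist k z)\<^sup>2 < 5/4 * (rad k)\<^sup>2})"
    by (auto simp: collar_def)
  then show ?thesis by (auto intro!: open_Int open_Collect_less continuous_intros)
qed

lemma region_Im: "z \<in> region \<Longrightarrow> 0 < Im z"
  by (simp add: region_def)

lemma edges_collar:
  assumes "z \<in> edges"
  obtains k where "z \<in> collar k"
proof -
  obtain k where "cdist k z = rad k" "0 < Im z" using assms by (auto simp: edges_def region_def)
  then have "z \<in> collar k" using rad_pos[of k] by (simp add: collar_def)
  then show thesis by (rule that)
qed

text \<open>An infinite intersection of open conditions, but a locally finite one: a half-disc that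
  meets \<open>ball 0 B\<close> has \<open>centre k / 5 < B\<close>, and
  \<open>centre k \<ge> k\<close>.\<close>

lemma open_interior: "open (region - edges)"
proof -
  define K where "K B = nat \<lceil>5 * B\<rceil>" for B :: real
  have "(region - edges) \<inter> ball 0 B = ball 0 B \<inter> {z. 0 < Im z} \<inter> (\<Inter>k\<in>{..K B}. {z. rad k < cdist k z})" for B
  proof (intro equalityI subsetI)
    fix z assume z: "z \<in> ball 0 B \<inter> {z. 0 < Im z} \<inter> (\<Inter>k\<in>{..K B}. {z. rad k < cdist k z})"
    have "rad k < cdist k z" for k
    proof (cases "k \<le> K B")
      case False
      then have "real k > 5 * B" unfolding K_def by linarith
      then have "centre k / 5 > B" using centre_ge_index[of k] by linarith
      moreover have "norm z < B" using z by simp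
      ultimately show ?thesis using shell(1)[OF le_rad_shell[of z k]] by linarith
    qed (use z in auto)
    then have "z \<in> region - edges" using z by (auto simp: region_def edges_def less_imp_le) (metis less_irrefl)
    then show "z \<in> (region - edges) \<inter> ball 0 B" using z by auto
  next
    fix z assume z: "z \<in> (region - edges) \<inter> ball 0 B"
    have "rad k < cdist k z" for k
    proof -
      have "rad k \<le> cdist k z" "cdist k z \<noteq> rad k" using z by (auto simp: region_def edges_def)
      then show ?thesis by linarith
    qed
    then show "z \<in> ball 0 B \<inter> {z. 0 < Im z} \<inter> (\<Inter>k\<in>{..K B}. {z. rad k < cdist k z})"
      using z region_Im by auto
  qed
  moreover have "open (ball 0 B \<inter> {z. 0 < Im z} \<inter> (\<Inter>k\<in>{..K B}. {z. rad k < cdist k z}))" for B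
    by (auto intro!: open_Int open_INT open_Collect_less continuous_intros)
  ultimately have "open ((region - edges) \<inter> ball 0 B)" for B by simp
  then have "open (\<Union>B. (region - edges) \<inter> ball 0 B)" by blast
  moreover have "(\<Union>B. (region - edges) \<inter> ball 0 B) = region - edges"
  proof -
    have "z \<in> ball 0 (norm z + 1)" for z :: complex by simp
    then show ?thesis by blast
  qed
  ultimately show ?thesis by simp
qed

text \<open>The surface is the double of \<open>region\<close>; the second copy is represented by its mirror image
  in the lower half plane, and points of the edges only by their representative in the first copy.\<close>

definition pt :: "bool \<Rightarrow> complex \<Rightarrow> complex set" where
  "pt s z = {if s \<or> z \<in> edges then z else cnj z}"

definition up :: "complex set \<Rightarrow> bool" where
  "up p \<longleftrightarrow> 0 < Im (the_elem p)"

definition base_pt :: "complex set \<Rightarrow> complex" where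
  "base_pt p = (if up p then the_elem p else cnj (the_elem p))"

lemma up_pt: "0 < Im z \<Longrightarrow> up (pt s z) \<longleftrightarrow> s \<or> z \<in> edges"
  by (simp add: up_def pt_def)

lemma base_pt_pt: "0 < Im z \<Longrightarrow> base_pt (pt s z) = z"
  unfolding base_pt_def by (simp add: up_pt) (simp add: pt_def)

lemma pt_eq_iff:
  assumes "0 < Im z" "0 < Im w"
  shows "pt s z = pt t w \<longleftrightarrow> z = w \<and> (s = t \<or> z \<in> edges)"
proof
  assume eq: "pt s z = pt t w"
  then have "z = w" using base_pt_pt assms by metis
  moreover have "up (pt s z) = up (pt t w)" using eq by simp
  ultimately show "z = w \<and> (s = t \<or> z \<in> edges)" using up_pt assms by auto
qed (auto simp: pt_def)

section \<open>Charts of the double\<close>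

definition sheet_chart :: "bool \<Rightarrow> (complex set, complex) chart" where
  "sheet_chart s = (pt s ` (region - edges), base_pt)"

text \<open>Unfolds the double across edge \<open>k\<close>: the first copy keeps its coordinate and
  the second is reflected to the inner side, so that the image is the full two-sided collar.\<close>

definition edge_chart :: "nat \<Rightarrow> (complex set, complex) chart" where
  "edge_chart k = ({pt s z | s z. z \<in> region \<inter> collar k},
     \<lambda>p. if up p then base_pt p else reflect k (base_pt p))"

definition atlas :: "(complex set, complex) chart set" where
  "atlas = range sheet_chart \<union> range edge_chart"

lemma fst_sheet_chart: "fst (sheet_chart s) = pt s ` (region - edges)"
  by (simp add: sheet_chart_def)

lemma snd_sheet_chart: "z \<in> region \<Longrightarrow> snd (sheet_chart s) (pt t z) = z"
  by (simp add: sheet_chart_def base_pt_pt region_Im)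

lemma fst_edge_chart: "fst (edge_chart k) = {pt s z | s z. z \<in> region \<inter> collar k}"
  by (simp add: edge_chart_def)

lemma snd_edge_chart:
  assumes "z \<in> region" "z \<in> collar k"
  shows "snd (edge_chart k) (pt s z) = (if s then z else reflect k z)"
  using assms collar_edges[OF assms(2)] reflect_fixed
  by (auto simp: edge_chart_def base_pt_pt up_pt region_Im)

lemma image_edge_chart:
  assumes "S \<subseteq> region \<inter> collar k"
  shows "snd (edge_chart k) ` pt s ` S = (if s then S else reflect k ` S)"
proof -
  have "snd (edge_chart k) (pt s z) = (if s then z else reflect k z)" if "z \<in> S" for z
  proof -
    have "z \<in> region" "z \<in> collar k" using that assms by auto
    then show ?thesis by (rule snd_edge_chart)
  qed
  then show ?thesis by (simp add: image_image cong: image_cong)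
qed

lemma image_sheet_chart:
  assumes "S \<subseteq> region"
  shows "snd (sheet_chart s) ` pt t ` S = S"
proof -
  have "snd (sheet_chart s) (pt t z) = z" if "z \<in> S" for z
    using snd_sheet_chart that assms by blast
  then show ?thesis by (simp add: image_image)
qed

lemma reflect_image_collar:
  "reflect k ` {z \<in> collar k. rad k < cdist k z} = {z \<in> collar k. cdist k z < rad k}"
  "reflect k ` {z \<in> collar k. rad k \<le> cdist k z} = {z \<in> collar k. cdist k z \<le> rad k}"
proof -
  have r: "rad k > 0" by (rule rad_pos)
  have eq: "cdist k (reflect k z) = rad k * rad k / cdist k z" for z
    by (simp add: cdist_reflect power2_eq_square)
  have 1: "(cdist k (reflect k z) < rad k \<longleftrightarrow> rad k < cdist k z) \<and>
     (cdist k (reflect k z) \<le> rad k \<longleftrightarrow> rad k \<le> cdist k z) \<and>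
     (rad k < cdist k (reflect k z) \<longleftrightarrow> cdist k z < rad k) \<and>
     (rad k \<le> cdist k (reflect k z) \<longleftrightarrow> cdist k z \<le> rad k)" if "z \<in> collar k" for z
    unfolding eq using r cdist_pos[OF collarD(1)[OF that], of k]
    by (simp add: divide_less_eq divide_le_eq less_divide_eq le_divide_eq)
  have 2: "z = reflect k (reflect k z)" if "z \<in> collar k" for z
    using reflect_reflect[OF collarD(1)[OF that]] by simp
  show "reflect k ` {z \<in> collar k. rad k < cdist k z} = {z \<in> collar k. cdist k z < rad k}"
    using 1 2 reflect_collar by (intro equalityI subsetI) (auto intro!: image_eqI[where x = "reflect k _"])
  show "reflect k ` {z \<in> collar k. rad k \<le> cdist k z} = {z \<in> collar k. cdist k z \<le> rad k}"
    using 1 2 reflect_collar by (intro equalityI subsetI) (auto intro!: image_eqI[where x = "reflect k _"])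
qed

lemma region_collar: "region \<inter> collar k = {z \<in> collar k. rad k \<le> cdist k z}"
  using collar_region by auto

lemma interior_collar: "region \<inter> collar k - edges = {z \<in> collar k. rad k < cdist k z}"
  using collar_region collar_edges by (auto simp: less_le)

lemma image_edge_chart_whole: "snd (edge_chart k) ` fst (edge_chart k) = collar k"
proof -
  have "fst (edge_chart k) = pt True ` (region \<inter> collar k) \<union> pt False ` (region \<inter> collar k)"
  proof (intro equalityI subsetI)
    fix p assume "p \<in> fst (edge_chart k)"
    then obtain s z where "p = pt s z" "z \<in> region \<inter> collar k" by (auto simp: fst_edge_chart)
    then show "p \<in> pt True ` (region \<inter> collar k) \<union> pt False ` (region \<inter> collar k)" by (cases s) auto
  qed (auto simp: fst_edge_chart)
  then have "snd (edge_chart k) ` fst (edge_chart k)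
      = (region \<inter> collar k) \<union> reflect k ` (region \<inter> collar k)"
    by (simp add: image_Un image_edge_chart)
  also have "\<dots> = collar k"
    unfolding region_collar reflect_image_collar by auto
  finally show ?thesis .
qed

lemma overlap_sheet_edge:
  "fst (sheet_chart s) \<inter> fst (edge_chart k) = pt s ` (region \<inter> collar k - edges)"
proof (intro equalityI subsetI)
  fix p assume "p \<in> fst (sheet_chart s) \<inter> fst (edge_chart k)"
  then obtain z t w where "z \<in> region - edges" "p = pt s z" "p = pt t w" "w \<in> region \<inter> collar k"
    by (auto simp: fst_sheet_chart fst_edge_chart)
  then have "z = w" using pt_eq_iff[of z w s t] region_Im by auto
  then show "p \<in> pt s ` (region \<inter> collar k - edges)" using \<open>p = pt s z\<close> \<open>z \<in> _\<close> \<open>w \<in> _\<close> by auto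
qed (auto simp: fst_sheet_chart fst_edge_chart)

lemma overlap_sheets: "s \<noteq> t \<Longrightarrow> fst (sheet_chart s) \<inter> fst (sheet_chart t) = {}"
  using pt_eq_iff region_Im by (fastforce simp: fst_sheet_chart)

lemma overlap_edges: "j \<noteq> k \<Longrightarrow> fst (edge_chart j) \<inter> fst (edge_chart k) = {}"
proof (rule ccontr)
  assume "j \<noteq> k" "fst (edge_chart j) \<inter> fst (edge_chart k) \<noteq> {}"
  then obtain s z t w where zw: "pt s z = pt t w" "z \<in> region \<inter> collar j" "w \<in> region \<inter> collar k"
    by (force simp: fst_edge_chart)
  then have "z = w" using pt_eq_iff[of z w s t] region_Im by auto
  then show False using zw collar_disjoint \<open>j \<noteq> k\<close> by blast
qed

lemma open_collar_parts:
  "open {z \<in> collar k. rad k < cdist k z}" "open {z \<in> collar k. cdist k z < rad k}"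
proof -
  have "{z \<in> collar k. rad k < cdist k z} = collar k \<inter> {z. rad k < cdist k z}"
    "{z \<in> collar k. cdist k z < rad k} = collar k \<inter> {z. cdist k z < rad k}" by auto
  then show "open {z \<in> collar k. rad k < cdist k z}" "open {z \<in> collar k. cdist k z < rad k}"
    using open_collar by (auto intro!: open_Int open_Collect_less continuous_intros)
qed

lemma id_isom: "id \<in> hyp_isoms"
  by (simp add: hyp_isoms_def)

lemma atlas_overlap:
  assumes "c \<in> atlas" "c' \<in> atlas"
  shows "open (snd c ` (fst c \<inter> fst c')) \<and> (\<exists>f\<in>hyp_isoms. \<forall>p\<in>fst c \<inter> fst c'. snd c' p = f (snd c p))"
proof -
  have same: "\<exists>f\<in>hyp_isoms. \<forall>p\<in>fst c \<inter> fst c. snd c p = f (snd c p)" for c :: "(complex set, complex) chart"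
    by (rule bexI[OF _ id_isom]) simp
  have disj: "open (snd c ` (fst c \<inter> fst c')) \<and> (\<exists>f\<in>hyp_isoms. \<forall>p\<in>fst c \<inter> fst c'. snd c' p = f (snd c p))"
    if "fst c \<inter> fst c' = {}" for c c' :: "(complex set, complex) chart"
    unfolding that using id_isom by auto
  have sub: "{z \<in> collar k. rad k < cdist k z} \<subseteq> region \<inter> collar k" for k
    unfolding region_collar by auto
  have f: "(if s then id else reflect k) \<in> hyp_isoms" for s k using id_isom reflect_isom by auto
  from assms consider (ss) s t where "c = sheet_chart s" "c' = sheet_chart t"
    | (se) s k where "c = sheet_chart s" "c' = edge_chart k"
    | (es) s k where "c = edge_chart k" "c' = sheet_chart s"
    | (ee) j k where "c = edge_chart j" "c' = edge_chart k"
    unfolding atlas_def by blast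
  then show ?thesis
  proof cases
    case ss
    show ?thesis
    proof (cases "s = t")
      case True
      have "snd c ` (fst c \<inter> fst c') = region - edges"
        using image_sheet_chart[of "region - edges" s s] True ss by (simp add: fst_sheet_chart)
      then show ?thesis using open_interior same[of c] ss True by simp
    next
      case False
      then have "fst c \<inter> fst c' = {}" unfolding ss by (rule overlap_sheets)
      then show ?thesis by (rule disj)
    qed
  next
    case se
    have "snd c ` (fst c \<inter> fst c') = {z \<in> collar k. rad k < cdist k z}"
      unfolding se overlap_sheet_edge interior_collar[symmetric] by (rule image_sheet_chart) auto
    moreover have "snd c' p = (if s then id else reflect k) (snd c p)" if "p \<in> fst c \<inter> fst c'" for p
    proof -
      obtain z where "p = pt s z" "z \<in> region" "z \<in> collar k"
        using \<open>p \<in> _\<close> unfolding se overlap_sheet_edge by blast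
      then show ?thesis by (simp add: se snd_sheet_chart snd_edge_chart)
    qed
    ultimately show ?thesis using open_collar_parts(1)[of k] f[of s k]
      by (intro conjI bexI[of _ "if s then id else reflect k"]) auto
  next
    case es
    have i: "fst c \<inter> fst c' = pt s ` {z \<in> collar k. rad k < cdist k z}"
      unfolding es using overlap_sheet_edge[of s k] by (simp add: Int_commute interior_collar)
    have "snd c ` (fst c \<inter> fst c') = (if s then {z \<in> collar k. rad k < cdist k z}
        else {z \<in> collar k. cdist k z < rad k})"
      unfolding i unfolding es image_edge_chart[OF sub] reflect_image_collar by (rule refl)
    moreover have "snd c' p = (if s then id else reflect k) (snd c p)" if p: "p \<in> fst c \<inter> fst c'" for p
    proof -
      obtain z where z: "p = pt s z" "z \<in> collar k" "rad k < cdist k z" using p i by auto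
      then have "z \<in> region" using sub by auto
      \<comment> \<open>A reflection is its own inverse, so the same map serves both directions of
        the chart change.\<close>
      then show ?thesis using z reflect_reflect[OF collarD(1)[OF z(2)]]
        unfolding es by (simp add: snd_sheet_chart snd_edge_chart)
    qed
    ultimately show ?thesis using open_collar_parts[of k] f[of s k]
      by (intro conjI bexI[of _ "if s then id else reflect k"]) (auto split: if_splits)
  next
    case ee
    show ?thesis
    proof (cases "j = k")
      case True
      then show ?thesis using image_edge_chart_whole open_collar same[of c] ee by simp
    next
      case False
      then have "fst c \<inter> fst c' = {}" unfolding ee by (rule overlap_edges)
      then show ?thesis by (rule disj)
    qed
  qed
qed

lemma half_plane_atlas_atlas: "half_plane_atlas atlas"
proof
  fix c assume "c \<in> atlas"
  then consider (s) s where "c = sheet_chart s" | (e) k where "c = edge_chart k"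
    unfolding atlas_def by blast
  note cases = this
  show "inj_on (snd c) (fst c)"
    using cases
  proof cases
    case s
    then show ?thesis by (auto intro!: inj_onI simp: fst_sheet_chart snd_sheet_chart)
  next
    case e
    show ?thesis
    proof (rule inj_onI)
      fix p q assume pq: "p \<in> fst c" "q \<in> fst c" "snd c p = snd c q"
      obtain s z where z: "p = pt s z" "z \<in> region" "z \<in> collar k" using pq(1) e by (auto simp: fst_edge_chart)
      obtain t w where w: "q = pt t w" "w \<in> region" "w \<in> collar k" using pq(2) e by (auto simp: fst_edge_chart)
      have eq: "(if s then z else reflect k z) = (if t then w else reflect k w)"
        using pq(3) z w by (simp add: e snd_edge_chart)
      have inv: "reflect k (reflect k z) = z" "reflect k (reflect k w) = w"
        using reflect_reflect collarD(1) z w by auto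
      have gez: "rad k \<le> cdist k z" and gew: "rad k \<le> cdist k w" using collar_region z w by auto
      have lez: "cdist k (reflect k z) \<le> rad k" and lew: "cdist k (reflect k w) \<le> rad k"
        using reflect_image_collar(2)[of k] gez gew z w by blast+
      show "p = q"
      proof (cases "s = t")
        case True
        then have "z = w" using eq inv by (metis (full_types))
        then show ?thesis using True z w by simp
      next
        case False
        \<comment> \<open>A coordinate reached from both copies lies on both closed sides of the
          edge, hence on the edge, where the copies are identified.\<close>
        have "z = w \<and> cdist k z = rad k"
        proof (cases s)
          case True
          then have "z = reflect k w" using eq False by simp
          then have "cdist k z = rad k" using gez lew by simp
          then show ?thesis using reflect_fixed \<open>z = reflect k w\<close> inv by metis
        next
          case f: False
          then have "w = reflect k z" using eq False by simp
          then have "cdist k w = rad k" using gew lez by simp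
          then show ?thesis using reflect_fixed \<open>w = reflect k z\<close> inv by metis
        qed
        moreover from this have "z \<in> edges" using collar_edges z by blast
        ultimately show ?thesis using z w by (simp add: pt_def)
      qed
    qed
  qed
  show "0 < Im (snd c p)" if "p \<in> fst c" for p
    using cases
  proof cases
    case s
    then show ?thesis using that region_Im by (auto simp: fst_sheet_chart snd_sheet_chart)
  next
    case e
    then have "snd c p \<in> collar k" using image_edge_chart_whole[of k] that by blast
    then show ?thesis by (rule collarD)
  qed
next
  show "countable atlas" unfolding atlas_def by auto
qed (use atlas_overlap in blast)+

section \<open>The surface and functions given copy by copy\<close>

interpretation S: half_plane_atlas atlas
  by (rule half_plane_atlas_atlas)

lemma topspace_surface: "topspace S.M = {pt s z | s z. z \<in> region}"
proof -
  have "topspace S.M = (\<Union>s. fst (sheet_chart s)) \<union> (\<Union>k. fst (edge_chart k))"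
    by (simp only: S.topspace_atlas) (auto simp: atlas_def)
  also have "\<dots> = {pt s z | s z. z \<in> region}"
  proof (intro equalityI subsetI)
    fix p assume "p \<in> {pt s z | s z. z \<in> region}"
    then obtain s z where p: "p = pt s z" "z \<in> region" by auto
    show "p \<in> (\<Union>s. fst (sheet_chart s)) \<union> (\<Union>k. fst (edge_chart k))"
    proof (cases "z \<in> edges")
      case True
      then obtain k where "z \<in> collar k" by (rule edges_collar)
      then show ?thesis using p by (auto simp: fst_edge_chart)
    qed (use p in \<open>auto simp: fst_sheet_chart\<close>)
  qed (auto simp: fst_sheet_chart fst_edge_chart)
  finally show ?thesis .
qed

lemma pt_in_surface: "z \<in> region \<Longrightarrow> pt s z \<in> topspace S.M"
  unfolding topspace_surface by blast

text \<open>Edge points are represented in the first copy, so there this reads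
  \<open>F True\<close>; agreement of both halves on \<open>edges\<close> removes the
  asymmetry.\<close>

definition sheet_fun :: "(bool \<Rightarrow> complex \<Rightarrow> real) \<Rightarrow> complex set \<Rightarrow> real" where
  "sheet_fun F p = F (up p) (base_pt p)"

lemma sheet_fun_pt:
  assumes "\<And>z. z \<in> edges \<Longrightarrow> F True z = F False z" "z \<in> region"
  shows "sheet_fun F (pt s z) = F s z"
  using assms region_Im[OF assms(2)] unfolding sheet_fun_def
  by (cases s; cases "z \<in> edges") (auto simp: up_pt base_pt_pt)

text \<open>Two points of the same copy are compared by the hypothesis, since \<open>chord\<close>
  is invariant under the reflection in the edge chart. Points of different copies are compared only
  when one of them is on the edge; it then belongs to the copy of the other, with the same value of
  \<open>F\<close>.\<close>

lemma lipschitz_sheet_fun: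
  assumes F: "\<And>s z w. z \<in> region \<Longrightarrow> w \<in> region \<Longrightarrow> \<bar>F s z - F s w\<bar> \<le> chord z w"
    and E: "\<And>z. z \<in> edges \<Longrightarrow> F True z = F False z"
  shows "S.lipschitz_fun (sheet_fun F)"
  unfolding S.lipschitz_fun_def
proof (intro ballI)
  have val: "sheet_fun F (pt s z) = F s z" if "z \<in> region" for s z
    using sheet_fun_pt[of F, OF E that] .
  fix c p assume c: "c \<in> atlas" and p: "p \<in> fst c"
  from c consider (s) s where "c = sheet_chart s" | (e) k where "c = edge_chart k"
    unfolding atlas_def by blast
  then show "\<exists>e>0. \<forall>p'\<in>fst c. dist (snd c p') (snd c p) < e \<longrightarrow>
      \<bar>sheet_fun F p' - sheet_fun F p\<bar> \<le> chord (snd c p') (snd c p)"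
  proof cases
    case s
    have "\<bar>sheet_fun F p' - sheet_fun F p\<bar> \<le> chord (snd c p') (snd c p)" if p': "p' \<in> fst c" for p'
    proof -
      obtain z w where "z \<in> region" "w \<in> region" "p = pt s z" "p' = pt s w"
        using p p' unfolding s fst_sheet_chart by auto
      then show ?thesis using F[of w z s] val by (simp add: s snd_sheet_chart)
    qed
    then show ?thesis by (intro exI[of _ 1]) auto
  next
    case e
    obtain s z where z: "p = pt s z" "z \<in> region" "z \<in> collar k" using p e by (auto simp: fst_edge_chart)
    let ?x = "snd c p"
    have x: "?x = (if s then z else reflect k z)" using z by (simp add: e snd_edge_chart)
    \<comment> \<open>The radius stops before the edge: by the triangle inequality
      \<open>\<bar>cdist k ?x - rad k\<bar>\<close> is at most the distance of \<open>?x\<close>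
      from the edge circle. At an edge point any positive number will do.\<close>
    define d where "d = (if z \<in> edges then 1 else \<bar>cdist k ?x - rad k\<bar>)"
    have refl_le: "cdist k (reflect k w) \<le> rad k" if "w \<in> region" "w \<in> collar k" for w
      using that reflect_image_collar(2)[of k] collar_region by blast
    have refl_eq: "w \<in> edges" if "w \<in> region" "w \<in> collar k" "cdist k (reflect k w) = rad k" for w
    proof -
      have "reflect k (reflect k w) = reflect k w" using that(3) by (rule reflect_fixed)
      then have "w = reflect k w" using reflect_reflect[OF collarD(1)[OF that(2)]] by simp
      then show ?thesis using that collar_edges by metis
    qed
    have "d > 0"
    proof (cases "z \<in> edges")
      case False
      then have "cdist k ?x \<noteq> rad k" using z collar_edges refl_eq unfolding x by (cases s) auto
      then show ?thesis using False by (simp add: d_def)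
    qed (simp add: d_def)
    moreover have "\<bar>sheet_fun F p' - sheet_fun F p\<bar> \<le> chord (snd c p') ?x"
      if p': "p' \<in> fst c" "dist (snd c p') ?x < d" for p'
    proof -
      obtain t w where w: "p' = pt t w" "w \<in> region" "w \<in> collar k" using p' e by (auto simp: fst_edge_chart)
      let ?y = "snd c p'"
      have y: "?y = (if t then w else reflect k w)" using w by (simp add: e snd_edge_chart)
      have rf: "chord (reflect k w) (reflect k z) = chord w z"
        by (rule chord_isom[OF reflect_isom]) (use z w collarD(1) in auto)
      have same: ?thesis if "s = t"
        using F[OF w(2) z(2), of s] val z w x y that rf by auto
      show ?thesis
      proof (cases "s = t")
        case False
        have "z \<in> edges \<or> w \<in> edges"
        proof (rule ccontr)
          assume *: "\<not> (z \<in> edges \<or> w \<in> edges)"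
          then have lt: "\<bar>cdist k ?y - cdist k ?x\<bar> < \<bar>cdist k ?x - rad k\<bar>"
            using p'(2) norm_triangle_ineq3[of "?y - of_real (centre k)" "?x - of_real (centre k)"]
            by (auto simp: d_def dist_norm)
          show False
          proof (cases s)
            case True
            then have "rad k \<le> cdist k ?x" "cdist k ?y \<le> rad k"
              using x y z w False refl_le collar_region by auto
            then show False using lt by linarith
          next
            case f: False
            then have "rad k \<le> cdist k ?y" "cdist k ?x \<le> rad k"
              using x y z w False refl_le collar_region by auto
            then show False using lt by linarith
          qed
        qed
        then show ?thesis
        proof
          assume ze: "z \<in> edges"
          then have "reflect k z = z" using collar_edges z reflect_fixed by auto
          then have "?x = (if t then z else reflect k z)" using x by auto
          then have "chord ?y ?x = chord w z" using y rf by auto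
          moreover have "sheet_fun F p = F t z" using val[OF z(2), of s] E[OF ze] z(1) by (cases s; cases t) auto
          ultimately show ?thesis using F[OF w(2) z(2), of t] val w by simp
        next
          assume we: "w \<in> edges"
          then have "reflect k w = w" using collar_edges w reflect_fixed by auto
          then have "?y = (if s then w else reflect k w)" using y by auto
          then have "chord ?y ?x = chord w z" using x rf by auto
          moreover have "sheet_fun F p' = F s w" using val[OF w(2), of t] E[OF we] w(1) by (cases s; cases t) auto
          ultimately show ?thesis using F[OF w(2) z(2), of s] val z by simp
        qed
      qed (rule same)
    qed
    ultimately show ?thesis by blast
  qed
qed

section \<open>Lipschitz functions and curves on the double\<close>

text \<open>This is \<open>u \<le> sinh u\<close> at half the difference of the logarithms:
  \<open>2 * sinh u\<close> is the right hand side for \<open>b \<le> a\<close>.\<close>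

lemma ln_diff_le:
  fixes a b :: real
  assumes "0 < a" "0 < b"
  shows "\<bar>ln a - ln b\<bar> \<le> \<bar>a - b\<bar> / sqrt (a * b)"
proof -
  have *: "ln a - ln b \<le> (a - b) / sqrt (a * b)" if "0 < b" "b \<le> a" for a b :: real
  proof -
    have a: "0 < a" using that by linarith
    define u where "u = (ln a - ln b) / 2"
    have "0 \<le> u" using that a by (simp add: u_def)
    from real_le_x_sinh[OF this] have "u \<le> (exp u - inverse (exp u)) / 2" .
    moreover have "exp u = sqrt a / sqrt b"
      using a that by (simp add: u_def exp_diff diff_divide_distrib powr_half_sqrt[symmetric] powr_def)
    moreover have "inverse (sqrt a / sqrt b) = sqrt b / sqrt a" by (rule inverse_divide)
    moreover have "ln a - ln b = 2 * u" by (simp add: u_def)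
    ultimately have "ln a - ln b \<le> sqrt a / sqrt b - sqrt b / sqrt a" by simp
    also have "\<dots> = (a - b) / sqrt (a * b)"
      using a that by (simp add: real_sqrt_mult diff_frac_eq)
    finally show ?thesis .
  qed
  show ?thesis
  proof (cases "b \<le> a")
    case True
    then have "ln b \<le> ln a" using assms by simp
    then show ?thesis using *[OF assms(2) True] True by simp
  next
    case False
    then have "ln a \<le> ln b" using assms by simp
    then show ?thesis using *[of a b] assms False by (simp add: mult.commute)
  qed
qed

lemma ln_Im_chord:
  assumes "0 < Im z" "0 < Im w"
  shows "\<bar>ln (Im z) - ln (Im w)\<bar> \<le> chord z w"
proof -
  have "\<bar>ln (Im z) - ln (Im w)\<bar> \<le> \<bar>Im z - Im w\<bar> / sqrt (Im z * Im w)" by (rule ln_diff_le[OF assms])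
  also have "\<dots> \<le> chord z w"
    unfolding chord_def using abs_Im_le_cmod[of "z - w"] assms by (intro divide_right_mono) auto
  finally show ?thesis .
qed

text \<open>The logarithm of the Euclidean distance to a real point is 1-Lipschitz, because that
  distance is at least the height.\<close>

lemma ln_norm_chord:
  assumes "0 < Im z" "0 < Im w"
  shows "\<bar>ln (norm (z - of_real a)) - ln (norm (w - of_real a))\<bar> \<le> chord z w"
proof -
  have z: "Im z \<le> norm (z - of_real a)" and w: "Im w \<le> norm (w - of_real a)"
    using abs_Im_le_cmod[of "z - of_real a"] abs_Im_le_cmod[of "w - of_real a"] by auto
  have "\<bar>ln (norm (z - of_real a)) - ln (norm (w - of_real a))\<bar>
      \<le> \<bar>norm (z - of_real a) - norm (w - of_real a)\<bar> / sqrt (norm (z - of_real a) * norm (w - of_real a))"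
    by (rule ln_diff_le) (use z w assms in linarith)+
  also have "\<dots> \<le> norm (z - w) / sqrt (Im z * Im w)"
    using norm_triangle_ineq3[of "z - of_real a" "w - of_real a"] z w assms
    by (intro frac_le real_sqrt_le_mono mult_mono) auto
  finally show ?thesis by (simp add: chord_def)
qed

text \<open>Up to sign, the Busemann function of the vertical rays in the second copy.\<close>

definition climb :: "bool \<Rightarrow> complex \<Rightarrow> real" where
  "climb s z = (if s then (SUP k. ln (Im (reflect k z))) else ln (Im z))"

text \<open>The reflection multiplies heights by \<open>(rad k)^2 / (cdist k z)^2\<close>, and the
  region lies outside all circles. So the supremum in \<open>climb\<close> is bounded by the height
  in the other copy.\<close>

lemma Im_reflect_le:
  assumes "z \<in> region"
  shows "Im (reflect k z) \<le> Im z"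
proof -
  have z: "0 < Im z" "rad k \<le> cdist k z" using assms by (auto simp: region_def)
  have "(rad k)\<^sup>2 \<le> (cdist k z)\<^sup>2" using z rad_pos[of k] by (intro power_mono) auto
  then have "(rad k)\<^sup>2 * Im z \<le> (cdist k z)\<^sup>2 * Im z" using z by (intro mult_right_mono) auto
  then show ?thesis
    unfolding Im_inversion using cdist_pos[OF z(1), of k] by (subst pos_divide_le_eq) (auto simp: mult.commute)
qed

lemma Im_reflect_pos: "0 < Im z \<Longrightarrow> 0 < Im (reflect k z)"
  by (rule hyp_isoms_Im[OF reflect_isom])

lemma ln_Im_reflect_le: "z \<in> region \<Longrightarrow> ln (Im (reflect k z)) \<le> ln (Im z)"
  using Im_reflect_le[of z k] Im_reflect_pos[of z k] region_Im[of z] by simp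

lemma bdd_above_reflect: "z \<in> region \<Longrightarrow> bdd_above (range (\<lambda>k. ln (Im (reflect k z))))"
  using ln_Im_reflect_le by (auto simp: bdd_above_def)

lemma climb_ge: "z \<in> region \<Longrightarrow> ln (Im (reflect k z)) \<le> climb True z"
  unfolding climb_def using cSUP_upper[OF UNIV_I bdd_above_reflect] by simp

lemma climb_le: "z \<in> region \<Longrightarrow> climb True z \<le> ln (Im z)"
  unfolding climb_def using ln_Im_reflect_le by (auto intro: cSUP_least)

text \<open>On edge \<open>k\<close> the point is its own mirror image, so the \<open>k\<close>-th
  term already attains the upper bound \<open>ln (Im z)\<close>.\<close>

lemma climb_edge: "z \<in> edges \<Longrightarrow> climb True z = climb False z"
proof -
  assume z: "z \<in> edges"
  then obtain k where "cdist k z = rad k" "z \<in> region" by (auto simp: edges_def)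
  then have "ln (Im z) \<le> climb True z" using climb_ge[of z k] by (simp add: reflect_fixed)
  then show "climb True z = climb False z" using climb_le[OF \<open>z \<in> region\<close>] by (simp add: climb_def)
qed

text \<open>Each term is a height composed with an isometry, and a supremum of 1-Lipschitz functions
  is 1-Lipschitz.\<close>

lemma lipschitz_climb: "S.lipschitz_fun (sheet_fun climb)"
proof (rule lipschitz_sheet_fun)
  fix s z w assume zw: "z \<in> region" "w \<in> region"
  have *: "climb True z \<le> climb True w + chord z w" if "z \<in> region" "w \<in> region" for z w
  proof -
    have "ln (Im (reflect k z)) \<le> climb True w + chord z w" for k
    proof -
      have "\<bar>ln (Im (reflect k z)) - ln (Im (reflect k w))\<bar> \<le> chord (reflect k z) (reflect k w)"
        using that by (intro ln_Im_chord hyp_isoms_Im[OF reflect_isom] region_Im)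
      also have "\<dots> = chord z w" using that by (intro chord_isom[OF reflect_isom] region_Im)
      finally show ?thesis using climb_ge[OF that(2), of k] by linarith
    qed
    then show ?thesis by (simp add: climb_def cSUP_least)
  qed
  have "chord w z = chord z w" by (simp add: chord_def norm_minus_commute mult.commute)
  then show "\<bar>climb s z - climb s w\<bar> \<le> chord z w"
    using *[OF zw] *[OF zw(2,1)] ln_Im_chord[of z w] zw region_Im by (cases s) (auto simp: climb_def)
qed (rule climb_edge)

text \<open>Needed to tell the two copies of an inner point apart. Each term is strictly smaller
  than \<open>ln (Im z)\<close>, but strictness of the supremum needs a uniform gap: the factors
  \<open>q k\<close> tend to \<open>1/2\<close>, so only finitely many can exceed
  \<open>3/4\<close>.\<close>

lemma climb_interior:
  assumes "z \<in> region - edges"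
  shows "climb True z < ln (Im z)"
proof -
  define q where "q k = (rad k)\<^sup>2 / (cdist k z)\<^sup>2" for k
  have Im: "0 < Im z" using assms region_Im by auto
  have q1: "q k < 1" for k
  proof -
    have "rad k \<le> cdist k z" "cdist k z \<noteq> rad k" using assms by (auto simp: region_def edges_def)
    then have "rad k < cdist k z" by linarith
    then have "(rad k)\<^sup>2 < (cdist k z)\<^sup>2" using rad_pos[of k] by (intro power_strict_mono) auto
    then show ?thesis using cdist_pos[OF Im, of k] by (simp add: q_def)
  qed
  \<comment> \<open>For \<open>centre k \<ge> 6 * Re z + 2\<close> the inequality
    \<open>4 * (rad k)^2 \<le> 3 * (cdist k z)^2\<close> holds, that is,
    \<open>q k \<le> 3/4\<close>.\<close>
  define K where "K = nat \<lceil>6 * \<bar>Re z\<bar> + 2\<rceil>"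
  have far: "q k \<le> 3/4" if "K < k" for k
  proof -
    let ?c = "centre k"
    have "6 * \<bar>Re z\<bar> + 2 \<le> real k" using that unfolding K_def by linarith
    then have c: "6 * \<bar>Re z\<bar> + 2 \<le> ?c" using centre_ge_index[of k] by linarith
    have "6 * Re z + 2 \<le> ?c" using c by linarith
    then have "?c * (6 * Re z + 2) \<le> ?c * ?c" using centre_ge_10[of k] by (intro mult_left_mono) auto
    then have "6 * (?c * Re z) + 2 * ?c \<le> ?c\<^sup>2" by (simp add: algebra_simps power2_eq_square)
    moreover have "4 * (rad k)\<^sup>2 = 2 * ?c\<^sup>2 + 2" by (simp add: rad_sq)
    moreover have "3 * (?c\<^sup>2 - 2 * ?c * Re z) = 3 * ?c\<^sup>2 - 6 * (?c * Re z)" by (simp add: algebra_simps)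
    ultimately have "4 * (rad k)\<^sup>2 \<le> 3 * (?c\<^sup>2 - 2 * ?c * Re z)"
      using centre_ge_10[of k] by linarith
    also have "\<dots> \<le> 3 * (cdist k z)\<^sup>2" unfolding cdist_sq by simp
    finally show ?thesis using cdist_pos[OF Im, of k] by (simp add: q_def divide_le_eq)
  qed
  define Q where "Q = Max (insert (3/4) (q ` {..K}))"
  have "Q < 1" unfolding Q_def using q1 by (subst Max_less_iff) auto
  have qQ: "q k \<le> Q" for k
  proof (cases "k \<le> K")
    case True
    then show ?thesis unfolding Q_def by (intro Max_ge) auto
  next
    case False
    have "3/4 \<le> Q" unfolding Q_def by (intro Max_ge) auto
    then show ?thesis using far[of k] False by linarith
  qed
  have Q: "0 < Q" using qQ[of 0] rad_pos[of 0] cdist_pos[OF Im, of 0]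
    by (auto simp: q_def intro: less_le_trans[rotated])
  have "ln (Im (reflect k z)) \<le> ln (Q * Im z)" for k
  proof -
    have "Im (reflect k z) = q k * Im z" by (simp add: Im_inversion q_def)
    then have "Im (reflect k z) \<le> Q * Im z" using qQ[of k] Im by (simp add: mult_right_mono)
    then show ?thesis using Im_reflect_pos[OF Im, of k] Q Im by simp
  qed
  then have "climb True z \<le> ln (Q * Im z)" by (simp add: climb_def cSUP_least)
  also have "\<dots> < ln (1 * Im z)" using Im Q \<open>Q < 1\<close> by (subst ln_less_cancel_iff) auto
  finally show ?thesis by simp
qed

lemma lipschitz_height: "S.lipschitz_fun (sheet_fun (\<lambda>s z. ln (Im z)))"
  by (rule lipschitz_sheet_fun) (auto intro!: ln_Im_chord region_Im)

lemma lipschitz_modulus: "S.lipschitz_fun (sheet_fun (\<lambda>s z. ln (norm (z - of_real a))))"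
  by (rule lipschitz_sheet_fun) (auto intro!: ln_norm_chord region_Im)

text \<open>Two copies of one point are separated by \<open>climb\<close>; different base points by
  the height or the distance to a real point, whose values determine a point of the half
  plane.\<close>

lemma lipschitz_separates:
  assumes "p \<in> topspace S.M" "q \<in> topspace S.M" "p \<noteq> q"
  shows "\<exists>f. S.lipschitz_fun f \<and> f p \<noteq> f q"
proof -
  obtain s z t w where p: "p = pt s z" "z \<in> region" and q: "q = pt t w" "w \<in> region"
    using assms(1,2) unfolding topspace_surface by blast
  have Im: "0 < Im z" "0 < Im w" using p q region_Im by auto
  show ?thesis
  proof (cases "z = w")
    case True
    then have st: "z \<notin> edges" "s \<noteq> t" using assms(3) p q by (auto simp: pt_def)
    then have "sheet_fun climb p \<noteq> sheet_fun climb q"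
      using climb_interior[of z] p q True climb_edge
      by (cases s) (auto simp: sheet_fun_pt, auto simp: climb_def)
    then show ?thesis using lipschitz_climb by blast
  next
    case False
    show ?thesis
    proof (rule ccontr)
      assume no: "\<not> ?thesis"
      then have "sheet_fun (\<lambda>s z. ln (Im z)) p = sheet_fun (\<lambda>s z. ln (Im z)) q"
        using lipschitz_height by blast
      then have "Im z = Im w" using p q Im by (simp add: sheet_fun_pt)
      have n: "norm (z - of_real a) = norm (w - of_real a)" for a
      proof -
        have "sheet_fun (\<lambda>s z. ln (norm (z - of_real a))) p = sheet_fun (\<lambda>s z. ln (norm (z - of_real a))) q"
          using lipschitz_modulus no by blast
        moreover have "z - of_real a \<noteq> 0" "w - of_real a \<noteq> 0" using Im by auto
        ultimately show ?thesis using p q by (simp add: sheet_fun_pt)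
      qed
      have "(norm (z - of_real a))\<^sup>2 = (norm (w - of_real a))\<^sup>2" for a using n[of a] by simp
      \<comment> \<open>The difference of the squared distances to 0 and 1 is affine in the real
        part.\<close>
      from this[of 0] this[of 1] have "Re z = Re w"
        using \<open>Im z = Im w\<close> unfolding cmod_power2 by (simp add: power2_eq_square algebra_simps)
      then show False using False \<open>Im z = Im w\<close> complex_eqI by blast
    qed
  qed
qed

section \<open>Curves within one copy\<close>

lemma hyp_isoms_has_derivative:
  assumes "f \<in> hyp_isoms" "0 < Im z"
  shows "(f has_derivative frechet_derivative f (at z)) (at z)"
  using hyp_isoms_derivative[OF assms] frechet_derivative_at by metis

lemma hyp_isoms_derivative_norm:
  assumes "f \<in> hyp_isoms" "0 < Im z"
  shows "norm (frechet_derivative f (at z) u) / Im (f z) = norm u / Im z"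
proof -
  obtain h where h: "(f has_derivative h) (at z)" "\<And>u v. h u \<bullet> h v / (Im (f z))\<^sup>2 = u \<bullet> v / (Im z)\<^sup>2"
    using hyp_isoms_derivative[OF assms] by metis
  have "frechet_derivative f (at z) = h" using frechet_derivative_at[OF h(1)] by simp
  then have "(norm (frechet_derivative f (at z) u) / Im (f z))\<^sup>2 = (norm u / Im z)\<^sup>2"
    using h(2)[of u u] by (simp add: power_divide power2_norm_eq_inner)
  then show ?thesis
    using assms(2) hyp_isoms_Im[OF assms] by (simp add: power2_eq_iff_nonneg)
qed

lemma hyp_isoms_derivative_continuous:
  fixes J :: "real set"
  assumes "f \<in> hyp_isoms" "continuous_on J x" "continuous_on J v" "\<And>t. t \<in> J \<Longrightarrow> 0 < Im (x t)"
  shows "continuous_on J (\<lambda>t. frechet_derivative f (at (x t)) (v t))"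
proof (cases "f = id")
  case True
  then show ?thesis using assms(3) by (simp add: id_def)
next
  case False
  then obtain a r where f: "f = inversion a r" using assms(1) by (auto simp: hyp_isoms_def)
  have "frechet_derivative f (at (x t)) (v t) = - of_real (r\<^sup>2) * cnj (v t) / (cnj (x t - of_real a))\<^sup>2"
    and nz: "cnj (x t - of_real a) \<noteq> 0" if "t \<in> J" for t
  proof -
    have "x t \<noteq> of_real a" using assms(4)[OF that] by auto
    from frechet_derivative_at[OF inversion_has_derivative[OF this, of r]]
    show "frechet_derivative f (at (x t)) (v t) = - of_real (r\<^sup>2) * cnj (v t) / (cnj (x t - of_real a))\<^sup>2"
      unfolding f by metis
    have "Im (cnj (x t - of_real a)) \<noteq> 0" using assms(4)[OF that] by simp
    then show "cnj (x t - of_real a) \<noteq> 0" by (metis zero_complex.sel(2))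
  qed
  moreover have "continuous_on J (\<lambda>t. - of_real (r\<^sup>2) * cnj (v t) / (cnj (x t - of_real a))\<^sup>2)"
    using assms(2,3) nz by (intro continuous_intros) auto
  ultimately show ?thesis by (simp cong: continuous_on_cong)
qed

text \<open>Restricted to one copy, every chart is a single isometry of the half plane; curves
  staying in one copy can therefore be treated in base coordinates.\<close>

lemma chart_isom:
  assumes "c \<in> atlas"
  obtains f where "f \<in> hyp_isoms" "\<And>z. z \<in> region \<Longrightarrow> pt s z \<in> fst c \<Longrightarrow> snd c (pt s z) = f z"
proof -
  from assms consider (s) t where "c = sheet_chart t" | (e) k where "c = edge_chart k"
    unfolding atlas_def by blast
  then show thesis
  proof cases
    case s
    show ?thesis by (rule that[OF id_isom]) (simp add: s snd_sheet_chart)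
  next
    case e
    show ?thesis
    proof (rule that[of "if s then id else reflect k"])
      show "(if s then id else reflect k) \<in> hyp_isoms" using id_isom reflect_isom by auto
      fix z assume z: "z \<in> region" "pt s z \<in> fst c"
      then obtain t w where "pt s z = pt t w" "w \<in> region" "w \<in> collar k" by (auto simp: e fst_edge_chart)
      then have "z \<in> collar k" using pt_eq_iff[of z w s t] z region_Im by auto
      then show "snd c (pt s z) = (if s then id else reflect k) z" using z by (simp add: e snd_edge_chart)
    qed
  qed
qed

lemma chart_neighbourhood:
  assumes "z \<in> region"
  obtains c B where "c \<in> atlas" "open B" "z \<in> B" "\<And>w. w \<in> region \<inter> B \<Longrightarrow> pt s w \<in> fst c"
proof (cases "z \<in> edges")
  case True
  then obtain k where k: "z \<in> collar k" by (rule edges_collar)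
  show ?thesis
    by (rule that[OF _ open_collar k, of "edge_chart k"]) (auto simp: atlas_def fst_edge_chart)
next
  case False
  then have "z \<in> region - edges" using assms by simp
  then show ?thesis
    by (rule that[OF _ open_interior, of "sheet_chart s", rotated]) (auto simp: atlas_def fst_sheet_chart)
qed

lemma continuous_map_pt: "continuous_map (top_of_set region) S.M (pt s)"
  unfolding continuous_map_eq_topcontinuous_at topcontinuous_at_def
proof (intro ballI allI impI conjI)
  fix z V assume "z \<in> topspace (top_of_set region)" and V: "openin S.M V \<and> pt s z \<in> V"
  then have z: "z \<in> region" by simp
  obtain c B where c: "c \<in> atlas" "open B" "z \<in> B" "\<And>w. w \<in> region \<inter> B \<Longrightarrow> pt s w \<in> fst c"
    using chart_neighbourhood[OF z] by metis
  obtain f where f: "f \<in> hyp_isoms" "\<And>z. z \<in> region \<Longrightarrow> pt s z \<in> fst c \<Longrightarrow> snd c (pt s z) = f z"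
    using chart_isom[OF c(1)] by metis
  let ?W = "snd c ` (V \<inter> fst c)"
  have W: "open ?W" using V c(1) unfolding S.openin_atlas by simp
  have "continuous_on (upper_half_plane \<inter> B) f"
    by (rule continuous_on_subset[OF hyp_isoms_continuous[OF f(1)]]) auto
  from continuous_open_preimage[OF this open_Int[OF open_upper_half_plane c(2)] W]
  have oW: "openin (top_of_set region) (region \<inter> ((upper_half_plane \<inter> B) \<inter> f -` ?W))"
    by (rule openin_open_Int)
  have pz: "pt s z \<in> fst c" using c(3,4) z by simp
  then have "f z \<in> ?W" using f(2)[OF z] V by (metis IntI image_eqI)
  then have zW: "z \<in> region \<inter> ((upper_half_plane \<inter> B) \<inter> f -` ?W)"
    using z c(3) region_Im by simp
  have "pt s w \<in> V" if w: "w \<in> region \<inter> ((upper_half_plane \<inter> B) \<inter> f -` ?W)" for w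
  proof -
    have pw: "pt s w \<in> fst c" using c(4) w by auto
    then obtain p where "p \<in> V" "p \<in> fst c" "snd c (pt s w) = snd c p" using f(2)[of w] w by auto
    then show ?thesis using inj_onD[OF S.chart_inj[OF c(1)]] pw by metis
  qed
  then show "\<exists>U. openin (top_of_set region) U \<and> z \<in> U \<and> (\<forall>y\<in>U. pt s y \<in> V)"
    using oW zW by (intro exI[of _ "region \<inter> ((upper_half_plane \<inter> B) \<inter> f -` ?W)"]) simp
qed (auto intro: pt_in_surface)

text \<open>The source of the explicit upper bounds for distances. Derivatives are taken in the
  plane, so the curve may touch the edges as long as it stays in one copy.\<close>

lemma sheet_path:
  assumes ab: "a < b" and z: "\<And>t. t \<in> {a..b} \<Longrightarrow> z t \<in> region"
    and d: "\<And>t. t \<in> {a..b} \<Longrightarrow> (z has_vector_derivative z' t) (at t)"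
    and z': "continuous_on {a..b} z'" and K: "\<And>t. t \<in> {a..b} \<Longrightarrow> norm (z' t) \<le> K * Im (z t)"
  shows "S.edist (pt s (z a)) (pt s (z b)) \<le> ennreal (K * (b - a))"
proof -
  let ?\<gamma> = "\<lambda>t. pt s (z t)"
  have cz: "continuous_on {a..b} z"
    using d has_vector_derivative_continuous continuous_at_imp_continuous_on by blast
  then have "continuous_map (top_of_set {a..b}) (top_of_set region) z" using z by auto
  from continuous_map_compose[OF this continuous_map_pt]
  have \<gamma>: "continuous_map (top_of_set {a..b}) S.M ?\<gamma>" by (simp add: o_def)
  have "C1_curve_on atlas ?\<gamma> a b"
    unfolding C1_curve_on_def Let_def
  proof
    fix c assume c: "c \<in> atlas"
    obtain f where f: "f \<in> hyp_isoms" "\<And>z. z \<in> region \<Longrightarrow> pt s z \<in> fst c \<Longrightarrow> snd c (pt s z) = f z"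
      using chart_isom[OF c] by metis
    let ?f' = "\<lambda>z. frechet_derivative f (at z)"
    note f' = hyp_isoms_has_derivative[OF f(1)] hyp_isoms_derivative_norm[OF f(1)]
      hyp_isoms_derivative_continuous[OF f(1)]
    let ?J = "{t \<in> {a..b}. ?\<gamma> t \<in> fst c}"
    have J: "?J \<subseteq> {a..b}" by auto
    have "continuous_on ?J (\<lambda>t. ?f' (z t) (z' t))"
      using continuous_on_subset[OF cz J] continuous_on_subset[OF z' J] z region_Im
      by (intro f'(3)) auto
    moreover have "((snd c \<circ> ?\<gamma>) has_vector_derivative ?f' (z t) (z' t)) (at t within ?J)" if t: "t \<in> ?J" for t
    proof (rule has_vector_derivative_transform[OF t])
      have t': "t \<in> {a..b}" using t by simp
      show "((f \<circ> z) has_vector_derivative ?f' (z t) (z' t)) (at t within ?J)"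
        by (rule vector_derivative_diff_chain_within[OF has_vector_derivative_at_within[OF d[OF t']]
            has_derivative_at_withinI[OF f'(1)[OF region_Im[OF z[OF t']]]]])
      show "(snd c \<circ> ?\<gamma>) s = (f \<circ> z) s" if "s \<in> ?J" for s
        using that z f(2) by auto
    qed
    ultimately show "\<exists>D. continuous_on ?J D \<and> (\<forall>t\<in>?J. ((snd c \<circ> ?\<gamma>) has_vector_derivative D t) (at t within ?J))"
      by blast
  qed
  then have P: "pcurve S.M atlas ?\<gamma> a b" by (rule pcurve_single[OF ab \<gamma>])
  have \<gamma>': "continuous_map (top_of_set {a<..<b}) S.M ?\<gamma>"
    by (rule continuous_map_from_subtopology_mono[OF \<gamma>]) auto
  have speed: "speed atlas hyp_metric ?\<gamma> t \<le> K" if t: "t \<in> {a<..<b}" for t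
  proof -
    have t': "t \<in> {a..b}" using t by auto
    have Im: "0 < Im (z t)" using z[OF t'] region_Im by blast
    obtain c where c: "c \<in> atlas" "?\<gamma> t \<in> fst c"
      using chart_neighbourhood[OF z[OF t'], of s] z[OF t'] by (metis IntI)
    obtain f where f: "f \<in> hyp_isoms" "\<And>z. z \<in> region \<Longrightarrow> pt s z \<in> fst c \<Longrightarrow> snd c (pt s z) = f z"
      using chart_isom[OF c(1)] by metis
    let ?f' = "\<lambda>z. frechet_derivative f (at z)"
    note f' = hyp_isoms_has_derivative[OF f(1)] hyp_isoms_derivative_norm[OF f(1)]
      hyp_isoms_derivative_continuous[OF f(1)]
    have fz: "((f \<circ> z) has_vector_derivative ?f' (z t) (z' t)) (at t)"
      using vector_derivative_diff_chain_within[OF d[OF t'] has_derivative_at_withinI[OF f'(1)[OF Im]]] .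
    have "openin (top_of_set {a<..<b}) {r \<in> {a<..<b}. ?\<gamma> r \<in> fst c}"
      using openin_continuous_map_preimage[OF \<gamma>' S.openin_chart[OF c(1)]]
      by (simp only: topspace_euclidean_subtopology)
    then have "open {r \<in> {a<..<b}. ?\<gamma> r \<in> fst c}"
      by (rule openin_open_trans[OF _ open_greaterThanLessThan])
    then have "((snd c \<circ> ?\<gamma>) has_vector_derivative ?f' (z t) (z' t)) (at t)"
      by (rule has_vector_derivative_transform_within_open[OF fz]) (use t c f(2) z in auto)
    from S.speed_eq[OF _ t \<gamma>' c this] have "speed atlas hyp_metric ?\<gamma> t = norm (?f' (z t) (z' t)) / Im (snd c (?\<gamma> t))"
      by simp
    also have "\<dots> = norm (z' t) / Im (z t)" using f'(2)[OF Im] f(2)[OF z[OF t'] c(2)] by simp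
    also have "\<dots> \<le> K" using K[OF t'] Im by (simp add: divide_le_eq)
    finally show ?thesis .
  qed
  have "S.len ?\<gamma> a b \<le> (\<integral>\<^sup>+t. ennreal K * indicator {a..b} t \<partial>lborel)"
    unfolding plength_def
  proof (rule nn_integral_mono_AE)
    have "ennreal (speed atlas hyp_metric ?\<gamma> t) * indicator {a..b} t \<le> ennreal K * indicator {a..b} t"
      if "t \<notin> {a, b}" for t
      using speed[of t] that by (auto simp: indicator_def ennreal_leI)
    note * = this
    show "AE t in lborel. ennreal (speed atlas hyp_metric ?\<gamma> t) * indicator {a..b} t \<le> ennreal K * indicator {a..b} t"
      by (rule eventually_mono[OF S.AE_not_finite[of "{a, b}"] *]) simp_all
  qed
  also have "\<dots> = ennreal K * ennreal (b - a)"
    using ab by (simp add: nn_integral_cmult_indicator)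
  also have "\<dots> = ennreal (K * (b - a))" using ab by (simp add: ennreal_mult'')
  finally show ?thesis using S.edist_le[OF P] by (rule order_trans[rotated])
qed

lemma edist_segment:
  assumes seg: "closed_segment z w \<subseteq> region" and m: "0 < m" "m \<le> Im z" "m \<le> Im w"
  shows "S.edist (pt s z) (pt s w) \<le> ennreal (norm (z - w) / m)"
proof -
  let ?z = "\<lambda>t. z + of_real t * (w - z)"
  have "S.edist (pt s (?z 0)) (pt s (?z 1)) \<le> ennreal (norm (z - w) / m * (1 - 0))"
  proof (rule sheet_path[where z' = "\<lambda>_. w - z"])
    fix t :: real assume t: "t \<in> {0..1}"
    have "?z t = (1 - t) *\<^sub>R z + t *\<^sub>R w" by (simp add: scaleR_conv_of_real algebra_simps)
    then have "?z t \<in> closed_segment z w" unfolding in_segment using t by auto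
    then show "?z t \<in> region" using seg by blast
    show "(?z has_vector_derivative w - z) (at t)"
      by (auto intro!: derivative_eq_intros)
    have "m = (1 - t) * m + t * m" by (simp add: algebra_simps)
    also have "\<dots> \<le> (1 - t) * Im z + t * Im w" using t m by (intro add_mono mult_left_mono) auto
    also have "\<dots> = Im (?z t)" by (simp add: algebra_simps)
    finally have "norm (z - w) / m * m \<le> norm (z - w) / m * Im (?z t)"
      using m by (intro mult_left_mono) auto
    then show "norm (w - z) \<le> norm (z - w) / m * Im (?z t)" using m by (simp add: norm_minus_commute)
  qed auto
  then show ?thesis by simp
qed

text \<open>The centres are real, so moving up increases the distance to each of them.\<close>

lemma region_upward:
  assumes "z \<in> region" "0 \<le> h"
  shows "z + of_real h * \<i> \<in> region"
  unfolding region_def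
proof (intro CollectI conjI allI)
  show "0 < Im (z + of_real h * \<i>)" using region_Im[OF assms(1)] assms(2) by simp
  fix k
  have "rad k \<le> cdist k z" using assms(1) by (simp add: region_def)
  also have "(cdist k z)\<^sup>2 \<le> (cdist k (z + of_real h * \<i>))\<^sup>2"
    unfolding cmod_power2 using region_Im[OF assms(1)] assms(2) by (simp add: power_mono)
  then have "cdist k z \<le> cdist k (z + of_real h * \<i>)" by (rule power2_le_imp_le) simp
  finally show "rad k \<le> cdist k (z + of_real h * \<i>)" .
qed

lemma edist_vertical:
  assumes "z \<in> region" "Re w = Re z" "Im z < Im w"
  shows "S.edist (pt s z) (pt s w) \<le> ennreal (ln (Im w / Im z))"
proof -
  have Im: "0 < Im z" "0 < Im w" using region_Im[OF assms(1)] assms(3) by auto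
  \<comment> \<open>The exponential parametrizes vertical geodesics by arc length.\<close>
  let ?z = "\<lambda>t. of_real (Re z) + of_real (exp t) * \<i>"
  have "S.edist (pt s (?z (ln (Im z)))) (pt s (?z (ln (Im w)))) \<le> ennreal (1 * (ln (Im w) - ln (Im z)))"
  proof (rule sheet_path[where z' = "\<lambda>t. of_real (exp t) * \<i>"])
    show "ln (Im z) < ln (Im w)" using Im assms(3) by simp
    fix t :: real assume t: "t \<in> {ln (Im z)..ln (Im w)}"
    then have "Im z \<le> exp t" using Im(1) by (metis atLeastAtMost_iff exp_le_cancel_iff exp_ln)
    then have "z + of_real (exp t - Im z) * \<i> \<in> region" using assms(1) by (intro region_upward) auto
    moreover have "z + of_real (exp t - Im z) * \<i> = ?z t" by (simp add: complex_eq_iff)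
    ultimately show "?z t \<in> region" by simp
    show "(?z has_vector_derivative of_real (exp t) * \<i>) (at t)"
      by (auto intro!: derivative_eq_intros has_vector_derivative_of_real)
    show "norm (of_real (exp t) * \<i>) \<le> 1 * Im (?z t)" by (simp add: norm_mult)
  qed (auto intro!: continuous_intros)
  moreover have "?z (ln (Im z)) = z" "?z (ln (Im w)) = w" using Im assms(2) by (auto simp: complex_eq_iff)
  ultimately show ?thesis using Im by (simp add: ln_div)
qed

section \<open>Completeness\<close>

lemma rad_le_centre: "rad k \<le> centre k"
proof (rule power2_le_imp_le)
  have "1 \<le> (centre k)\<^sup>2" using power_mono[of 1 "centre k" 2] centre_ge_10[of k] by simp
  then show "(rad k)\<^sup>2 \<le> (centre k)\<^sup>2" by (simp add: rad_sq)
qed (use centre_ge_10[of k] in simp)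

text \<open>No half-disc reaches a steep cone about the imaginary axis: an edge with small centre is
  lower than \<open>z\<close>, and one with large centre is at horizontal distance at least
  \<open>3/4\<close> of its centre, which exceeds its radius.\<close>

lemma region_high:
  assumes "4 * \<bar>Re z\<bar> + 4 \<le> Im z"
  shows "z \<in> region"
  unfolding region_def
proof (intro CollectI conjI allI)
  show "0 < Im z" using assms by linarith
  fix k
  show "rad k \<le> cdist k z"
  proof (cases "centre k \<le> 4 * \<bar>Re z\<bar> + 4")
    case True
    then have "rad k \<le> Im (z - of_real (centre k))" using rad_le_centre[of k] assms by simp
    also have "\<dots> \<le> cdist k z" using abs_Im_le_cmod[of "z - of_real (centre k)"] by simp
    finally show ?thesis .
  next
    case False
    then have d: "3/4 * centre k \<le> \<bar>Re (z - of_real (centre k))\<bar>" by simp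
    have c: "100 \<le> (centre k)\<^sup>2" using power_mono[of 10 "centre k" 2] centre_ge_10[of k] by simp
    have sq: "(3/4 * centre k)\<^sup>2 = 9/16 * (centre k)\<^sup>2" by (simp add: power2_eq_square)
    have "(rad k)\<^sup>2 \<le> (3/4 * centre k)\<^sup>2" unfolding rad_sq sq using c by simp
    then have "rad k \<le> 3/4 * centre k" by (rule power2_le_imp_le) (use centre_ge_10[of k] in simp)
    also have "\<dots> \<le> cdist k z" using d abs_Re_le_cmod order_trans by blast
    finally show ?thesis .
  qed
qed

text \<open>Room for the limit ray and for the initial parts of the other rays, which stay close to
  it.\<close>

lemma region_left:
  assumes "0 < Im z" "Re z \<le> 1"
  shows "z \<in> region"
  unfolding region_def
proof (intro CollectI conjI allI)
  show "0 < Im z" by fact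
  fix k
  have c: "10 \<le> centre k" by (rule centre_ge_10)
  then have "10 * centre k \<le> (centre k)\<^sup>2" unfolding power2_eq_square by (intro mult_right_mono) auto
  moreover have sq: "(centre k - 1)\<^sup>2 = (centre k)\<^sup>2 - 2 * centre k + 1" by (simp add: power2_eq_square algebra_simps)
  ultimately have "(rad k)\<^sup>2 \<le> (centre k - 1)\<^sup>2" unfolding rad_sq sq using c by simp
  then have "rad k \<le> centre k - 1" by (rule power2_le_imp_le) (use c in simp)
  also have "\<dots> \<le> \<bar>Re (z - of_real (centre k))\<bar>" using assms(2) by simp
  also have "\<dots> \<le> cdist k z" by (rule abs_Re_le_cmod)
  finally show "rad k \<le> cdist k z" .
qed

lemma edist_horizontal:
  assumes "0 < y" "\<And>x. x \<in> closed_segment a b \<Longrightarrow> Complex x y \<in> region"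
  shows "S.edist (pt s (Complex a y)) (pt s (Complex b y)) \<le> ennreal (\<bar>a - b\<bar> / y)"
proof -
  have "closed_segment (Complex a y) (Complex b y) \<subseteq> region"
  proof
    fix w assume "w \<in> closed_segment (Complex a y) (Complex b y)"
    then obtain u where u: "0 \<le> u" "u \<le> 1" "w = (1 - u) *\<^sub>R Complex a y + u *\<^sub>R Complex b y"
      unfolding in_segment by blast
    then have "w = Complex ((1 - u) *\<^sub>R a + u *\<^sub>R b) y" by (simp add: complex_eq_iff algebra_simps)
    moreover have "(1 - u) *\<^sub>R a + u *\<^sub>R b \<in> closed_segment a b" using u unfolding in_segment by blast
    ultimately show "w \<in> region" using assms(2) by simp
  qed
  from edist_segment[OF this assms(1)]
  show ?thesis by (simp add: cmod_def)
qed

text \<open>Half-discs may lie between the points, so the path climbs above all obstacles, crosses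
  horizontally and descends.\<close>

lemma edist_finite_sheet:
  assumes "z \<in> region" "w \<in> region"
  shows "S.edist (pt s z) (pt s w) < top"
proof -
  define y where "y = 4 * (\<bar>Re z\<bar> + \<bar>Re w\<bar>) + 4 + Im z + Im w"
  have Im: "0 < Im z" "0 < Im w" using assms region_Im by auto
  have y: "Im z < y" "Im w < y" "0 < y" using Im by (auto simp: y_def)
  have "S.edist (pt s z) (pt s (Complex (Re z) y)) \<le> ennreal (ln (y / Im z))"
    using edist_vertical[OF assms(1), of "Complex (Re z) y"] y by simp
  moreover have "S.edist (pt s (Complex (Re z) y)) (pt s (Complex (Re w) y)) \<le> ennreal (\<bar>Re z - Re w\<bar> / y)"
  proof (rule edist_horizontal[OF y(3)])
    fix x assume "x \<in> closed_segment (Re z) (Re w)"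
    then have "\<bar>x\<bar> \<le> \<bar>Re z\<bar> + \<bar>Re w\<bar>" by (auto simp: closed_segment_eq_real_ivl split: if_splits)
    then show "Complex x y \<in> region" by (intro region_high) (use Im in \<open>simp add: y_def\<close>)
  qed
  moreover have "S.edist (pt s (Complex (Re w) y)) (pt s w) \<le> ennreal (ln (y / Im w))"
    using edist_vertical[OF assms(2), of "Complex (Re w) y"] y by (simp add: S.edist_commute)
  moreover have "S.edist (pt s z) (pt s w) \<le> S.edist (pt s z) (pt s (Complex (Re z) y))
      + S.edist (pt s (Complex (Re z) y)) (pt s (Complex (Re w) y)) + S.edist (pt s (Complex (Re w) y)) (pt s w)"
    by (metis S.edist_triangle add_right_mono order_trans)
  ultimately have "S.edist (pt s z) (pt s w) \<le> ennreal (ln (y / Im z)) + ennreal (\<bar>Re z - Re w\<bar> / y) + ennreal (ln (y / Im w))"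
    by (meson add_mono order_trans)
  also have "\<dots> < top" by (simp add: ennreal_add_eq_top less_top[symmetric])
  finally show ?thesis .
qed

lemma edist_finite:
  assumes "p \<in> topspace S.M" "q \<in> topspace S.M"
  shows "S.edist p q < top"
proof -
  obtain s z t w where p: "p = pt s z" "z \<in> region" and q: "q = pt t w" "w \<in> region"
    using assms unfolding topspace_surface by blast
  \<comment> \<open>The top of the first half-circle, a point common to both copies.\<close>
  define e where "e = Complex (centre 0) (rad 0)"
  have e0: "cdist 0 e = rad 0" using rad_pos[of 0] by (simp add: e_def cmod_def)
  then have "e \<in> collar 0" using rad_pos[of 0] by (simp add: collar_def e_def)
  then have e: "e \<in> edges" "e \<in> region" using e0 collar_edges collar_region by auto
  then have same: "pt s e = pt t e" by (simp add: pt_def)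
  have "S.edist p q \<le> S.edist (pt s z) (pt s e) + S.edist (pt t e) (pt t w)"
    unfolding p q same[symmetric] by (rule S.edist_triangle)
  also have "\<dots> < top"
    using edist_finite_sheet[OF p(2) e(2)] edist_finite_sheet[OF e(2) q(2)] by (simp add: less_top)
  finally show ?thesis .
qed

lemma ennreal_rdist:
  assumes "p \<in> topspace S.M" "q \<in> topspace S.M"
  shows "ennreal (S.rdist p q) = S.edist p q"
  using edist_finite[OF assms] by (simp add: S.rdist_edist)

lemma rdist_triangle:
  assumes "p \<in> topspace S.M" "q \<in> topspace S.M" "r \<in> topspace S.M"
  shows "S.rdist p r \<le> S.rdist p q + S.rdist q r"
proof -
  have "ennreal (S.rdist p r) \<le> ennreal (S.rdist p q) + ennreal (S.rdist q r)"
    using S.edist_triangle[of p r q] assms by (simp add: ennreal_rdist)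
  then show ?thesis by (simp add: S.rdist_nonneg flip: ennreal_plus)
qed

lemma rdist_le:
  assumes "S.edist p q \<le> ennreal r" "0 \<le> r"
  shows "S.rdist p q \<le> r"
  unfolding S.rdist_edist using assms by (simp add: enn2real_leI)

lemma rdist_ge:
  assumes "S.lipschitz_fun f" "p \<in> topspace S.M" "q \<in> topspace S.M"
  shows "\<bar>f p - f q\<bar> \<le> S.rdist p q"
proof -
  have "ennreal \<bar>f p - f q\<bar> \<le> ennreal (S.rdist p q)"
    using S.lipschitz_edist[OF assms(1), of p q] ennreal_rdist assms by simp
  then show ?thesis by (simp add: S.rdist_nonneg)
qed

section \<open>The metric space and its Cauchy sequences\<close>

lemma Metric_space_surface: "Metric_space (topspace S.M) S.rdist"
proof
  fix p q
  show "0 \<le> S.rdist p q" by (rule S.rdist_nonneg)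
  show "S.rdist p q = S.rdist q p" by (rule S.rdist_commute)
  assume pq: "p \<in> topspace S.M" "q \<in> topspace S.M"
  show "S.rdist p q = 0 \<longleftrightarrow> p = q"
  proof
    assume "S.rdist p q = 0"
    then have "f p = f q" if "S.lipschitz_fun f" for f using rdist_ge[OF that pq] by simp
    then show "p = q" using lipschitz_separates[OF pq] by blast
  qed (use S.edist_self pq in \<open>simp add: S.rdist_edist\<close>)
qed (rule rdist_triangle)

lemma edges_upward:
  assumes "z \<in> region" "0 < h"
  shows "z + of_real h * \<i> \<in> region - edges"
proof -
  have "cdist k (z + of_real h * \<i>) \<noteq> rad k" for k
  proof -
    have "rad k \<le> cdist k z" using assms(1) by (simp add: region_def)
    also have "(cdist k z)\<^sup>2 < (cdist k (z + of_real h * \<i>))\<^sup>2"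
      unfolding cmod_power2 using region_Im[OF assms(1)] assms(2) by (simp add: power_strict_mono)
    then have "cdist k z < cdist k (z + of_real h * \<i>)" by (rule power2_less_imp_less) simp
    finally show ?thesis by simp
  qed
  then show ?thesis using region_upward[OF assms(1), of h] assms(2) by (auto simp: edges_def)
qed

text \<open>A short vertical detour lifts the points off the edges, so that they can be joined by
  a straight segment.\<close>

lemma rdist_locally_small:
  assumes z: "z \<in> region" and \<epsilon>: "0 < \<epsilon>"
  shows "\<exists>\<delta>>0. \<forall>w\<in>region. dist w z < \<delta> \<longrightarrow> S.rdist (pt s w) (pt s z) < \<epsilon>"
proof -
  have y: "0 < Im z" using z by (rule region_Im)
  \<comment> \<open>Each of the three legs then costs at most
    \<open>h / (Im z / 2) = \<epsilon> / 4\<close>.\<close>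
  define h where "h = \<epsilon> * Im z / 8"
  have h: "0 < h" using \<epsilon> y by (simp add: h_def)
  let ?u = "\<lambda>w. w + of_real h * \<i>"
  obtain r where r: "0 < r" "ball (?u z) r \<subseteq> region"
    using open_interior edges_upward[OF z h] open_contains_ball by (metis Diff_subset order_trans)
  define \<delta> where "\<delta> = min r (min h (Im z / 2))"
  have "\<delta> > 0" using r h y by (simp add: \<delta>_def)
  moreover have "S.rdist (pt s w) (pt s z) < \<epsilon>" if w: "w \<in> region" "dist w z < \<delta>" for w
  proof -
    have dw: "dist w z < r" "dist w z < h" "dist w z < Im z / 2" using w(2) by (auto simp: \<delta>_def)
    have "\<bar>Im w - Im z\<bar> \<le> dist w z" using abs_Im_le_cmod[of "w - z"] by (simp add: dist_norm)
    then have Imw: "Im z / 2 \<le> Im w" using dw(3) by linarith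
    have vert: "S.rdist (pt s v) (pt s (?u v)) \<le> h / (Im z / 2)" if v: "v \<in> region" "Im z / 2 \<le> Im v" for v
    proof (rule rdist_le)
      have v0: "0 < Im v" using v(1) by (rule region_Im)
      have "ln (Im (?u v) / Im v) \<le> Im (?u v) / Im v - 1" using v0 h by (intro ln_le_minus_one) simp
      also have "\<dots> = h / Im v" using v0 by (simp add: field_simps)
      also have "\<dots> \<le> h / (Im z / 2)" using v y h by (intro divide_left_mono) auto
      finally have "ennreal (ln (Im (?u v) / Im v)) \<le> ennreal (h / (Im z / 2))" by (rule ennreal_leI)
      moreover have "S.edist (pt s v) (pt s (?u v)) \<le> ennreal (ln (Im (?u v) / Im v))"
        using v h by (intro edist_vertical) auto
      ultimately show "S.edist (pt s v) (pt s (?u v)) \<le> ennreal (h / (Im z / 2))" by (rule order_trans[rotated])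
    qed (use h y in simp)
    have "S.rdist (pt s (?u w)) (pt s (?u z)) \<le> norm (?u w - ?u z) / (Im z / 2)"
    proof (rule rdist_le)
      have "closed_segment (?u w) (?u z) \<subseteq> ball (?u z) r"
        using dw(1) r(1) by (intro closed_segment_subset) (auto simp: dist_norm norm_minus_commute)
      then show "S.edist (pt s (?u w)) (pt s (?u z)) \<le> ennreal (norm (?u w - ?u z) / (Im z / 2))"
        using r(2) y h Imw by (intro edist_segment) auto
    qed (use y in simp)
    also have "\<dots> \<le> h / (Im z / 2)" using dw(2) y by (intro divide_right_mono) (auto simp: dist_norm)
    finally have horiz: "S.rdist (pt s (?u w)) (pt s (?u z)) \<le> h / (Im z / 2)" .
    have X: "pt s w \<in> topspace S.M" "pt s z \<in> topspace S.M" "pt s (?u w) \<in> topspace S.M" "pt s (?u z) \<in> topspace S.M"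
      using w(1) z h by (auto intro!: pt_in_surface region_upward)
    have "S.rdist (pt s w) (pt s z) \<le> S.rdist (pt s w) (pt s (?u w)) + S.rdist (pt s (?u w)) (pt s z)"
      "S.rdist (pt s (?u w)) (pt s z) \<le> S.rdist (pt s (?u w)) (pt s (?u z)) + S.rdist (pt s (?u z)) (pt s z)"
      by (intro rdist_triangle X)+
    then have "S.rdist (pt s w) (pt s z) \<le> 3 * (h / (Im z / 2))"
      using vert[OF w(1) Imw] vert[OF z] y horiz S.rdist_commute[of "pt s (?u z)" "pt s z"] by simp
    also have "\<dots> < \<epsilon>" using y \<epsilon> by (simp add: h_def)
    finally show ?thesis .
  qed
  ultimately show ?thesis by blast
qed

text \<open>The logarithms of height and modulus are 1-Lipschitz, so a tail of the sequence stays
  over a compact part of the region. A subsequence converges there within one copy, and a Cauchy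
  sequence with a convergent subsequence converges.\<close>

lemma complete_surface: "Metric_space.mcomplete (topspace S.M) S.rdist"
proof -
  interpret D: Metric_space "topspace S.M" S.rdist by (rule Metric_space_surface)
  show ?thesis
    unfolding D.mcomplete_def
  proof (intro allI impI)
    fix \<sigma> :: "nat \<Rightarrow> complex set" assume C: "D.MCauchy \<sigma>"
    then have X: "\<sigma> n \<in> topspace S.M" for n by (auto simp: D.MCauchy_def)
    then have "\<exists>s z. \<sigma> n = pt s z \<and> z \<in> region" for n unfolding topspace_surface by blast
    then obtain s z where sz: "\<And>n. \<sigma> n = pt (s n) (z n)" "\<And>n. z n \<in> region" by metis
    have Im: "0 < Im (z n)" for n using sz(2) region_Im by blast
    have "\<exists>N. \<forall>n n'. N \<le> n \<longrightarrow> N \<le> n' \<longrightarrow> S.rdist (\<sigma> n) (\<sigma> n') < 1"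
      using C unfolding D.MCauchy_def by (meson zero_less_one)
    then obtain N where N: "\<And>n. N \<le> n \<Longrightarrow> S.rdist (\<sigma> n) (\<sigma> N) < 1" by blast
    \<comment> \<open>Within distance 1 of \<open>\<sigma> N\<close>, height and modulus change at
      most by a factor \<open>exp 1\<close>. The bound \<open>m > 0\<close> in place of
      \<open>0 < Im w\<close> makes \<open>K\<close> closed.\<close>
    define m where "m = Im (z N) * exp (-1)"
    define B where "B = norm (z N) * exp 1"
    define K where "K = {w. m \<le> Im w} \<inter> (\<Inter>k. {w. rad k \<le> cdist k w}) \<inter> cball 0 B"
    have m: "0 < m" using Im by (simp add: m_def)
    have "closed ({w. m \<le> Im w} \<inter> (\<Inter>k. {w. rad k \<le> cdist k w}))"
      by (auto intro!: closed_Int closed_INT closed_Collect_le continuous_intros)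
    then have "compact K" unfolding K_def by (intro closed_Int_compact compact_cball)
    have zK: "z (n + N) \<in> K" for n
    proof -
      have N': "S.rdist (\<sigma> (n + N)) (\<sigma> N) < 1" by (rule N) simp
      have "\<bar>ln (Im (z (n + N))) - ln (Im (z N))\<bar> < 1"
        using rdist_ge[OF lipschitz_height X X, of "n + N" N] N' by (simp add: sz sheet_fun_pt)
      moreover have "ln m = ln (Im (z N)) - 1" using Im[of N] by (simp add: m_def ln_mult)
      ultimately have "ln m \<le> ln (Im (z (n + N)))" by simp
      then have 1: "m \<le> Im (z (n + N))" using Im m by simp
      have nz: "0 < norm (z n)" for n using Im[of n] by auto
      have "\<bar>ln (norm (z (n + N))) - ln (norm (z N))\<bar> < 1"
        using rdist_ge[OF lipschitz_modulus[of 0] X X, of "n + N" N] N' by (simp add: sz sheet_fun_pt)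
      then have "ln (norm (z (n + N))) \<le> ln B" using nz by (simp add: B_def ln_mult)
      then have "norm (z (n + N)) \<le> B" using nz by (simp add: B_def)
      then show ?thesis using 1 sz(2)[of "n + N"] by (auto simp: K_def region_def)
    qed
    \<comment> \<open>Encoding the copy as 0 or 1 lets a single compactness argument select the copy
      and the limit of the base points together.\<close>
    have "compact ({0, 1::real} \<times> K)" using \<open>compact K\<close> by (intro compact_Times) auto
    then have c: "seq_compact ({0, 1::real} \<times> K)" by (simp add: compact_eq_seq_compact_metric)
    have "\<forall>n. (of_bool (s (n + N)), z (n + N)) \<in> {0, 1::real} \<times> K" using zK by auto
    then obtain l r where l: "l \<in> {0, 1::real} \<times> K" and r: "strict_mono r"
      and lim: "((\<lambda>n. (of_bool (s (n + N)), z (n + N))) \<circ> r) \<longlonglongrightarrow> l"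
      by (rule seq_compactE[OF c])
    obtain x w where xw: "l = (x, w)" "x \<in> {0, 1}" "w \<in> K" using l by (rule SigmaE)
    define b where "b = (x = 1)"
    have bw: "l = (of_bool b, w)" "w \<in> K" using xw by (auto simp: b_def)
    have w: "w \<in> region" using bw(2) m by (auto simp: K_def region_def)
    have "(\<lambda>n. of_bool (s (r n + N)) :: real) \<longlonglongrightarrow> of_bool b"
      using tendsto_fst[OF lim] by (simp add: bw o_def)
    then have "eventually (\<lambda>n. dist (of_bool (s (r n + N)) :: real) (of_bool b) < 1) sequentially"
      by (rule tendstoD) simp
    then have ev: "eventually (\<lambda>n. s (r n + N) = b) sequentially"
      by (rule eventually_mono) (auto simp: dist_real_def of_bool_def split: if_splits)
    have zlim: "(\<lambda>n. z (r n + N)) \<longlonglongrightarrow> w" using tendsto_snd[OF lim] by (simp add: bw o_def)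
    define r' where "r' n = r n + N" for n
    have r': "strict_mono r'" using r by (auto simp: r'_def strict_mono_def)
    have "limitin D.mtopology (\<sigma> \<circ> r') (pt b w) sequentially"
      unfolding D.limit_metric_sequentially
    proof (intro conjI allI impI)
      show "pt b w \<in> topspace S.M" using w by (rule pt_in_surface)
      fix \<epsilon> :: real assume "0 < \<epsilon>"
      from rdist_locally_small[OF w this, of b] obtain \<delta> where \<delta>: "0 < \<delta>"
        "\<And>v. v \<in> region \<Longrightarrow> dist v w < \<delta> \<Longrightarrow> S.rdist (pt b v) (pt b w) < \<epsilon>" by blast
      have "eventually (\<lambda>n. dist (z (r n + N)) w < \<delta>) sequentially" using zlim \<delta>(1) by (rule tendstoD)
      with ev have "eventually (\<lambda>n. S.rdist (\<sigma> (r' n)) (pt b w) < \<epsilon>) sequentially"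
        by eventually_elim (use \<delta>(2) sz in \<open>auto simp: r'_def\<close>)
      then obtain N' where "\<And>n. N' \<le> n \<Longrightarrow> S.rdist (\<sigma> (r' n)) (pt b w) < \<epsilon>"
        unfolding eventually_sequentially by blast
      then show "\<exists>N. \<forall>n\<ge>N. (\<sigma> \<circ> r') n \<in> topspace S.M \<and> S.rdist ((\<sigma> \<circ> r') n) (pt b w) < \<epsilon>"
        using X by (intro exI[of _ N']) auto
    qed
    then show "\<exists>x. limitin D.mtopology \<sigma> x sequentially"
      using D.MCauchy_convergent_subsequence[OF C r'] by blast
  qed
qed

lemma hyperbolic_surface_atlas: "hyperbolic_surface S.M atlas hyp_metric"
  unfolding hyperbolic_surface_def complete_riemannian_manifold_def riemannian_manifold_def
  using S.smooth_manifold_atlas[OF S.Hausdorff_atlas[OF lipschitz_separates]]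
    S.connected_space_atlas[OF edist_finite] S.riemannian_metric_atlas complete_surface
    S.constant_curvature_atlas by blast

section \<open>Rays\<close>

context Metric_space
begin

text \<open>From the origin of the ray, the expression under the limit is
  \<open>t - d (\<gamma> t) y\<close>, which is nondecreasing and bounded by the triangle
  inequality. The limit is its supremum, so one good \<open>t\<close> gives a lower bound.\<close>

lemma busemann_ray:
  assumes \<gamma>: "is_ray M d \<gamma>" and y: "y \<in> M"
  shows "0 \<le> t \<Longrightarrow> t - d (\<gamma> t) y \<le> busemann d \<gamma> (\<gamma> 0) y"
    and "(\<And>t. 0 \<le> t \<Longrightarrow> t - d (\<gamma> t) y \<le> b) \<Longrightarrow> busemann d \<gamma> (\<gamma> 0) y \<le> b"
proof -
  have X: "\<gamma> t \<in> M" if "0 \<le> t" for t using \<gamma> that by (simp add: is_ray_def)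
  have D: "d (\<gamma> t) (\<gamma> s) = \<bar>t - s\<bar>" if "0 \<le> s" "0 \<le> t" for s t using \<gamma> that by (simp add: is_ray_def)
  define \<phi> where "\<phi> t = t - d (\<gamma> t) y" for t
  have mono: "\<phi> s \<le> \<phi> t" if "0 \<le> s" "s \<le> t" for s t
    using triangle[OF X X y, of t s] D[of s t] that by (simp add: \<phi>_def)
  have bound: "\<phi> t \<le> d (\<gamma> 0) y" if "0 \<le> t" for t
    using triangle[OF X y X, of t 0] D[of 0 t] that commute[of y "\<gamma> 0"] by (simp add: \<phi>_def)
  define L where "L = Sup (\<phi> ` {0..})"
  have bdd: "bdd_above (\<phi> ` {0..})" using bound by (auto simp: bdd_above_def)
  have le: "\<phi> t \<le> L" if "0 \<le> t" for t unfolding L_def using that bdd by (intro cSup_upper) auto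
  have "(\<phi> \<longlongrightarrow> L) at_top"
  proof (rule increasing_tendsto)
    show "\<forall>\<^sub>F t in at_top. \<phi> t \<le> L" using eventually_ge_at_top[of 0] by (rule eventually_mono) (rule le)
    fix x assume "x < L"
    then obtain s where s: "0 \<le> s" "x < \<phi> s" unfolding L_def using less_cSup_iff[OF _ bdd, of x] by auto
    show "\<forall>\<^sub>F t in at_top. x < \<phi> t"
      using eventually_ge_at_top[of s] by (rule eventually_mono) (use mono s in force)
  qed
  moreover have "\<forall>\<^sub>F t in at_top. \<phi> t = d (\<gamma> 0) (\<gamma> t) - d (\<gamma> t) y"
    using eventually_ge_at_top[of 0] by (rule eventually_mono) (use D in \<open>simp add: \<phi>_def\<close>)
  ultimately have "((\<lambda>t. d (\<gamma> 0) (\<gamma> t) - d (\<gamma> t) y) \<longlongrightarrow> L) at_top"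
    by (rule Lim_transform_eventually)
  then have B: "busemann d \<gamma> (\<gamma> 0) y = L"
    unfolding busemann_def by (rule tendsto_Lim[rotated]) simp
  show "0 \<le> t \<Longrightarrow> t - d (\<gamma> t) y \<le> busemann d \<gamma> (\<gamma> 0) y" using le unfolding B \<phi>_def .
  show "(\<And>t. 0 \<le> t \<Longrightarrow> t - d (\<gamma> t) y \<le> b) \<Longrightarrow> busemann d \<gamma> (\<gamma> 0) y \<le> b"
    unfolding B L_def by (intro cSup_least) (auto simp: \<phi>_def)
qed

lemma same_busemann_asymptotic:
  assumes X: "\<And>t. 0 \<le> t \<Longrightarrow> \<gamma> t \<in> M" "\<And>t. 0 \<le> t \<Longrightarrow> \<delta> t \<in> M"
    and lim: "((\<lambda>t. d (\<gamma> t) (\<delta> t)) \<longlongrightarrow> 0) at_top"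
  shows "same_busemann M d \<gamma> \<delta>"
  unfolding same_busemann_def
proof (intro ballI)
  fix x y assume xy: "x \<in> M" "y \<in> M"
  have "((\<lambda>t. (d x (\<gamma> t) - d (\<gamma> t) y) - (d x (\<delta> t) - d (\<delta> t) y)) \<longlongrightarrow> 0) at_top"
  proof (rule Lim_null_comparison)
    show "((\<lambda>t. 2 * d (\<gamma> t) (\<delta> t)) \<longlongrightarrow> 0) at_top" using tendsto_mult_right_zero[OF lim] .
    have "norm ((d x (\<gamma> t) - d (\<gamma> t) y) - (d x (\<delta> t) - d (\<delta> t) y)) \<le> 2 * d (\<gamma> t) (\<delta> t)" if t: "0 \<le> t" for t
      using triangle[OF xy(1) X(1)[OF t] X(2)[OF t]] triangle[OF xy(1) X(2)[OF t] X(1)[OF t]]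
        triangle[OF X(1)[OF t] X(2)[OF t] xy(2)] triangle[OF X(2)[OF t] X(1)[OF t] xy(2)]
        commute[of "\<gamma> t" "\<delta> t"] by (simp add: abs_le_iff)
    then show "\<forall>\<^sub>F t in at_top. norm ((d x (\<gamma> t) - d (\<gamma> t) y) - (d x (\<delta> t) - d (\<delta> t) y)) \<le> 2 * d (\<gamma> t) (\<delta> t)"
      using eventually_ge_at_top[of 0] by (rule eventually_mono[rotated])
  qed
  \<comment> \<open>The two expressions have the same limits, and \<open>Lim\<close> is a
    description of the limit, so its values coincide.\<close>
  from Lim_transform_eq[OF this]
  show "busemann d \<gamma> x y = busemann d \<delta> x y" unfolding busemann_def t2_space_class.Lim_def by simp
qed

end

section \<open>The rays and their minimality\<close>

definition imag_axis :: "real \<Rightarrow> complex" where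
  "imag_axis t = of_real (exp t) * \<i>"

text \<open>The rotation of the half plane about \<open>\<i>\<close> that maps \<open>0\<close> to \<open>centre n\<close>,
  applied to the vertical geodesic descending from \<open>\<i>\<close>.\<close>

definition rot_axis :: "nat \<Rightarrow> real \<Rightarrow> complex" where
  "rot_axis n t = (of_real (centre n) + \<i> * of_real (exp (-t))) / (1 - \<i> * of_real (centre n * exp (-t)))"

text \<open>The mirror image of \<open>rot_axis n\<close> under \<open>reflect n\<close>, with the
  same parameter: \<open>\<i>\<close> goes to \<open>(centre n + \<i>) / 2\<close> and
  \<open>centre n\<close> to infinity, so the arc becomes a vertical line.\<close>

definition line :: "nat \<Rightarrow> real \<Rightarrow> complex" where
  "line n t = Complex (centre n / 2) (exp t / 2)"

text \<open>The crossing time: \<open>line n t\<close> is on edge \<open>n\<close> when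
  \<open>(centre n / 2)^2 + (exp t / 2)^2 = (rad n)^2\<close>, that is,
  \<open>exp (2 * t) = (centre n)^2 + 2\<close>.\<close>

definition turn :: "nat \<Rightarrow> real" where
  "turn n = ln ((centre n)\<^sup>2 + 2) / 2"

definition ray :: "nat \<Rightarrow> real \<Rightarrow> complex set" where
  "ray n t = (if t \<le> turn n then pt True (rot_axis n t) else pt False (line n t))"

definition limit_ray :: "real \<Rightarrow> complex set" where
  "limit_ray t = pt True (imag_axis t)"

lemma exp_turn: "(exp (turn n))\<^sup>2 = (centre n)\<^sup>2 + 2"
proof -
  have "(exp (turn n))\<^sup>2 = exp (2 * turn n)" by (simp add: power2_eq_square flip: exp_add)
  then show ?thesis by (simp add: turn_def add_nonneg_pos)
qed

lemma le_turn_iff: "t \<le> turn n \<longleftrightarrow> (exp t)\<^sup>2 \<le> (centre n)\<^sup>2 + 2"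
  unfolding exp_turn[symmetric] by (simp add: power2_le_iff_abs_le)

lemma turn_nonneg: "0 \<le> turn n"
  by (simp add: le_turn_iff)

lemma rot_axis_components:
  "Re (rot_axis n t) = centre n * (1 - (exp (-t))\<^sup>2) / (1 + (centre n)\<^sup>2 * (exp (-t))\<^sup>2)"
  "Im (rot_axis n t) = exp (-t) * (1 + (centre n)\<^sup>2) / (1 + (centre n)\<^sup>2 * (exp (-t))\<^sup>2)"
  unfolding rot_axis_def
  by (simp_all add: Re_divide Im_divide power2_eq_square algebra_simps)

lemma rot_axis_denominator_pos: "0 < 1 + (centre n)\<^sup>2 * (exp (-t))\<^sup>2"
  by (simp add: add_pos_nonneg)

lemma Im_rot_axis_pos: "0 < Im (rot_axis n t)"
  unfolding rot_axis_components using rot_axis_denominator_pos[of n t]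
  by (intro divide_pos_pos mult_pos_pos) (auto simp: add_pos_nonneg)

text \<open>The equation of the geodesic through \<open>\<i>\<close> with end points
  \<open>centre n\<close> and \<open>- 1 / centre n\<close>.\<close>

lemma rot_axis_circle: "(norm (rot_axis n t))\<^sup>2 = ((centre n)\<^sup>2 - 1) / centre n * Re (rot_axis n t) + 1"
proof -
  define D where "D = 1 + (centre n)\<^sup>2 * (exp (-t))\<^sup>2"
  have D: "0 < D" unfolding D_def by (rule rot_axis_denominator_pos)
  have c: "centre n \<noteq> 0" using centre_ge_10[of n] by simp
  have "norm (rot_axis n t) ^ 2 = (norm (of_real (centre n) + \<i> * of_real (exp (-t))))\<^sup>2 / (norm (1 - \<i> * of_real (centre n * exp (-t))))\<^sup>2"
    unfolding rot_axis_def by (simp add: norm_divide power_divide)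
  also have "\<dots> = ((centre n)\<^sup>2 + (exp (-t))\<^sup>2) / D"
    by (simp add: cmod_power2 D_def power_mult_distrib)
  also have "\<dots> = ((centre n)\<^sup>2 - 1) / centre n * Re (rot_axis n t) + 1"
    unfolding rot_axis_components D_def[symmetric] using D c
    by (simp add: field_simps) (simp add: D_def power2_eq_square algebra_simps)
  finally show ?thesis .
qed

text \<open>On the circle of the arc, \<open>(cdist k)^2 - (rad k)^2\<close> is an affine function
  of the real part, so it suffices to know that the real part runs between 0 and
  \<open>centre n / 2\<close>.\<close>

lemma region_rot_axis:
  assumes "0 \<le> t" "t \<le> turn n"
  shows "rot_axis n t \<in> region"
  unfolding region_def
proof (intro CollectI conjI allI)
  show "0 < Im (rot_axis n t)" by (rule Im_rot_axis_pos)
  fix k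
  let ?c = "centre n" and ?x = "Re (rot_axis n t)"
  have c: "10 \<le> ?c" "10 \<le> centre k" by (rule centre_ge_10)+
  have E: "(exp (-t))\<^sup>2 \<le> 1" "0 < (exp (-t))\<^sup>2" using assms(1) by (simp_all add: power_le_one)
  have x0: "0 \<le> ?x" unfolding rot_axis_components using E c rot_axis_denominator_pos[of n t] by simp
  \<comment> \<open>\<open>t \<le> turn n\<close>, multiplied by \<open>exp (-t)^2\<close>, is what
    bounds the real part by \<open>centre n / 2\<close>.\<close>
  have "2 * (1 - (exp (-t))\<^sup>2) \<le> 1 + ?c\<^sup>2 * (exp (-t))\<^sup>2"
  proof -
    have "(exp t)\<^sup>2 * (exp (-t))\<^sup>2 \<le> (?c\<^sup>2 + 2) * (exp (-t))\<^sup>2"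
      using assms(2) by (intro mult_right_mono) (auto simp: le_turn_iff)
    moreover have "(exp t)\<^sup>2 * (exp (-t))\<^sup>2 = 1" by (simp add: exp_minus flip: power_mult_distrib)
    ultimately show ?thesis by (simp add: algebra_simps)
  qed
  then have "2 * (1 - (exp (-t))\<^sup>2) * ?c \<le> (1 + ?c\<^sup>2 * (exp (-t))\<^sup>2) * ?c" using c by (intro mult_right_mono) auto
  then have x1: "?x \<le> ?c / 2"
    unfolding rot_axis_components using rot_axis_denominator_pos[of n t] by (simp add: field_simps)
  have m: "(?c\<^sup>2 - 1) / ?c = ?c - 1 / ?c" using c by (simp add: field_simps power2_eq_square)
  have ic: "1 / ?c \<le> 1 / 10" using c by (intro divide_left_mono) auto
  \<comment> \<open>The affine function in question. For \<open>k = n\<close> its least value 0 is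
    attained at the crossing; for \<open>k < n\<close> its slope is nonnegative; for
    \<open>k > n\<close> the real part is at most \<open>centre k / 20\<close>, too small to
    matter.\<close>
  have "0 \<le> ((?c\<^sup>2 - 1) / ?c - 2 * centre k) * ?x + (1 + (centre k)\<^sup>2) / 2"
  proof (cases "k = n")
    case True
    have "((?c\<^sup>2 - 1) / ?c - 2 * ?c) * ?x = - ((?c + 1 / ?c) * ?x)" unfolding m by (simp add: algebra_simps)
    moreover have "(?c + 1 / ?c) * ?x \<le> (?c + 1 / ?c) * (?c / 2)" using x1 c by (intro mult_left_mono) auto
    moreover have "(?c + 1 / ?c) * (?c / 2) = (1 + ?c\<^sup>2) / 2" using c by (simp add: field_simps power2_eq_square)
    ultimately show ?thesis using True by simp
  next
    case False
    then consider "k < n" | "n < k" by linarith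
    then show ?thesis
    proof cases
      case 1
      then have "10 * centre k \<le> ?c" by (rule centre_mono)
      then have "0 \<le> (?c\<^sup>2 - 1) / ?c - 2 * centre k" unfolding m using ic c by linarith
      then show ?thesis using x0 by simp
    next
      case 2
      then have "10 * ?c \<le> centre k" by (rule centre_mono)
      then have "(2 * centre k) * ?x \<le> (2 * centre k) * (centre k / 20)"
        using x1 c by (intro mult_left_mono) auto
      moreover have "0 \<le> ?c - 1 / ?c" using ic c by linarith
      then have "0 \<le> (?c\<^sup>2 - 1) / ?c * ?x" unfolding m using x0 by (rule mult_nonneg_nonneg)
      moreover have "(2 * centre k) * (centre k / 20) = (centre k)\<^sup>2 / 10" by (simp add: power2_eq_square)
      moreover have "0 \<le> (centre k)\<^sup>2" by simp
      moreover have "0 \<le> (M - 2 * C) * x + (1 + Q) / 2" if "2 * C * x \<le> Q / 10" "0 \<le> M * x" "0 \<le> Q" for M C x Q :: real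
      proof -
        have *: "(M - 2 * C) * x = M * x - 2 * (C * x)" by (simp add: algebra_simps)
        have "20 * (C * x) \<le> Q" using that(1) by simp
        then show ?thesis unfolding * add_divide_distrib using that(2,3) by linarith
      qed
      ultimately show ?thesis by simp
    qed
  qed
  then have "(rad k)\<^sup>2 \<le> (cdist k (rot_axis n t))\<^sup>2"
    unfolding cdist_sq rot_axis_circle rad_sq by (simp add: algebra_simps add_divide_distrib)
  then show "rad k \<le> cdist k (rot_axis n t)" by (rule power2_le_imp_le) simp
qed

lemma rot_axis_turn: "rot_axis n (turn n) = line n (turn n)"
proof -
  let ?c = "centre n" and ?e = "exp (turn n)"
  have e: "?e\<^sup>2 = ?c\<^sup>2 + 2" by (rule exp_turn)
  have pos: "0 < ?c\<^sup>2 + 2" by (simp add: add_nonneg_pos)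
  have E: "exp (- turn n) = 1 / ?e" by (simp add: exp_minus field_simps)
  have E2: "(exp (- turn n))\<^sup>2 = 1 / (?c\<^sup>2 + 2)" unfolding E power_divide e by simp
  have D: "1 + ?c\<^sup>2 * (exp (- turn n))\<^sup>2 = 2 * (1 + ?c\<^sup>2) / (?c\<^sup>2 + 2)"
    unfolding E2 using pos by (simp add: field_simps)
  have p: "1 + ?c\<^sup>2 \<noteq> 0" "?c\<^sup>2 + 2 \<noteq> 0" using pos by (auto simp: add_nonneg_eq_0_iff)
  have "1 - (exp (- turn n))\<^sup>2 = (1 + ?c\<^sup>2) / (?c\<^sup>2 + 2)" unfolding E2 using pos by (simp add: field_simps)
  then have "Re (rot_axis n (turn n)) = ?c / 2" unfolding rot_axis_components D using p by (simp add: field_simps)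
  moreover have "Im (rot_axis n (turn n)) = ?e / 2"
  proof -
    have "1 / e * u / (2 * u / w) = w / (2 * e)" if "u \<noteq> 0" "w \<noteq> 0" for e u w :: real
      using that by (simp add: field_simps)
    from this[OF p, of ?e] have "Im (rot_axis n (turn n)) = (?c\<^sup>2 + 2) / (2 * ?e)"
      unfolding rot_axis_components D unfolding E .
    also have "\<dots> = ?e / 2" unfolding e[symmetric] by (simp add: power2_eq_square)
    finally show ?thesis .
  qed
  ultimately show ?thesis by (simp add: line_def complex_eq_iff)
qed

lemma line_turn_edges: "line n (turn n) \<in> edges"
proof -
  have "line n (turn n) \<in> region" using region_rot_axis[OF turn_nonneg order.refl] rot_axis_turn by simp
  moreover have "(cdist n (line n (turn n)))\<^sup>2 = (rad n)\<^sup>2"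
  proof -
    have "(exp (turn n) / 2)\<^sup>2 = ((centre n)\<^sup>2 + 2) / 4" unfolding power_divide exp_turn by simp
    then show ?thesis unfolding rad_sq cmod_power2 by (simp add: line_def power2_eq_square field_simps)
  qed
  then have "cdist n (line n (turn n)) = rad n" using rad_pos[of n] by (simp add: power2_eq_iff_nonneg)
  ultimately show ?thesis by (auto simp: edges_def)
qed

lemma region_line:
  assumes "turn n \<le> t"
  shows "line n t \<in> region"
proof -
  have "line n (turn n) + of_real (exp t / 2 - exp (turn n) / 2) * \<i> \<in> region"
    using line_turn_edges assms by (intro region_upward) (auto simp: edges_def)
  moreover have "line n (turn n) + of_real (exp t / 2 - exp (turn n) / 2) * \<i> = line n t"
    by (simp add: line_def complex_eq_iff)
  ultimately show ?thesis by simp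
qed

lemma ray_line: "turn n \<le> t \<Longrightarrow> ray n t = pt False (line n t)"
  using line_turn_edges[of n] by (cases "t = turn n") (auto simp: ray_def rot_axis_turn pt_def)

lemma rot_axis_0: "rot_axis n 0 = \<i>"
proof -
  have "0 < 1 + (centre n)\<^sup>2" by (simp add: add_pos_nonneg)
  then show ?thesis by (simp add: complex_eq_iff rot_axis_components)
qed

lemma ray_0: "ray n 0 = pt True \<i>"
  by (simp add: ray_def turn_nonneg rot_axis_0)

lemma ray_in_surface: "0 \<le> t \<Longrightarrow> ray n t \<in> topspace S.M"
  by (auto simp: ray_def intro!: pt_in_surface region_rot_axis region_line)

lemma rot_axis_has_derivative:
  "(rot_axis n has_vector_derivative
     - \<i> * of_real (exp (-t) * (1 + (centre n)\<^sup>2)) / (1 - \<i> * of_real (centre n * exp (-t)))\<^sup>2) (at t)"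
proof -
  let ?c = "complex_of_real (centre n)"
  define z where "z = of_real (exp (-t)) * \<i>"
  have nz: "1 - ?c * z \<noteq> 0"
  proof -
    have "Re (1 - ?c * z) = 1" by (simp add: z_def)
    then show ?thesis by (metis zero_complex.sel(1) zero_neq_one)
  qed
  have "((\<lambda>z. (?c + z) / (1 - ?c * z)) has_field_derivative ((1 - ?c * z) + ?c * (?c + z)) / (1 - ?c * z)\<^sup>2) (at z)"
    using nz by (auto intro!: derivative_eq_intros simp: field_simps power2_eq_square)
  moreover have "((\<lambda>t. of_real (exp (-t)) * \<i>) has_vector_derivative of_real (- exp (-t)) * \<i>) (at t)"
    by (auto intro!: derivative_eq_intros has_vector_derivative_of_real)
  ultimately have "((\<lambda>z. (?c + z) / (1 - ?c * z)) \<circ> (\<lambda>t. of_real (exp (-t)) * \<i>) has_vector_derivative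
      (of_real (- exp (-t)) * \<i>) * (((1 - ?c * z) + ?c * (?c + z)) / (1 - ?c * z)\<^sup>2)) (at t)"
    unfolding z_def by (intro field_vector_diff_chain_at)
  moreover have "(\<lambda>z. (?c + z) / (1 - ?c * z)) \<circ> (\<lambda>t. of_real (exp (-t)) * \<i>) = rot_axis n"
    by (simp add: fun_eq_iff rot_axis_def mult_ac)
  moreover have "(of_real (- exp (-t)) * \<i>) * (((1 - ?c * z) + ?c * (?c + z)) / (1 - ?c * z)\<^sup>2)
      = - \<i> * of_real (exp (-t) * (1 + (centre n)\<^sup>2)) / (1 - \<i> * of_real (centre n * exp (-t)))\<^sup>2"
  proof -
    have num: "(1 - ?c * z) + ?c * (?c + z) = 1 + ?c\<^sup>2" by (simp add: algebra_simps power2_eq_square)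
    have den: "1 - ?c * z = 1 - \<i> * of_real (centre n * exp (-t))" by (simp add: z_def mult_ac)
    show ?thesis unfolding num unfolding den by simp
  qed
  ultimately show ?thesis by simp
qed

lemma ray_short_ordered:
  assumes "0 \<le> s" "s \<le> t"
  shows "S.rdist (ray n s) (ray n t) \<le> t - s"
proof -
  have rot_axis: "S.rdist (ray n s) (ray n t) \<le> t - s" if "0 \<le> s" "s < t" "t \<le> turn n" for s t
  proof -
    have "S.edist (pt True (rot_axis n s)) (pt True (rot_axis n t)) \<le> ennreal (1 * (t - s))"
    proof (rule sheet_path[OF that(2) _ rot_axis_has_derivative])
      show "rot_axis n r \<in> region" if "r \<in> {s..t}" for r
        using that \<open>0 \<le> s\<close> \<open>t \<le> turn n\<close> by (intro region_rot_axis) auto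
      have "1 - \<i> * complex_of_real (centre n * exp (-r)) \<noteq> 0" for r
      proof -
        have "Re (1 - \<i> * complex_of_real (centre n * exp (-r))) = 1" by simp
        then show ?thesis by (metis zero_complex.sel(1) zero_neq_one)
      qed
      then show "continuous_on {s..t} (\<lambda>t. - \<i> * of_real (exp (-t) * (1 + (centre n)\<^sup>2)) / (1 - \<i> * of_real (centre n * exp (-t)))\<^sup>2)"
        by (intro continuous_intros) auto
      fix r
      have "norm (- \<i> * complex_of_real (exp (-r) * (1 + (centre n)\<^sup>2))) = exp (-r) * (1 + (centre n)\<^sup>2)"
        by (simp add: norm_mult abs_mult del: of_real_mult of_real_add)
      moreover have "(norm (1 - \<i> * complex_of_real (centre n * exp (-r))))\<^sup>2 = 1 + (centre n)\<^sup>2 * (exp (-r))\<^sup>2"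
        by (simp add: cmod_power2 power_mult_distrib)
      \<comment> \<open>Both sides are equal: the arc has unit speed.\<close>
      ultimately show "norm (- \<i> * of_real (exp (-r) * (1 + (centre n)\<^sup>2)) / (1 - \<i> * of_real (centre n * exp (-r)))\<^sup>2)
          \<le> 1 * Im (rot_axis n r)"
        unfolding rot_axis_components by (simp only: norm_divide norm_power mult_1 order.refl)
    qed
    then show ?thesis using that by (intro rdist_le) (auto simp: ray_def)
  qed
  have line: "S.rdist (ray n s) (ray n t) \<le> t - s" if "turn n \<le> s" "s < t" for s t
  proof -
    have "S.edist (pt False (line n s)) (pt False (line n t)) \<le> ennreal (ln (Im (line n t) / Im (line n s)))"
      by (rule edist_vertical[OF region_line[OF that(1)]]) (use that in \<open>auto simp: line_def\<close>)
    also have "ln (Im (line n t) / Im (line n s)) = t - s" by (simp add: line_def ln_div)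
    finally show ?thesis using that by (intro rdist_le) (auto simp: ray_line)
  qed
  consider "s = t" | "s < t" "t \<le> turn n" | "turn n \<le> s" "s < t" | "s < turn n" "turn n < t"
    using assms by linarith
  then show ?thesis
  proof cases
    case 1
    then show ?thesis using S.edist_self ray_in_surface assms by (simp add: S.rdist_edist)
  next
    case 4
    have "S.rdist (ray n s) (ray n t) \<le> S.rdist (ray n s) (ray n (turn n)) + S.rdist (ray n (turn n)) (ray n t)"
      using assms turn_nonneg by (intro rdist_triangle ray_in_surface) auto
    also have "\<dots> \<le> (turn n - s) + (t - turn n)"
      using rot_axis[OF assms(1) 4(1)] line[OF _ 4(2)] by (intro add_mono) auto
    finally show ?thesis by simp
  qed (use rot_axis line assms in auto)
qed

text \<open>Here the choice of the radii enters: \<open>(cdist k \<i>)^2 = 2 * (rad k)^2\<close> for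
  every \<open>k\<close>, so each reflection halves the height of \<open>\<i>\<close> and all terms
  of the supremum coincide.\<close>

lemma climb_i: "climb True \<i> = - ln 2"
proof -
  have "Im (reflect k \<i>) = 1/2" for k
  proof -
    have "(cdist k \<i>)\<^sup>2 = (centre k)\<^sup>2 + 1" by (simp add: cmod_power2)
    moreover have "(centre k)\<^sup>2 + 1 \<noteq> 0" by (simp add: add_nonneg_eq_0_iff)
    ultimately show ?thesis unfolding Im_inversion rad_sq by simp
  qed
  note * = this
  have "climb True \<i> = (SUP k::nat. ln (1/2))" unfolding climb_def * by simp
  then show ?thesis by (simp add: ln_div)
qed

lemma region_i: "\<i> \<in> region"
  by (rule region_left) auto

text \<open>\<open>climb\<close> gains exactly \<open>T\<close> between the parameters 0 and
  \<open>T\<close>, and the ray has length at most \<open>T\<close> there. It is minimizing up to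
  \<open>T\<close>, and pieces of a minimizing curve are minimizing.\<close>

lemma is_ray_ray: "is_ray (topspace S.M) S.rdist (ray n)"
  unfolding is_ray_def
proof (intro conjI allI impI)
  show "ray n t \<in> topspace S.M" if "0 \<le> t" for t using that by (rule ray_in_surface)
  have long: "t - s \<le> S.rdist (ray n s) (ray n t)" if st: "0 \<le> s" "s \<le> t" for s t
  proof -
    \<comment> \<open>Beyond the crossing the ray is in the second copy, where \<open>climb\<close>
      is just the logarithmic height.\<close>
    define T where "T = max t (turn n)"
    have T: "t \<le> T" "turn n \<le> T" "0 \<le> T" using st by (auto simp: T_def)
    have v: "sheet_fun climb (ray n 0) = - ln 2" "sheet_fun climb (ray n T) = T - ln 2"
      unfolding ray_0 ray_line[OF T(2)]
      using climb_edge climb_i region_i region_line[OF T(2)]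
      by (auto simp: sheet_fun_pt) (simp add: climb_def line_def ln_div)
    have X: "ray n 0 \<in> topspace S.M" "ray n s \<in> topspace S.M" "ray n t \<in> topspace S.M" "ray n T \<in> topspace S.M"
      using st T by (auto intro: ray_in_surface)
    have "T \<le> S.rdist (ray n 0) (ray n T)"
      using rdist_ge[OF lipschitz_climb X(1,4)] v by simp
    also have "\<dots> \<le> S.rdist (ray n 0) (ray n s) + S.rdist (ray n s) (ray n T)" by (rule rdist_triangle[OF X(1,2,4)])
    also have "S.rdist (ray n s) (ray n T) \<le> S.rdist (ray n s) (ray n t) + S.rdist (ray n t) (ray n T)"
      by (rule rdist_triangle[OF X(2,3,4)])
    finally show ?thesis
      using ray_short_ordered[of 0 s n] ray_short_ordered[of t T n] st T by linarith
  qed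
  fix s t :: real assume st: "0 \<le> s" "0 \<le> t"
  have eq: "S.rdist (ray n s) (ray n t) = t - s" if "0 \<le> s" "s \<le> t" for s t
    using long[OF that] ray_short_ordered[OF that] by (rule antisym[rotated])
  show "S.rdist (ray n t) (ray n s) = \<bar>t - s\<bar>"
    using eq[of s t] eq[of t s] st S.rdist_commute[of "ray n t" "ray n s"] by (cases "s \<le> t") auto
qed

lemma region_imag_axis: "imag_axis t \<in> region"
  by (rule region_left) (auto simp: imag_axis_def)

text \<open>The height taken equally on both copies calibrates vertical lines, so no detour through
  the other copy shortens them.\<close>

lemma is_ray_limit_ray: "is_ray (topspace S.M) S.rdist limit_ray"
  unfolding is_ray_def
proof (intro conjI allI impI)
  show X: "limit_ray t \<in> topspace S.M" for t unfolding limit_ray_def by (rule pt_in_surface[OF region_imag_axis])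
  have eq: "S.rdist (limit_ray s) (limit_ray t) = t - s" if "s < t" for s t
  proof (rule antisym)
    have "S.edist (limit_ray s) (limit_ray t) \<le> ennreal (ln (Im (imag_axis t) / Im (imag_axis s)))"
      unfolding limit_ray_def by (rule edist_vertical[OF region_imag_axis]) (use that in \<open>auto simp: imag_axis_def\<close>)
    also have "ln (Im (imag_axis t) / Im (imag_axis s)) = t - s" by (simp add: imag_axis_def ln_div)
    finally show "S.rdist (limit_ray s) (limit_ray t) \<le> t - s" using that by (intro rdist_le) auto
    show "t - s \<le> S.rdist (limit_ray s) (limit_ray t)"
      using rdist_ge[OF lipschitz_height X X, of s t] that
      by (simp add: limit_ray_def sheet_fun_pt region_imag_axis) (simp add: imag_axis_def)
  qed
  have "S.rdist (limit_ray s) (limit_ray s) = 0" for s using S.edist_self[OF X] by (simp add: S.rdist_edist)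
  then show "S.rdist (limit_ray t) (limit_ray s) = \<bar>t - s\<bar>" for s t
    using eq[of s t] eq[of t s] S.rdist_commute[of "limit_ray t" "limit_ray s"] by (cases s t rule: linorder_cases) auto
qed

section \<open>Convergence to the limit ray\<close>

lemma rot_axis_imag_axis_dist: "norm (rot_axis n t - imag_axis t) \<le> exp (2 * t) / centre n" if "0 \<le> t"
proof -
  let ?E = "exp (-t)" and ?c = "centre n"
  have c: "10 \<le> ?c" by (rule centre_ge_10)
  have nz: "1 - \<i> * complex_of_real (?c * ?E) \<noteq> 0"
  proof -
    have "Re (1 - \<i> * complex_of_real (?c * ?E)) = 1" by simp
    then show ?thesis by (metis zero_complex.sel(1) zero_neq_one)
  qed
  have ax: "imag_axis t = \<i> / complex_of_real ?E" by (simp add: imag_axis_def exp_minus field_simps)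
  have "rot_axis n t - imag_axis t = (\<i> * (of_real (?E\<^sup>2) - 1)) / (of_real ?E * (1 - \<i> * of_real (?c * ?E)))"
    unfolding ax rot_axis_def using nz by (simp add: divide_simps) (simp add: algebra_simps power2_eq_square)
  then have "norm (rot_axis n t - imag_axis t) = norm (complex_of_real (?E\<^sup>2 - 1)) / (?E * norm (1 - \<i> * complex_of_real (?c * ?E)))"
    by (simp add: norm_divide norm_mult)
  also have "norm (complex_of_real (?E\<^sup>2 - 1)) = \<bar>?E\<^sup>2 - 1\<bar>" by (rule norm_of_real)
  also have "\<bar>?E\<^sup>2 - 1\<bar> / (?E * norm (1 - \<i> * complex_of_real (?c * ?E))) \<le> 1 / (?E * (?c * ?E))"
  proof (rule frac_le)
    have "?E\<^sup>2 \<le> 1" "0 \<le> ?E\<^sup>2" using that by (simp_all add: power_le_one)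
    then show "\<bar>?E\<^sup>2 - 1\<bar> \<le> 1" by linarith
    show "0 < ?E * (?c * ?E)" using c by simp
    have "?c * ?E \<le> norm (1 - \<i> * complex_of_real (?c * ?E))"
      using abs_Im_le_cmod[of "1 - \<i> * complex_of_real (?c * ?E)"] c by simp
    then show "?E * (?c * ?E) \<le> ?E * norm (1 - \<i> * complex_of_real (?c * ?E))" by (intro mult_left_mono) auto
  qed simp
  also have "1 / (?E * (?c * ?E)) = exp (2 * t) / ?c"
  proof -
    have "exp (2 * t) * (?E * ?E) = 1" by (simp flip: exp_add)
    then have "exp (2 * t) = 1 / (?E * ?E)" by (simp add: eq_divide_eq)
    then show ?thesis by (simp add: mult_ac)
  qed
  finally show ?thesis .
qed

text \<open>The Euclidean distance is at most \<open>exp (2 * T) / centre n\<close> and heights are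
  at least \<open>exp (-T)\<close>. The condition on \<open>centre n\<close> ensures both that the
  crossing comes later than \<open>T\<close> and that the joining segment stays at real part at most
  1, away from all edges.\<close>

lemma ray_limit_ray_dist:
  assumes t: "0 \<le> t" "t \<le> T" and c: "exp (2 * T) \<le> centre n"
  shows "S.rdist (ray n t) (limit_ray t) \<le> exp (3 * T) / centre n"
proof -
  let ?E = "exp (-t)" and ?c = "centre n"
  have c0: "0 < ?c" using centre_ge_10[of n] by linarith
  have d: "norm (rot_axis n t - imag_axis t) \<le> exp (2 * T) / ?c"
  proof -
    have "norm (rot_axis n t - imag_axis t) \<le> exp (2 * t) / ?c" by (rule rot_axis_imag_axis_dist[OF t(1)])
    also have "\<dots> \<le> exp (2 * T) / ?c" using t(2) c0 by (intro divide_right_mono) auto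
    finally show ?thesis .
  qed
  have "(exp t)\<^sup>2 = exp (2 * t)" by (simp add: power2_eq_square flip: exp_add)
  also have "\<dots> \<le> exp (2 * T)" using t(2) by simp
  also note c
  also have "?c \<le> ?c\<^sup>2 + 2"
  proof -
    have "1 * ?c \<le> ?c * ?c" using centre_ge_10[of n] by (intro mult_right_mono) auto
    then show ?thesis by (simp add: power2_eq_square)
  qed
  finally have turn: "t \<le> turn n" by (simp add: le_turn_iff)
  have m: "exp (-T) \<le> Im (rot_axis n t)"
  proof -
    have "exp (-T) \<le> ?E" using t by simp
    also have "?E * (1 + ?c\<^sup>2 * ?E\<^sup>2) \<le> ?E * (1 + ?c\<^sup>2)"
      using t by (intro mult_left_mono add_left_mono mult_left_le) (auto simp: power_le_one)
    then have "?E \<le> Im (rot_axis n t)" unfolding rot_axis_components using rot_axis_denominator_pos[of n t] by (simp add: le_divide_eq)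
    finally show ?thesis .
  qed
  have "closed_segment (rot_axis n t) (imag_axis t) \<subseteq> {w. 0 < Im w} \<inter> {w. Re w \<le> 1}"
  proof (rule closed_segment_subset)
    have "Re (rot_axis n t) \<le> norm (rot_axis n t - imag_axis t)"
      using complex_Re_le_cmod[of "rot_axis n t - imag_axis t"] by (simp add: imag_axis_def)
    also have "\<dots> \<le> 1" using d c c0 by (intro order_trans[OF d]) simp
    finally show "rot_axis n t \<in> {w. 0 < Im w} \<inter> {w. Re w \<le> 1}" using Im_rot_axis_pos by simp
    show "convex ({w. 0 < Im w} \<inter> {w. Re w \<le> 1})"
      by (intro convex_Int convex_upper_half_plane convex_halfspace_Re_le)
  qed (simp add: imag_axis_def)
  then have "closed_segment (rot_axis n t) (imag_axis t) \<subseteq> region" using region_left by blast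
  from edist_segment[OF this _ m, of True]
  have "S.edist (ray n t) (limit_ray t) \<le> ennreal (norm (rot_axis n t - imag_axis t) / exp (-T))"
    using t turn by (simp add: ray_def limit_ray_def imag_axis_def)
  then have "S.rdist (ray n t) (limit_ray t) \<le> norm (rot_axis n t - imag_axis t) / exp (-T)" by (rule rdist_le) simp
  also have "\<dots> \<le> exp (2 * T) / ?c / exp (-T)" using d by (intro divide_right_mono) auto
  also have "\<dots> = exp (3 * T) / ?c"
    using c0 by (simp add: exp_minus field_simps flip: exp_add)
  finally show ?thesis .
qed

lemma rays_converge_ray: "rays_converge S.rdist ray limit_ray"
  unfolding rays_converge_def
proof (intro allI impI)
  fix K :: "real set" and \<epsilon> :: real
  assume K: "compact K \<and> K \<subseteq> {0..}" and \<epsilon>: "0 < \<epsilon>"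
  then have "bounded K" using compact_imp_bounded by blast
  then obtain T where T': "\<And>t. t \<in> K \<Longrightarrow> norm t \<le> T" unfolding bounded_iff by blast
  have T: "t \<le> T" if "t \<in> K" for t using T'[OF that] by simp
  obtain N :: nat where N: "max (exp (2 * T)) (exp (3 * T) / \<epsilon>) < real N" using reals_Archimedean2 by blast
  have "S.rdist (ray n t) (limit_ray t) < \<epsilon>" if n: "N \<le> n" and t: "t \<in> K" for n t
  proof -
    have "real N \<le> centre n" using centre_ge_index[of n] n by linarith
    then have c: "exp (2 * T) \<le> centre n" "exp (3 * T) / \<epsilon> < centre n" using N by auto
    have "S.rdist (ray n t) (limit_ray t) \<le> exp (3 * T) / centre n"
      using K t T by (intro ray_limit_ray_dist c) auto
    also have "\<dots> < \<epsilon>" using c(2) \<epsilon> centre_ge_10[of n] by (simp add: divide_less_eq mult.commute)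
    finally show ?thesis .
  qed
  then show "\<exists>N. \<forall>n\<ge>N. \<forall>t\<in>K. S.rdist (ray n t) (limit_ray t) < \<epsilon>" by blast
qed

section \<open>Asymptotic rays and Busemann functions\<close>

lemma rays_asymptotic:
  "\<exists>T\<ge>0. \<forall>t\<ge>T. S.rdist (ray n t) (ray m t) \<le> \<bar>centre n - centre m\<bar> * exp (-t)"
proof (intro exI conjI allI impI)
  \<comment> \<open>The logarithm is what \<open>region_high\<close> asks for: from then on the
    horizontal segment at height \<open>exp t / 2\<close> between the two lines passes above all
    half-discs.\<close>
  define T where "T = max (max (turn n) (turn m)) (ln (4 * (centre n + centre m) + 8))"
  show "0 \<le> T" using turn_nonneg[of n] by (simp add: T_def)
  fix t assume "T \<le> t"
  then have t: "turn n \<le> t" "turn m \<le> t" "ln (4 * (centre n + centre m) + 8) \<le> t" by (auto simp: T_def)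
  have pos: "10 \<le> centre n" "10 \<le> centre m" by (rule centre_ge_10)+
  have "exp (ln (4 * (centre n + centre m) + 8)) \<le> exp t" using t(3) by simp
  then have e: "4 * (centre n + centre m) + 8 \<le> exp t" using pos by simp
  have "S.edist (pt False (Complex (centre n / 2) (exp t / 2))) (pt False (Complex (centre m / 2) (exp t / 2)))
      \<le> ennreal (\<bar>centre n / 2 - centre m / 2\<bar> / (exp t / 2))"
  proof (rule edist_horizontal)
    fix x assume "x \<in> closed_segment (centre n / 2) (centre m / 2)"
    then have "\<bar>x\<bar> \<le> (centre n + centre m) / 2" using pos by (auto simp: closed_segment_eq_real_ivl split: if_splits)
    then show "Complex x (exp t / 2) \<in> region" using e by (intro region_high) simp
  qed simp
  also have "\<bar>centre n / 2 - centre m / 2\<bar> / (exp t / 2) = \<bar>centre n - centre m\<bar> * exp (-t)"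
    by (simp add: exp_minus field_simps flip: diff_divide_distrib)
  finally show "S.rdist (ray n t) (ray m t) \<le> \<bar>centre n - centre m\<bar> * exp (-t)"
    unfolding ray_line[OF t(1)] ray_line[OF t(2)] line_def by (intro rdist_le) auto
qed

lemma d_infinity_rays: "d_infinity S.rdist (ray n) (ray m) < \<infinity>"
proof -
  obtain T where T: "0 \<le> T" "\<And>t. T \<le> t \<Longrightarrow> S.rdist (ray n t) (ray m t) \<le> \<bar>centre n - centre m\<bar> * exp (-t)"
    using rays_asymptotic[of n m] by blast
  have "S.rdist (ray n t) (ray m t) \<le> 2 * T + \<bar>centre n - centre m\<bar>" if t: "0 \<le> t" for t
  proof (cases "T \<le> t")
    case True
    then have "S.rdist (ray n t) (ray m t) \<le> \<bar>centre n - centre m\<bar> * exp (-t)" by (rule T(2))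
    also have "\<dots> \<le> \<bar>centre n - centre m\<bar> * 1" using t by (intro mult_left_mono) auto
    also have "\<dots> \<le> 2 * T + \<bar>centre n - centre m\<bar>" using T(1) by simp
    finally show ?thesis .
  next
    case False
    \<comment> \<open>Before \<open>T\<close> a detour through the common origin is short
      enough.\<close>
    have "S.rdist (ray n t) (ray m t) \<le> S.rdist (ray n t) (ray n 0) + S.rdist (ray n 0) (ray m t)"
      using t by (intro rdist_triangle ray_in_surface) auto
    also have "\<dots> \<le> t + t"
      using ray_short_ordered[of 0 t n] ray_short_ordered[of 0 t m] t
        S.rdist_commute[of "ray n t" "ray n 0"] ray_0[of n] ray_0[of m] by simp
    finally show ?thesis using False by linarith
  qed
  then have "d_infinity S.rdist (ray n) (ray m) \<le> ereal (2 * T + \<bar>centre n - centre m\<bar>)"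
    unfolding d_infinity_def by (intro SUP_least) simp
  then show ?thesis by (rule le_less_trans) simp
qed

lemma same_busemann_rays: "same_busemann (topspace S.M) S.rdist (ray n) (ray m)"
proof -
  interpret D: Metric_space "topspace S.M" S.rdist by (rule Metric_space_surface)
  obtain T where T: "\<And>t. T \<le> t \<Longrightarrow> S.rdist (ray n t) (ray m t) \<le> \<bar>centre n - centre m\<bar> * exp (-t)"
    using rays_asymptotic[of n m] by blast
  have "((\<lambda>t::real. exp (-t)) \<longlongrightarrow> 0) at_top"
    by (rule filterlim_compose[OF exp_at_bot filterlim_uminus_at_bot_at_top])
  then have lim: "((\<lambda>t. \<bar>centre n - centre m\<bar> * exp (-t)) \<longlongrightarrow> 0) at_top" by (rule tendsto_mult_right_zero)
  have "((\<lambda>t. S.rdist (ray n t) (ray m t)) \<longlongrightarrow> 0) at_top"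
  proof (rule Lim_null_comparison[OF _ lim])
    show "\<forall>\<^sub>F t in at_top. norm (S.rdist (ray n t) (ray m t)) \<le> \<bar>centre n - centre m\<bar> * exp (-t)"
      using eventually_ge_at_top[of T] by (rule eventually_mono) (use T S.rdist_nonneg in auto)
  qed
  then show ?thesis by (intro D.same_busemann_asymptotic ray_in_surface)
qed

text \<open>The limit ray gains nothing towards the second copy of \<open>\<i>\<close>: descending
  from height \<open>exp t\<close> to 1 costs at least \<open>t\<close> in either copy. The other
  rays end up in the second copy at height only \<open>exp t / 2\<close>, so they gain
  \<open>ln 2\<close> up to the small horizontal correction.\<close>

lemma not_same_busemann: "\<not> same_busemann (topspace S.M) S.rdist (ray n) limit_ray"
proof
  interpret D: Metric_space "topspace S.M" S.rdist by (rule Metric_space_surface)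
  let ?p = "pt True \<i>" and ?q = "pt False \<i>" and ?c = "centre n"
  assume same: "same_busemann (topspace S.M) S.rdist (ray n) limit_ray"
  have X: "?p \<in> topspace S.M" "?q \<in> topspace S.M" using region_i by (auto intro: pt_in_surface)
  have l0: "limit_ray 0 = ?p" by (simp add: limit_ray_def imag_axis_def)
  have "busemann S.rdist limit_ray (limit_ray 0) ?q \<le> 0"
  proof (rule D.busemann_ray(2)[OF is_ray_limit_ray X(2)])
    fix t :: real assume "0 \<le> t"
    then have "t \<le> S.rdist (limit_ray t) ?q"
      using rdist_ge[OF lipschitz_height pt_in_surface[OF region_imag_axis] X(2), of True t]
      unfolding limit_ray_def by (simp add: sheet_fun_pt region_imag_axis region_i) (simp add: imag_axis_def)
    then show "t - S.rdist (limit_ray t) ?q \<le> 0" by simp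
  qed
  moreover have "0 < busemann S.rdist (ray n) (ray n 0) ?q"
  proof -
    \<comment> \<open>The height is then \<open>4 * ?c + 4\<close>: enough for
      \<open>region_high\<close>, and it makes the horizontal leg of Euclidean length
      \<open>?c / 2\<close> cost at most \<open>1/8\<close>.\<close>
    define t where "t = ln (8 * ?c + 8)"
    have c: "10 \<le> ?c" by (rule centre_ge_10)
    have e: "exp t = 8 * ?c + 8" using c by (simp add: t_def)
    have t0: "0 \<le> t" using c by (simp add: t_def)
    have turn: "turn n \<le> t"
    proof -
      have "(8 * ?c + 8)\<^sup>2 = 64 * ?c\<^sup>2 + 128 * ?c + 64" by (simp add: power2_eq_square algebra_simps)
      moreover have "0 \<le> ?c\<^sup>2" by simp
      ultimately have "?c\<^sup>2 + 2 < (8 * ?c + 8)\<^sup>2" using c by linarith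
      then have "\<not> (exp t)\<^sup>2 \<le> ?c\<^sup>2 + 2" unfolding e by simp
      then show ?thesis using le_turn_iff[of t n] by linarith
    qed
    let ?y = "exp t / 2"
    have hi: "Complex x ?y \<in> region" if "x \<in> closed_segment (?c / 2) 0" for x
    proof -
      have "\<bar>x\<bar> \<le> ?c / 2" using that c by (auto simp: closed_segment_eq_real_ivl split: if_splits)
      then show ?thesis unfolding e using c by (intro region_high) simp
    qed
    have "S.edist (pt False (Complex (?c / 2) ?y)) (pt False (Complex 0 ?y)) \<le> ennreal (\<bar>?c / 2 - 0\<bar> / ?y)"
      by (rule edist_horizontal[OF _ hi]) simp
    then have "S.rdist (ray n t) (pt False (Complex 0 ?y)) \<le> \<bar>?c / 2 - 0\<bar> / ?y"
      unfolding ray_line[OF turn] line_def by (rule rdist_le) simp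
    also have "\<dots> \<le> 1 / 8" unfolding e using c by (simp add: field_simps)
    finally have 1: "S.rdist (ray n t) (pt False (Complex 0 ?y)) \<le> 1 / 8" .
    have "S.edist ?q (pt False (Complex 0 ?y)) \<le> ennreal (ln (Im (Complex 0 ?y) / Im \<i>))"
      by (rule edist_vertical[OF region_i]) (use e c in auto)
    also have "ln (Im (Complex 0 ?y) / Im \<i>) = t - ln 2" by (simp add: ln_div)
    finally have "S.rdist ?q (pt False (Complex 0 ?y)) \<le> t - ln 2"
      by (rule rdist_le) (use c in \<open>simp add: t_def\<close>)
    then have "S.rdist (ray n t) ?q \<le> 1 / 8 + (t - ln 2)"
      using 1 rdist_triangle[of "ray n t" "pt False (Complex 0 ?y)" ?q] X ray_in_surface[OF t0, of n]
        pt_in_surface[OF hi[of 0], of False] S.rdist_commute[of ?q] by simp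
    moreover have "t - S.rdist (ray n t) ?q \<le> busemann S.rdist (ray n) (ray n 0) ?q"
      by (rule D.busemann_ray(1)[OF is_ray_ray X(2) t0])
    ultimately show ?thesis using ln2_ge_two_thirds by linarith
  qed
  ultimately show False using same X unfolding same_busemann_def ray_0 l0 by force
qed

text \<open>As \<open>gap_bump j (ln (norm z))\<close> vanishes on all edges, it can be taken with opposite signs
  on the two copies of the region; this bounds their distance from below in the gap after
  the \<open>j\<close>-th edge.\<close>

definition gap_bump :: "nat \<Rightarrow> real \<Rightarrow> real" where
  "gap_bump j u = max 0 (min (u - ln (9/5 * centre j)) (ln (centre (Suc j) / 5) - u))"

lemma centre_le: "j \<le> k \<Longrightarrow> centre j \<le> centre k"
  using centre_mono[of j k] centre_ge_10[of j] by (cases "j = k") auto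

text \<open>By \<open>shell\<close> the moduli on edge \<open>k\<close> lie between
  \<open>centre k / 5\<close> and \<open>9/5 * centre k\<close>; the bump lives between these bands
  for \<open>j\<close> and \<open>Suc j\<close>.\<close>

lemma gap_bump_edge:
  assumes "z \<in> edges"
  shows "gap_bump j (ln (norm z)) = 0"
proof -
  obtain k where "cdist k z = rad k" and Im: "0 < Im z" using assms by (auto simp: edges_def region_def)
  then have k: "centre k / 5 \<le> norm z" "norm z \<le> 9/5 * centre k" using shell[OF le_rad_shell[of z k]] by auto
  have z: "0 < norm z" using Im by auto
  have pos: "10 \<le> centre j" "10 \<le> centre (Suc j)" by (rule centre_ge_10)+
  consider "k \<le> j" | "Suc j \<le> k" by linarith
  then show ?thesis
  proof cases
    case 1
    then have "norm z \<le> 9/5 * centre j" using k(2) centre_le[OF 1] by linarith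
    then have "ln (norm z) \<le> ln (9/5 * centre j)" using z pos by simp
    then show ?thesis by (simp add: gap_bump_def)
  next
    case 2
    then have "centre (Suc j) / 5 \<le> norm z" using k(1) centre_le[OF 2] by linarith
    then have "ln (centre (Suc j) / 5) \<le> ln (norm z)" using z pos by simp
    then show ?thesis by (simp add: gap_bump_def)
  qed
qed

lemma lipschitz_gap_bump:
  "S.lipschitz_fun (sheet_fun (\<lambda>s z. (if s then -1 else 1) * gap_bump j (ln (norm z))))"
proof (rule lipschitz_sheet_fun)
  fix s z w assume "z \<in> region" "w \<in> region"
  then have "\<bar>ln (norm z) - ln (norm w)\<bar> \<le> chord z w"
    using ln_norm_chord[of z w 0] region_Im by simp
  moreover have "\<bar>gap_bump j u - gap_bump j v\<bar> \<le> \<bar>u - v\<bar>" for u v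
    unfolding gap_bump_def by (smt (verit))
  ultimately have "\<bar>gap_bump j (ln (norm z)) - gap_bump j (ln (norm w))\<bar> \<le> chord z w" using order_trans by blast
  then show "\<bar>(if s then -1 else 1) * gap_bump j (ln (norm z)) - (if s then -1 else 1) * gap_bump j (ln (norm w))\<bar> \<le> chord z w"
    by (auto simp: abs_minus_commute)
qed (simp add: gap_bump_edge)

lemma d_infinity_limit_ray: "d_infinity S.rdist (ray n) limit_ray = \<infinity>"
  unfolding d_infinity_def
proof (rule SUP_PInfty)
  fix N :: nat
  \<comment> \<open>The ratio of the centres around gap \<open>j\<close> is \<open>j + 10\<close>;
    half its logarithm must exceed \<open>N\<close> by \<open>ln 5\<close>, which pays for the width
    of the bands.\<close>
  obtain j0 :: nat where j0: "exp (2 * (real N + ln 5)) < real j0" using reals_Archimedean2 by blast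
  define j where "j = max j0 n"
  have j: "exp (2 * (real N + ln 5)) \<le> real j + 10" "n \<le> j" using j0 by (auto simp: j_def)
  let ?c = "centre j" and ?c' = "centre (Suc j)"
  have c: "10 \<le> ?c" "10 \<le> ?c'" by (rule centre_ge_10)+
  \<comment> \<open>At this time the limit ray is at the logarithmic middle of the gap.\<close>
  define t where "t = (ln ?c + ln ?c') / 2"
  have t0: "0 \<le> t" using c by (simp add: t_def)
  have "ln (exp (2 * (real N + ln 5))) \<le> ln (real j + 10)" using j(1) by (subst ln_le_cancel_iff) auto
  then have gap: "2 * (real N + ln 5) \<le> ln ?c' - ln ?c"
    using c by (simp add: centre_Suc ln_mult)
  have turn: "turn n \<le> t"
  proof -
    have "(exp t)\<^sup>2 = exp (ln ?c + ln ?c')" by (simp add: t_def power2_eq_square flip: exp_add)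
    also have "\<dots> = ?c * ?c'" using c by (simp add: exp_add)
    also have "?c * (10 * ?c) \<le> ?c * ?c'" using c centre_mono[of j "Suc j"] by (intro mult_left_mono) auto
    finally have "10 * ?c\<^sup>2 \<le> (exp t)\<^sup>2" by (simp add: power2_eq_square)
    moreover have "(centre n)\<^sup>2 \<le> ?c\<^sup>2" using centre_le[OF j(2)] centre_ge_10[of n] by (intro power_mono) auto
    moreover have "100 \<le> ?c\<^sup>2" using power_mono[of 10 ?c 2] c by simp
    ultimately have "\<not> (exp t)\<^sup>2 \<le> (centre n)\<^sup>2 + 1" by linarith
    then show ?thesis using le_turn_iff[of t n] \<open>10 * ?c\<^sup>2 \<le> (exp t)\<^sup>2\<close> \<open>100 \<le> ?c\<^sup>2\<close> \<open>(centre n)\<^sup>2 \<le> ?c\<^sup>2\<close>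
      by linarith
  qed
  have bump: "real N \<le> gap_bump j t"
  proof -
    have "ln (9/5 * ?c) \<le> ln (5 * ?c)" using c by simp
    also have "\<dots> = ln 5 + ln ?c" using c by (simp add: ln_mult)
    finally have "real N \<le> t - ln (9/5 * ?c)" using gap by (simp add: t_def field_simps)
    moreover have "real N \<le> ln (?c' / 5) - t" using gap c by (simp add: t_def ln_div field_simps)
    ultimately show ?thesis by (simp add: gap_bump_def)
  qed
  let ?F = "\<lambda>s z. (if s then -1 else 1) * gap_bump j (ln (norm z))"
  have E: "?F True z = ?F False z" if "z \<in> edges" for z using gap_bump_edge[OF that] by simp
  have "sheet_fun ?F (ray n t) = ?F False (line n t)"
    unfolding ray_line[OF turn] by (rule sheet_fun_pt[OF E region_line[OF turn]])
  \<comment> \<open>Nonnegativity suffices, because the sign of the bump in the first copy is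
    negative: its size at the limit ray alone already bounds the distance.\<close>
  then have "0 \<le> sheet_fun ?F (ray n t)" by (simp add: gap_bump_def)
  moreover have "sheet_fun ?F (limit_ray t) = ?F True (imag_axis t)"
    unfolding limit_ray_def by (rule sheet_fun_pt[OF E region_imag_axis])
  then have "sheet_fun ?F (limit_ray t) = - gap_bump j t" by (simp add: imag_axis_def norm_mult)
  moreover have "\<bar>sheet_fun ?F (ray n t) - sheet_fun ?F (limit_ray t)\<bar> \<le> S.rdist (ray n t) (limit_ray t)"
    by (rule rdist_ge[OF lipschitz_gap_bump ray_in_surface[OF t0]])
      (simp add: limit_ray_def pt_in_surface region_imag_axis)
  ultimately have "real N \<le> S.rdist (ray n t) (limit_ray t)"
    using bump by linarith
  then show "\<exists>t\<in>{0..}. ereal (real N) \<le> ereal (S.rdist (ray n t) (limit_ray t))"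
    using t0 by (intro bexI[of _ t]) auto
qed

theorem theorem2:
  shows "\<exists>(M :: complex set topology) A g (\<alpha>s :: nat \<Rightarrow> real \<Rightarrow> complex set) \<alpha>.
    let X = topspace M; d = riem_dist M A g in
      hyperbolic_surface M A g \<and>
      (\<forall>n. is_ray X d (\<alpha>s n)) \<and> is_ray X d \<alpha> \<and>
      rays_converge d \<alpha>s \<alpha> \<and>
      (\<forall>n m. d_infinity d (\<alpha>s n) (\<alpha>s m) < \<infinity>) \<and>
      (\<forall>n. d_infinity d (\<alpha>s n) \<alpha> = \<infinity>) \<and>
      (\<forall>n m. same_busemann X d (\<alpha>s n) (\<alpha>s m)) \<and>
      (\<forall>n. \<not> same_busemann X d (\<alpha>s n) \<alpha>)"
  unfolding Let_def
  by (intro exI[of _ S.M] exI[of _ atlas] exI[of _ hyp_metric] exI[of _ ray] exI[of _ limit_ray]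
      conjI allI hyperbolic_surface_atlas is_ray_ray is_ray_limit_ray rays_converge_ray
      d_infinity_rays d_infinity_limit_ray same_busemann_rays not_same_busemann)

end
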